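(* Let $\Omega\subset\mathbb{R}^N$, $N\ge 3$, be a bounded domain containing the origin. Assume that $0<\mu\le\mu^*$ and that, for some $q$ with $\frac{2N}{N+2}<q<2$, $0<\gamma\le\frac{Nq-2N+2q}{2(N-q)}$. Consider the problem $-\Delta u-\frac{\mu}{|x|^2}u=\lambda u-|u|^{2\gamma}u$, $u|_{\partial\Omega}=0$, and its global branch $C_{\lambda_{1,\mu}}$ of nonnegative solutions bifurcating from $(\lambda_{1,\mu},0)$. Then: (i) The global branch $C_{\lambda_{1,\mu}}$ bends to the right of $\lambda_{1,\mu}$ (supercritical bifurcation), i.e. every $(\lambda,u)\in C_{\lambda_{1,\mu}}$ with $u\not\equiv0$ has $\lambda>\lambda_{1,\mu}$, and it is bounded for $\lambda$ bounded, i.e. for every $L>0$ the set $\{u:(\lambda,u)\in C_{\lambda_{1,\mu}},\ |\lambda|\le L\}$ is bounded in $H_\mu(\Omega)$. (ii) For every $(\lambda,u)\in C_{\lambda_{1,\mu}}$ with $u\not\equiv0$, $u$ is the unique nontrivial nonnegative solution in $H_\mu(\Omega)$ of the problem with parameter $\lambda$.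
   Context: $\mu^*=\left(\frac{N-2}{2}\right)^2$ is the best constant in Hardy's inequality $\int_\Omega|\nabla u|^2dx\ge\mu^*\int_\Omega\frac{u^2}{|x|^2}dx$. For $0<\mu\le\mu^*$, $H_\mu(\Omega)$ is the Hilbert space obtained as the completion of $C_0^\infty(\Omega)$ under the norm $\|\phi\|_\mu^2=\int_\Omega|\nabla\phi|^2dx-\mu\int_\Omega\frac{\phi^2}{|x|^2}dx$, with scalar product $(\phi,\psi)_\mu=\int_\Omega\nabla\phi\cdot\nabla\psi\,dx-\mu\int_\Omega\frac{\phi\psi}{|x|^2}dx$ (extended by continuity to the completion). A solution for $\lambda\in\mathbb{R}$ is $u\in H_\mu(\Omega)$ with $(u,\psi)_\mu=\lambda\int_\Omega u\psi\,dx-\int_\Omega|u|^{2\gamma}u\psi\,dx$ for all $\psi\in H_\mu(\Omega)$. The principal eigenvalue of $-\Delta-\frac{\mu}{|x|^2}$ is $\lambda_{1,\mu}=\inf\{\|\phi\|_\mu^2/\|\phi\|_{L^2(\Omega)}^2:\phi\in H_\mu(\Omega),\phi\not\equiv0\}$. $C_{\lambda_{1,\mu}}$ denotes the maximal connected set containing $(\lambda_{1,\mu},0)$ in the closure in $\mathbb{R}\times H_\mu(\Omega)$ of the set of pairs $(\lambda,u)$ such that $u\not\equiv0$, $u\ge0$ a.e. in $\Omega$, and $u$ is a solution for the parameter $\lambda$. *)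

theory Defs
  imports "HOL-Analysis.Analysis"
begin

text \<open>The best constant in Hardy's inequality in dimension \<open>N\<close>.\<close>

definition hardy_const :: "nat \<Rightarrow> real" where
  "hardy_const N = ((real N - 2) / 2)\<^sup>2"

definition partial :: "'n::finite \<Rightarrow> (real^'n \<Rightarrow> real) \<Rightarrow> real^'n \<Rightarrow> real" where
  "partial i f x = frechet_derivative f (at x) (axis i 1)"

definition grad :: "(real^'n::finite \<Rightarrow> real) \<Rightarrow> real^'n \<Rightarrow> real^'n" where
  "grad f x = (\<chi> i. partial i f x)"

text \<open>\<open>smooth_upto k\<close> is the class \<open>C\<^sup>k\<close>: all partial derivatives of order less than \<open>k\<close> are
  differentiable, and those of order at most \<open>k\<close> are continuous.\<close>

primrec smooth_upto :: "nat \<Rightarrow> (real^'n::finite \<Rightarrow> real) \<Rightarrow> bool" where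
  "smooth_upto 0 f \<longleftrightarrow> continuous_on UNIV f"
| "smooth_upto (Suc k) f \<longleftrightarrow> f differentiable_on UNIV \<and> (\<forall>i. smooth_upto k (partial i f))"

text \<open>\<open>C\<^sub>0\<^sup>\<infinity>(\<Omega>)\<close>; test functions are extended by zero to the whole space.\<close>

definition test_functions :: "(real^'n::finite) set \<Rightarrow> (real^'n \<Rightarrow> real) set" where
  "test_functions \<Omega> = {\<phi>. (\<forall>k. smooth_upto k \<phi>) \<and>
     compact (closure {x. \<phi> x \<noteq> 0}) \<and> closure {x. \<phi> x \<noteq> 0} \<subseteq> \<Omega>}"

definition hardy_form ::
  "(real^'n::finite) set \<Rightarrow> real \<Rightarrow> (real^'n \<Rightarrow> real) \<Rightarrow> (real^'n \<Rightarrow> real) \<Rightarrow> real" where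
  "hardy_form \<Omega> \<mu> \<phi> \<psi> =
     (LINT x:\<Omega>|lebesgue. grad \<phi> x \<bullet> grad \<psi> x) - \<mu> * (LINT x:\<Omega>|lebesgue. \<phi> x * \<psi> x / (norm x)\<^sup>2)"

text \<open>A Hilbert space \<open>'h\<close> together with \<open>emb\<close> is (a model of) \<open>H\<^sub>\<mu>(\<Omega>)\<close>, the completion of
  \<open>C\<^sub>0\<^sup>\<infinity>(\<Omega>)\<close> under the scalar product \<^const>\<open>hardy_form\<close>: \<open>emb\<close> is linear, carries \<^const>\<open>hardy_form\<close>
  to the scalar product of \<open>'h\<close> and has dense range. This determines \<open>'h\<close> up to a unique isometric
  isomorphism compatible with the embeddings. Values of \<open>emb\<close> outside \<open>C\<^sub>0\<^sup>\<infinity>(\<Omega>)\<close> are irrelevant.\<close>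

definition is_H_mu ::
  "(real^'n::finite) set \<Rightarrow> real \<Rightarrow> ((real^'n \<Rightarrow> real) \<Rightarrow> 'h::{real_inner,complete_space}) \<Rightarrow> bool" where
  "is_H_mu \<Omega> \<mu> emb \<longleftrightarrow>
     (\<forall>\<phi>\<in>test_functions \<Omega>. \<forall>\<psi>\<in>test_functions \<Omega>. \<forall>a b.
        emb (\<lambda>x. a * \<phi> x + b * \<psi> x) = a *\<^sub>R emb \<phi> + b *\<^sub>R emb \<psi>) \<and>
     (\<forall>\<phi>\<in>test_functions \<Omega>. \<forall>\<psi>\<in>test_functions \<Omega>. emb \<phi> \<bullet> emb \<psi> = hardy_form \<Omega> \<mu> \<phi> \<psi>) \<and>
     closure (emb ` test_functions \<Omega>) = UNIV"

text \<open>An element \<open>u\<close> of the completion is identified with the function on \<open>\<Omega>\<close> that is the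
  \<open>L\<^sup>2(\<Omega>)\<close>-limit of test functions converging to \<open>u\<close> in \<open>H\<^sub>\<mu>(\<Omega>)\<close>. For \<open>0 < \<mu> \<le> \<mu>\<^sup>*\<close> and bounded \<open>\<Omega>\<close>, the
  improved Hardy inequality makes \<open>L\<^sup>2(\<Omega>)\<close>-norms bounded by \<open>H\<^sub>\<mu>(\<Omega>)\<close>-norms, so such a function
  exists and is unique up to null sets; \<open>fn_of\<close> picks a representative.\<close>

definition represents ::
  "(real^'n::finite) set \<Rightarrow> ((real^'n \<Rightarrow> real) \<Rightarrow> 'h::{real_inner,complete_space}) \<Rightarrow>
   'h \<Rightarrow> (real^'n \<Rightarrow> real) \<Rightarrow> bool" where
  "represents \<Omega> emb u f \<longleftrightarrow> f \<in> borel_measurable (lebesgue_on \<Omega>) \<and>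
     (\<exists>\<phi>. (\<forall>n. \<phi> n \<in> test_functions \<Omega>) \<and> (\<lambda>n. emb (\<phi> n)) \<longlonglongrightarrow> u \<and>
       (\<lambda>n. \<integral>\<^sup>+x. ennreal ((\<phi> n x - f x)\<^sup>2) \<partial>lebesgue_on \<Omega>) \<longlonglongrightarrow> 0)"

definition fn_of ::
  "(real^'n::finite) set \<Rightarrow> ((real^'n \<Rightarrow> real) \<Rightarrow> 'h::{real_inner,complete_space}) \<Rightarrow>
   'h \<Rightarrow> real^'n \<Rightarrow> real" where
  "fn_of \<Omega> emb u = (SOME f. represents \<Omega> emb u f)"

definition lambda1 ::
  "(real^'n::finite) set \<Rightarrow> ((real^'n \<Rightarrow> real) \<Rightarrow> 'h::{real_inner,complete_space}) \<Rightarrow> real" where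
  "lambda1 \<Omega> emb =
     Inf {(norm \<phi>)\<^sup>2 / (LINT x:\<Omega>|lebesgue. (fn_of \<Omega> emb \<phi> x)\<^sup>2) | \<phi>. \<phi> \<noteq> 0}"

text \<open>The integrability clause says that the nonlinear term is meaningful, since the Bochner integral
  of a non-integrable function is 0 by convention. It holds automatically whenever \<open>H\<^sub>\<mu>(\<Omega>)\<close> embeds
  into \<open>L\<^sup>p(\<Omega>)\<close> with \<open>p = 2\<gamma> + 2\<close>.\<close>

definition is_solution ::
  "(real^'n::finite) set \<Rightarrow> ((real^'n \<Rightarrow> real) \<Rightarrow> 'h::{real_inner,complete_space}) \<Rightarrow>
   real \<Rightarrow> real \<Rightarrow> 'h \<Rightarrow> bool" where
  "is_solution \<Omega> emb \<gamma> l u \<longleftrightarrow> (\<forall>\<psi>.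
     set_integrable lebesgue \<Omega>
       (\<lambda>x. \<bar>fn_of \<Omega> emb u x\<bar> powr (2 * \<gamma>) * fn_of \<Omega> emb u x * fn_of \<Omega> emb \<psi> x) \<and>
     u \<bullet> \<psi> = l * (LINT x:\<Omega>|lebesgue. fn_of \<Omega> emb u x * fn_of \<Omega> emb \<psi> x)
       - (LINT x:\<Omega>|lebesgue.
            \<bar>fn_of \<Omega> emb u x\<bar> powr (2 * \<gamma>) * fn_of \<Omega> emb u x * fn_of \<Omega> emb \<psi> x))"

definition nontrivial_nonneg_solution ::
  "(real^'n::finite) set \<Rightarrow> ((real^'n \<Rightarrow> real) \<Rightarrow> 'h::{real_inner,complete_space}) \<Rightarrow>
   real \<Rightarrow> real \<Rightarrow> 'h \<Rightarrow> bool" where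
  "nontrivial_nonneg_solution \<Omega> emb \<gamma> l u \<longleftrightarrow>
     u \<noteq> 0 \<and> (AE x in lebesgue_on \<Omega>. 0 \<le> fn_of \<Omega> emb u x) \<and> is_solution \<Omega> emb \<gamma> l u"

definition global_branch ::
  "(real^'n::finite) set \<Rightarrow> ((real^'n \<Rightarrow> real) \<Rightarrow> 'h::{real_inner,complete_space}) \<Rightarrow>
   real \<Rightarrow> (real \<times> 'h) set" where
  "global_branch \<Omega> emb \<gamma> =
     connected_component_set (closure {(l, u). nontrivial_nonneg_solution \<Omega> emb \<gamma> l u})
       (lambda1 \<Omega> emb, 0)"

end

theory Submission
  imports Defs
begin

text \<open>
  For \<open>r = |x|\<close> and \<open>a = (N - 2) / 2\<close>, writing \<open>\<phi> = r\<^sup>-\<^sup>a w\<close> turns the Hardy form into the weighted Dirichlet form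
  \<open>\<integral> r\<^sup>2\<^sup>-\<^sup>N |\<nabla>w|\<^sup>2 + (\<mu>\<^sup>* - \<mu>) \<integral> r\<^sup>-\<^sup>N w\<^sup>2\<close> on functions supported away from the origin, and these are dense because points have
  zero capacity for \<open>N \<ge> 3\<close>. Hence smooth contractions applied to \<open>w\<close> do not increase the norm, also for the critical \<open>\<mu>\<close>.

  Testing with smoothed absolute values shows that the nonlinear term is a bounded functional as soon as the equation
  holds for test functions, so nonnegative solutions pass to limits and every nonzero point of the branch is a solution.
  Testing with \<open>u\<close> itself gives \<open>\<lambda> > \<lambda>\<^sub>1\<close> and the bound on the branch.

  Testing with \<open>\<phi>\<^sup>2 / (u + \<epsilon>)\<close> (in the variable \<open>w\<close>) controls the gradient of \<open>ln (u + \<epsilon>)\<close> locally, so by the Poincare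
  inequality and connectedness nontrivial solutions are positive almost everywhere; Picone's inequality then says that a
  positive solution \<open>u\<close> is the ground state of \<open>- \<Delta> - \<mu> / r\<^sup>2 + u\<^sup>2\<^sup>\<gamma>\<close>. Using this for two solutions \<open>u\<close>, \<open>v\<close> with the test
  function \<open>u - v\<close> forces \<open>u = v\<close>.
\<close>

section \<open>Smooth functions\<close>

text \<open>The completion is abstract: its elements carry no gradient, and at the critical \<mu>
  the functions attached to them need not have a square integrable one. So every nonlinear test
  function (absolute value, truncation, regularised quotient) is built on approximating test
  functions that vanish near the origin, where the substitution is classical, and only then passed
  to the limit. Two devices do this: norms that do not increase, together with L^2 convergence, give
  convergence in the completion; and in an inner product whose first argument converges it is enough
  that the second stays bounded. As test functions are infinitely differentiable, truncations must
  be smooth, vanish at 0 and have slope at most 1, which explains sqrt(s^2 + d^2) - d and s / sqrt(1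
  + s^2/k^2). The L^2 bound comes from the field \<phi>^2 x, because N - 2a = 2 is positive whatever
  \<mu> is. Limits of the nonlinear term rest on the energy identity: it bounds the integral of
  |u|^(2\<gamma>+2) along a sequence of solutions, which makes |u|^(2\<gamma>+1)
  equi-integrable.\<close>

definition has_grad :: "(real^'n::finite \<Rightarrow> real) \<Rightarrow> real^'n \<Rightarrow> real^'n \<Rightarrow> bool" where
  "has_grad f G x \<longleftrightarrow> (f has_derivative (\<lambda>h. G \<bullet> h)) (at x)"

text \<open>Calculus is done on the relation \<open>has_grad\<close>, which carries
  differentiability along. Only the final value is read off as \<open>grad\<close>, which rests on a
  choice and obeys no rules where differentiability fails.\<close>

lemma has_grad_unique: "has_grad f G x \<Longrightarrow> grad f x = G"
  unfolding has_grad_def grad_def partial_def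
  by (simp add: vec_eq_iff frechet_derivative_at[symmetric] inner_axis)

lemma has_grad_differentiable: "has_grad f G x \<Longrightarrow> f differentiable at x"
  unfolding has_grad_def differentiable_def by blast

lemma has_grad_grad:
  assumes "f differentiable at x"
  shows "has_grad f (grad f x) x"
proof -
  obtain D where D: "(f has_derivative D) (at x)"
    using assms differentiable_def by blast
  interpret bounded_linear D using D has_derivative_bounded_linear by blast
  have fd: "frechet_derivative f (at x) = D"
    using D frechet_derivative_at by metis
  have "D h = grad f x \<bullet> h" for h
  proof -
    have "D h = D (\<Sum>i\<in>UNIV. (h $ i) *\<^sub>R axis i 1)"
      using basis_expansion[of h] by (simp add: scalar_mult_eq_scaleR)
    also have "\<dots> = (\<Sum>i\<in>UNIV. h $ i * D (axis i 1))"
      by (simp add: sum scale)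
    finally show ?thesis
      by (simp add: grad_def partial_def fd inner_vec_def mult.commute)
  qed
  then show ?thesis using D unfolding has_grad_def by presburger
qed

lemma partial_has_grad: "has_grad f G x \<Longrightarrow> partial i f x = G $ i"
  using has_grad_unique[of f G x] by (auto simp: grad_def)

lemma has_grad_const: "has_grad (\<lambda>_. c) 0 x"
  by (simp add: has_grad_def)

lemma has_grad_coord: "has_grad (\<lambda>x. x $ i) (axis i 1) x"
  unfolding has_grad_def
  by (rule has_derivative_eq_rhs[OF bounded_linear_imp_has_derivative[OF bounded_linear_vec_nth]])
     (simp add: inner_axis' fun_eq_iff)

lemma has_grad_add: "has_grad f F x \<Longrightarrow> has_grad g G x \<Longrightarrow> has_grad (\<lambda>x. f x + g x) (F + G) x"
  unfolding has_grad_def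
  by (rule has_derivative_eq_rhs, rule has_derivative_add) (auto simp: inner_add_left)

lemma has_grad_mult:
  "has_grad f F x \<Longrightarrow> has_grad g G x \<Longrightarrow> has_grad (\<lambda>x. f x * g x) (f x *\<^sub>R G + g x *\<^sub>R F) x"
  unfolding has_grad_def
  by (rule has_derivative_eq_rhs, rule has_derivative_mult) (auto simp: inner_add_left)

lemma has_grad_compose:
  assumes "(F has_real_derivative d) (at (f x))" "has_grad f G x"
  shows "has_grad (\<lambda>x. F (f x)) (d *\<^sub>R G) x"
  using has_derivative_compose[of f "\<lambda>h. G \<bullet> h" x UNIV F "(*) d"] assms
  unfolding has_grad_def has_field_derivative_def
  by (simp add: inner_scaleR_left[abs_def])

lemma has_grad_norm2: "has_grad (\<lambda>x. x \<bullet> x) (2 *\<^sub>R x) x"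
  unfolding has_grad_def
  by (rule has_derivative_eq_rhs, rule has_derivative_inner[OF has_derivative_ident has_derivative_ident])
     (auto simp: inner_commute)

lemma has_grad_norm_powr:
  assumes "x \<noteq> 0"
  shows "has_grad (\<lambda>x. norm x powr b) ((b * norm x powr (b - 2)) *\<^sub>R x) x"
proof -
  have "((\<lambda>s. s powr (b / 2)) has_real_derivative b / 2 * (x \<bullet> x) powr (b / 2 - 1)) (at (x \<bullet> x))"
    using assms by (intro has_real_derivative_powr) auto
  from has_grad_compose[OF this has_grad_norm2]
  have *: "has_grad (\<lambda>x. (x \<bullet> x) powr (b / 2)) ((b * (x \<bullet> x) powr (b / 2 - 1)) *\<^sub>R x) x"
    by simp
  have e: "(y \<bullet> y) powr c = norm y powr (2 * c)" for y :: "real^'a" and c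
    by (simp add: dot_square_norm powr_powr flip: powr_numeral)
  show ?thesis using * by (simp add: e algebra_simps)
qed

lemma has_grad_transform:
  assumes "has_grad f G x" "open S" "x \<in> S" "\<And>y. y \<in> S \<Longrightarrow> f y = g y"
  shows "has_grad g G x"
  using assms has_derivative_transform_within_open[of f _ x UNIV S g] unfolding has_grad_def by blast

lemma grad_eq_0_outside:
  assumes "open S" "x \<in> S" "\<And>y. y \<in> S \<Longrightarrow> f y = 0"
  shows "has_grad f 0 x"
  using has_grad_transform[OF has_grad_const[of 0] assms(1,2)] assms(3) by simp

text \<open>A relative version of \<open>smooth_upto\<close>: powers of the norm are smooth only off
  the origin, and products with them must be differentiated there before they are known to
  extend.\<close>

primrec smooth_on_upto :: "nat \<Rightarrow> (real^'n::finite) set \<Rightarrow> (real^'n \<Rightarrow> real) \<Rightarrow> bool" where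
  "smooth_on_upto 0 S f \<longleftrightarrow> continuous_on S f"
| "smooth_on_upto (Suc k) S f \<longleftrightarrow>
     (\<forall>x\<in>S. f differentiable at x) \<and> (\<forall>i. smooth_on_upto k S (partial i f))"

definition smooth_on :: "(real^'n::finite) set \<Rightarrow> (real^'n \<Rightarrow> real) \<Rightarrow> bool" where
  "smooth_on S f \<longleftrightarrow> (\<forall>k. smooth_on_upto k S f)"

lemma smooth_on_upto_UNIV: "smooth_on_upto k UNIV f = smooth_upto k f"
  by (induction k arbitrary: f) (auto simp: differentiable_on_def)

lemma test_functions_iff:
  "\<phi> \<in> test_functions S \<longleftrightarrow> smooth_on UNIV \<phi> \<and>
     compact (closure {x. \<phi> x \<noteq> 0}) \<and> closure {x. \<phi> x \<noteq> 0} \<subseteq> S"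
  by (simp add: test_functions_def smooth_on_def smooth_on_upto_UNIV)

lemma smooth_on_upto_mono: "T \<subseteq> S \<Longrightarrow> smooth_on_upto k S f \<Longrightarrow> smooth_on_upto k T f"
  by (induction k arbitrary: f) (auto intro: continuous_on_subset)

lemma smooth_on_mono: "smooth_on S f \<Longrightarrow> T \<subseteq> S \<Longrightarrow> smooth_on T f"
  using smooth_on_upto_mono unfolding smooth_on_def by blast

lemma smooth_on_upto_Suc: "smooth_on_upto (Suc k) S f \<Longrightarrow> smooth_on_upto k S f"
proof (induction k arbitrary: f)
  case 0
  then show ?case
    by (auto intro!: continuous_at_imp_continuous_on differentiable_imp_continuous_within)
qed auto

lemma partial_cong:
  assumes "open S" "x \<in> S" "\<And>y. y \<in> S \<Longrightarrow> f y = g y" "f differentiable at x"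
  shows "partial i f x = partial i g x"
  using has_grad_transform[OF has_grad_grad[OF assms(4)] assms(1,2), of g] assms(3)
  by (metis partial_has_grad has_grad_grad assms(4))

lemma smooth_on_upto_cong:
  assumes "open S" "smooth_on_upto k S f" "\<And>x. x \<in> S \<Longrightarrow> f x = g x"
  shows "smooth_on_upto k S g"
  using assms(2,3)
proof (induction k arbitrary: f g)
  case 0
  then show ?case by (simp cong: continuous_on_cong)
next
  case (Suc k)
  have "g differentiable at x" if "x \<in> S" for x
    using has_grad_transform[OF has_grad_grad \<open>open S\<close> that, of f g] Suc.prems that
    by (auto intro: has_grad_differentiable)
  moreover have "smooth_on_upto k S (partial i g)" for i
    by (rule Suc.IH[of "partial i f"])
       (use Suc.prems partial_cong[OF \<open>open S\<close>, of _ f g] in auto)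
  ultimately show ?case by simp
qed

lemma smooth_on_cong:
  "open S \<Longrightarrow> smooth_on S f \<Longrightarrow> (\<And>x. x \<in> S \<Longrightarrow> f x = g x) \<Longrightarrow> smooth_on S g"
  using smooth_on_upto_cong unfolding smooth_on_def by blast

lemma smooth_on_upto_Un:
  assumes "open S" "open T" shows "smooth_on_upto k S f \<Longrightarrow> smooth_on_upto k T f \<Longrightarrow> smooth_on_upto k (S \<union> T) f"
  by (induction k arbitrary: f) (auto intro: continuous_on_open_Un assms)

lemma smooth_on_Un: "open S \<Longrightarrow> open T \<Longrightarrow> smooth_on S f \<Longrightarrow> smooth_on T f \<Longrightarrow> smooth_on (S \<union> T) f"
  using smooth_on_upto_Un unfolding smooth_on_def by blast

lemma smooth_onD_differentiable: "smooth_on S f \<Longrightarrow> x \<in> S \<Longrightarrow> f differentiable at x"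
  unfolding smooth_on_def using smooth_on_upto.simps(2)[of 0] by blast

lemma smooth_on_partial: "smooth_on S f \<Longrightarrow> smooth_on S (partial i f)"
  unfolding smooth_on_def using smooth_on_upto.simps(2) by blast

lemma smooth_on_continuous: "smooth_on S f \<Longrightarrow> continuous_on S f"
  unfolding smooth_on_def using smooth_on_upto.simps(1) by blast

lemma smooth_on_has_grad: "smooth_on S f \<Longrightarrow> x \<in> S \<Longrightarrow> has_grad f (grad f x) x"
  by (simp add: has_grad_grad smooth_onD_differentiable)

lemma smooth_on_continuous_grad: "smooth_on S f \<Longrightarrow> continuous_on S (grad f)"
  unfolding grad_def by (intro continuous_intros smooth_on_continuous smooth_on_partial)

lemma smooth_on_upto_const: "smooth_on_upto k S (\<lambda>_. c)"
proof (induction k arbitrary: c)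
  case (Suc k)
  have "partial i (\<lambda>_::real^'a. c) = (\<lambda>_. 0)" for i
    using partial_has_grad[OF has_grad_const] by fastforce
  then show ?case using Suc by simp
qed simp

lemma smooth_on_const: "smooth_on S (\<lambda>_. c)"
  by (simp add: smooth_on_def smooth_on_upto_const)

lemma smooth_on_coord: "smooth_on S (\<lambda>x. x $ i)"
proof -
  have "smooth_on_upto k S (\<lambda>x. x $ i)" for k
  proof (cases k)
    case (Suc k)
    have "partial j (\<lambda>x::real^'a. x $ i) = (\<lambda>_. axis i 1 $ j)" for j
      using partial_has_grad[OF has_grad_coord] by fastforce
    then show ?thesis using Suc
      by (simp add: smooth_on_upto_const has_grad_differentiable[OF has_grad_coord])
  qed (auto intro: continuous_intros)
  then show ?thesis by (simp add: smooth_on_def)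
qed

lemma smooth_on_upto_add:
  assumes "open S"
  shows "smooth_on_upto k S f \<Longrightarrow> smooth_on_upto k S g \<Longrightarrow> smooth_on_upto k S (\<lambda>x. f x + g x)"
proof (induction k arbitrary: f g)
  case (Suc k)
  have *: "has_grad (\<lambda>x. f x + g x) (grad f x + grad g x) x" if "x \<in> S" for x
    using Suc.prems that by (intro has_grad_add has_grad_grad) auto
  have "smooth_on_upto k S (partial i (\<lambda>x. f x + g x))" for i
    by (rule smooth_on_upto_cong[OF \<open>open S\<close> Suc.IH[of "partial i f" "partial i g"]])
       (use Suc.prems partial_has_grad[OF *] in \<open>auto simp: grad_def\<close>)
  then show ?case using * by (auto intro: has_grad_differentiable)
qed (auto intro: continuous_intros)

lemma smooth_on_add: "open S \<Longrightarrow> smooth_on S f \<Longrightarrow> smooth_on S g \<Longrightarrow> smooth_on S (\<lambda>x. f x + g x)"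
  using smooth_on_upto_add unfolding smooth_on_def by blast

lemma smooth_on_upto_mult:
  assumes "open S"
  shows "smooth_on_upto k S f \<Longrightarrow> smooth_on_upto k S g \<Longrightarrow> smooth_on_upto k S (\<lambda>x. f x * g x)"
proof (induction k arbitrary: f g)
  case (Suc k)
  have *: "has_grad (\<lambda>x. f x * g x) (f x *\<^sub>R grad g x + g x *\<^sub>R grad f x) x" if "x \<in> S" for x
    using Suc.prems that by (intro has_grad_mult has_grad_grad) auto
  have "smooth_on_upto k S (partial i (\<lambda>x. f x * g x))" for i
    by (rule smooth_on_upto_cong[OF \<open>open S\<close> smooth_on_upto_add[OF \<open>open S\<close>
          Suc.IH[of f "partial i g"] Suc.IH[of g "partial i f"]]])
       (use Suc.prems smooth_on_upto_Suc partial_has_grad[OF *] in \<open>auto simp: grad_def\<close>)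
  then show ?case using * by (auto intro: has_grad_differentiable)
qed (auto intro: continuous_intros)

lemma smooth_on_mult: "open S \<Longrightarrow> smooth_on S f \<Longrightarrow> smooth_on S g \<Longrightarrow> smooth_on S (\<lambda>x. f x * g x)"
  using smooth_on_upto_mult unfolding smooth_on_def by blast

lemma smooth_on_cmult: "open S \<Longrightarrow> smooth_on S g \<Longrightarrow> smooth_on S (\<lambda>x. c * g x)"
  by (rule smooth_on_mult[OF _ smooth_on_const])

lemma smooth_on_diff: "open S \<Longrightarrow> smooth_on S f \<Longrightarrow> smooth_on S g \<Longrightarrow> smooth_on S (\<lambda>x. f x - g x)"
  using smooth_on_add[of S f "\<lambda>x. -1 * g x"] smooth_on_cmult[of S g "-1"] by simp

lemma smooth_on_sum:
  assumes "open S"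
  shows "finite I \<Longrightarrow> (\<And>i. i \<in> I \<Longrightarrow> smooth_on S (f i)) \<Longrightarrow> smooth_on S (\<lambda>x. \<Sum>i\<in>I. f i x)"
  by (induction I rule: finite_induct) (auto simp: smooth_on_const intro!: smooth_on_add assms)

lemma smooth_on_norm2: "open S \<Longrightarrow> smooth_on S (\<lambda>x. x \<bullet> x)"
  unfolding inner_vec_def inner_real_def
  by (intro smooth_on_sum smooth_on_mult smooth_on_coord) auto

text \<open>The outer function comes with its whole chain of derivatives \<open>g n\<close>, in
  place of a separate notion of smoothness on the real line. The induction treats all
  \<open>n\<close> at once, because a partial derivative of \<open>g n\<close> after
  \<open>\<phi>\<close> contains \<open>g (Suc n)\<close>.\<close>

lemma smooth_on_compose:
  assumes "open S" "smooth_on S \<phi>" "\<And>x. x \<in> S \<Longrightarrow> \<phi> x \<in> T"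
    and g: "\<And>n s. s \<in> T \<Longrightarrow> (g n has_real_derivative g (Suc n) s) (at s)"
  shows "smooth_on S (\<lambda>x. g 0 (\<phi> x))"
proof -
  have "smooth_on_upto k S (\<lambda>x. g n (\<phi> x))" for k n
  proof (induction k arbitrary: n)
    case 0
    have "continuous_on T (g n)"
      by (rule DERIV_continuous_on) (use g in \<open>auto intro: DERIV_subset\<close>)
    then show ?case
      using continuous_on_compose2[of T "g n" S \<phi>] smooth_on_continuous[OF assms(2)] assms(3) by auto
  next
    case (Suc k)
    have *: "has_grad (\<lambda>x. g n (\<phi> x)) (g (Suc n) (\<phi> x) *\<^sub>R grad \<phi> x) x" if "x \<in> S" for x
      using assms that by (intro has_grad_compose g smooth_on_has_grad) auto
    have "smooth_on_upto k S (partial i (\<lambda>x. g n (\<phi> x)))" for i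
      by (rule smooth_on_upto_cong[OF \<open>open S\<close> smooth_on_upto_mult[OF \<open>open S\<close> Suc.IH[of "Suc n"], of "partial i \<phi>"]])
         (use smooth_on_partial[OF assms(2), of i] partial_has_grad[OF *] in \<open>auto simp: grad_def smooth_on_def\<close>)
    then show ?case using * by (auto intro: has_grad_differentiable)
  qed
  then show ?thesis by (simp add: smooth_on_def)
qed

lemma smooth_on_powr:
  assumes "open S" "smooth_on S \<phi>" "\<And>x. x \<in> S \<Longrightarrow> \<phi> x > 0"
  shows "smooth_on S (\<lambda>x. \<phi> x powr b)"
proof -
  \<comment> \<open>The n-th derivative of s powr b, with the falling factorial of b in
    front.\<close>
  define g where "g n s = (\<Prod>j<n. b - real j) * s powr (b - real n)" for n :: nat and s :: real
  have "(g n has_real_derivative g (Suc n) s) (at s)" if "s \<in> {0<..}" for n s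
    unfolding g_def using that
    by (auto intro!: derivative_eq_intros has_real_derivative_powr simp: algebra_simps)
  from smooth_on_compose[OF assms(1,2), of "{0<..}" g, OF _ this] assms(3)
  show ?thesis by (simp add: g_def)
qed

lemma smooth_on_norm_powr: "smooth_on (-{0}) (\<lambda>x. norm x powr b)"
proof -
  have "smooth_on (-{0}) (\<lambda>x::real^'a. (x \<bullet> x) powr (b / 2))"
    by (intro smooth_on_powr smooth_on_norm2) auto
  moreover have "(x \<bullet> x) powr (b / 2) = norm x powr b" for x :: "real^'a"
    by (simp add: dot_square_norm powr_powr flip: powr_numeral)
  ultimately show ?thesis by simp
qed

lemma smooth_on_inverse:
  assumes "open S" "smooth_on S \<phi>" "\<And>x. x \<in> S \<Longrightarrow> \<phi> x > 0"
  shows "smooth_on S (\<lambda>x. 1 / \<phi> x)"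
  by (rule smooth_on_cong[OF assms(1) smooth_on_powr[OF assms, of "-1"]])
     (use assms(3) in \<open>auto simp: powr_minus_divide less_imp_le\<close>)

text \<open>Gluing: \<open>f\<close> is smooth on \<open>T\<close>, which contains the support of
  \<open>\<phi>\<close>, and vanishes off that support; these two open sets cover the space.
  Expressions singular at the origin thus become test functions as soon as they vanish together with
  some \<open>\<phi>\<close> supported away from it.\<close>

lemma test_functionsI:
  assumes "\<phi> \<in> test_functions S" "S \<subseteq> T" "open T" "smooth_on T f" "\<And>x. \<phi> x = 0 \<Longrightarrow> f x = 0"
  shows "f \<in> test_functions S"
proof -
  let ?K = "closure {x. \<phi> x \<noteq> 0}"
  have K: "compact ?K" "?K \<subseteq> S" using assms(1) by (auto simp: test_functions_iff)
  have sub: "closure {x. f x \<noteq> 0} \<subseteq> ?K" using assms(5) by (intro closure_mono) auto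
  have "f x = 0" if "x \<in> - ?K" for x
    using that closure_subset[of "{x. \<phi> x \<noteq> 0}"] assms(5) by blast
  then have "smooth_on (- ?K) f"
    using smooth_on_cong[OF _ smooth_on_const[of _ 0], of "- ?K" f] by auto
  then have "smooth_on (T \<union> - ?K) f"
    using assms(3,4) by (intro smooth_on_Un) auto
  moreover have "T \<union> - ?K = UNIV" using K assms(2) by auto
  ultimately show ?thesis
    using K sub by (auto simp: test_functions_iff compact_eq_bounded_closed intro: bounded_subset)
qed

section \<open>Bump and cutoff functions\<close>

definition bump1 :: "real \<Rightarrow> real" where
  "bump1 t = (if t > 0 then exp (- (1 / t)) else 0)"

lemma poly_div_exp_tendsto_0: "((\<lambda>s. poly P s / exp s) \<longlongrightarrow> 0) at_top" for P :: "real poly"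
proof -
  have "((\<lambda>s. \<Sum>i\<le>degree P. coeff P i * (s ^ i / exp s)) \<longlongrightarrow> (\<Sum>i\<le>degree P. coeff P i * 0)) at_top"
    by (intro tendsto_intros tendsto_power_div_exp_0)
  then show ?thesis by (simp add: poly_altdef sum_divide_distrib)
qed

lemma smooth_on_bump1:
  assumes "open S" "smooth_on S \<phi>"
  shows "smooth_on S (\<lambda>x. bump1 (\<phi> x))"
proof -
  \<comment> \<open>For t > 0 the n-th derivative is p n (1/t) exp(-1/t). Since 1/t has derivative
    -(1/t)^2, one more differentiation gives the polynomial s^2 (p - p') in s = 1/t.\<close>
  define p :: "nat \<Rightarrow> real poly" where
    "p = rec_nat 1 (\<lambda>_ q. [:0, 0, 1:] * (q - pderiv q))"
  have pS: "p (Suc n) = [:0, 0, 1:] * (p n - pderiv (p n))" for n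
    by (simp add: p_def)
  have p0: "p 0 = 1" by (simp add: p_def)
  define g where "g n t = (if t > 0 then poly (p n) (1 / t) * exp (- (1 / t)) else 0)" for n and t :: real
  have "(g n has_real_derivative g (Suc n) t) (at t)" for n t
  proof (cases t "0::real" rule: linorder_cases)
    case less
    have "(g n has_real_derivative 0) (at t) \<longleftrightarrow> ((\<lambda>_. 0) has_real_derivative 0) (at t)"
      by (rule DERIV_cong_ev)
         (use eventually_nhds_in_open[of "{..<0}" t] less in \<open>auto simp: g_def elim!: eventually_mono\<close>)
    then show ?thesis using less by (simp add: g_def)
  next
    case greater
    have "(g n has_real_derivative g (Suc n) t) (at t) \<longleftrightarrow>
        ((\<lambda>t. poly (p n) (1 / t) * exp (- (1 / t))) has_real_derivative g (Suc n) t) (at t)"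
      by (rule DERIV_cong_ev)
         (use eventually_nhds_in_open[of "{0<..}" t] greater in \<open>auto simp: g_def elim!: eventually_mono\<close>)
    moreover have "((\<lambda>t. poly (p n) (1 / t) * exp (- (1 / t))) has_real_derivative g (Suc n) t) (at t)"
      using greater unfolding g_def pS
      by (auto intro!: derivative_eq_intros simp: field_simps power2_eq_square)
    ultimately show ?thesis by simp
  next
    case equal
    \<comment> \<open>With s = 1/t this quotient is s * p n (s) / exp s, which tends to 0 as s
      grows; hence the polynomial \<open>pCons 0 (p n)\<close>.\<close>
    have "((\<lambda>t. g n t / t) \<longlongrightarrow> 0) (at_right 0)"
    proof -
      have "eventually (\<lambda>s. poly (pCons 0 (p n)) s / exp s = g n (inverse s) / inverse s) at_top"
        using eventually_gt_at_top[of 0]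
        by eventually_elim (auto simp: g_def field_simps exp_minus)
      then have "((\<lambda>s. g n (inverse s) / inverse s) \<longlongrightarrow> 0) at_top"
        by (rule Lim_transform_eventually[OF poly_div_exp_tendsto_0])
      then show ?thesis by (simp add: filterlim_at_right_to_top)
    qed
    moreover have "((\<lambda>t. g n t / t) \<longlongrightarrow> 0) (at_left 0)"
      by (rule tendsto_eventually) (auto simp: g_def eventually_at_filter)
    ultimately have "((\<lambda>t. g n t / t) \<longlongrightarrow> 0) (at 0)"
      using filterlim_split_at by blast
    then show ?thesis using equal by (simp add: has_field_derivative_iff g_def)
  qed
  from smooth_on_compose[OF assms, of UNIV g, OF _ this]
  show ?thesis by (simp add: g_def bump1_def p0 cong: if_cong)
qed

lemma bump1_nonneg: "bump1 t \<ge> 0" and bump1_pos_iff: "bump1 t > 0 \<longleftrightarrow> t > 0"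
  by (auto simp: bump1_def)

lemma bump_exists:
  fixes c :: "real^'n::finite"
  assumes "r > 0"
  shows "\<exists>\<phi>. smooth_on UNIV \<phi> \<and> (\<forall>x. \<phi> x \<ge> 0) \<and> (\<forall>x. \<phi> x > 0 \<longleftrightarrow> dist c x < r)"
proof -
  let ?q = "\<lambda>x. r\<^sup>2 - (\<Sum>i\<in>UNIV. (x $ i - c $ i) * (x $ i - c $ i))"
  have q: "?q x = r\<^sup>2 - (dist c x)\<^sup>2" for x
    by (auto simp: dist_norm power2_norm_eq_inner inner_vec_def algebra_simps intro!: sum.cong)
  have "smooth_on UNIV (\<lambda>x. bump1 (?q x))"
    by (intro smooth_on_bump1 smooth_on_diff smooth_on_sum smooth_on_mult smooth_on_coord smooth_on_const) auto
  moreover have "bump1 (?q x) > 0 \<longleftrightarrow> dist c x < r" for x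
    using assms unfolding q bump1_pos_iff
    by (metis abs_of_pos abs_le_square_iff diff_gt_0_iff_gt not_le abs_of_nonneg zero_le_dist)
  ultimately show ?thesis using bump1_nonneg by (intro exI[of _ "\<lambda>x. bump1 (?q x)"]) blast
qed

lemma cutoff_exists:
  "\<exists>\<zeta> :: real^'n::finite \<Rightarrow> real. smooth_on UNIV \<zeta> \<and> (\<forall>x. 0 \<le> \<zeta> x \<and> \<zeta> x \<le> 1 \<and>
     (norm x \<le> 1 \<longrightarrow> \<zeta> x = 0) \<and> (norm x \<ge> 2 \<longrightarrow> \<zeta> x = 1))"
proof (intro exI conjI allI impI)
  define q :: "real^'n \<Rightarrow> real" where "q x = x \<bullet> x" for x
  \<comment> \<open>The transition takes place for 1 < q < 2, that is, before the norm reaches 2.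
    The two bumps never vanish together, so the denominator is positive.\<close>
  let ?z = "\<lambda>x. bump1 (q x - 1) * (1 / (bump1 (q x - 1) + bump1 (2 - q x)))"
  have q: "q x = (norm x)\<^sup>2" for x by (simp add: q_def power2_norm_eq_inner)
  have sq: "smooth_on UNIV q" unfolding q_def by (intro smooth_on_norm2) auto
  have pos: "bump1 (q x - 1) + bump1 (2 - q x) > 0" for x
    using bump1_nonneg[of "q x - 1"] bump1_nonneg[of "2 - q x"] bump1_pos_iff[of "q x - 1"]
      bump1_pos_iff[of "2 - q x"] by (cases "q x > 1") linarith+
  show "smooth_on UNIV ?z"
    by (intro smooth_on_mult smooth_on_inverse smooth_on_add smooth_on_bump1 smooth_on_diff smooth_on_const sq pos) auto
  fix x
  show "0 \<le> ?z x" using pos[of x] bump1_nonneg by simp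
  show "?z x \<le> 1" using pos[of x] bump1_nonneg[of "2 - q x"] by simp
  show "norm x \<le> 1 \<Longrightarrow> ?z x = 0" using power_le_one[of "norm x" 2] by (simp add: q bump1_def)
  assume "norm x \<ge> 2"
  then have "q x \<ge> 2\<^sup>2" unfolding q by (intro power_mono) auto
  then show "?z x = 1" using pos[of x] by (auto simp: bump1_def)
qed

section \<open>Test functions and integration by parts\<close>

lemma tendsto_inverse_Suc: "(\<lambda>n. 1 / (real n + 1)) \<longlonglongrightarrow> 0"
  using LIMSEQ_Suc[OF lim_1_over_n[where 'a=real]] by (simp add: add.commute)

lemma test_functions_smooth: "\<phi> \<in> test_functions S \<Longrightarrow> smooth_on UNIV \<phi>"
  by (simp add: test_functions_iff)

lemma test_functions_has_grad: "\<phi> \<in> test_functions S \<Longrightarrow> has_grad \<phi> (grad \<phi> x) x"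
  by (rule smooth_on_has_grad[OF test_functions_smooth UNIV_I])

lemma test_functions_continuous: "\<phi> \<in> test_functions S \<Longrightarrow> continuous_on A \<phi>"
  by (rule continuous_on_subset[OF smooth_on_continuous[OF test_functions_smooth] subset_UNIV])

lemma test_functions_continuous_grad: "\<phi> \<in> test_functions S \<Longrightarrow> continuous_on A (grad \<phi>)"
  by (rule continuous_on_subset[OF smooth_on_continuous_grad[OF test_functions_smooth] subset_UNIV])

lemma test_functions_mono: "\<phi> \<in> test_functions S \<Longrightarrow> S \<subseteq> T \<Longrightarrow> \<phi> \<in> test_functions T"
  by (auto simp: test_functions_iff)

lemma test_functions_support:
  assumes "\<phi> \<in> test_functions S" "x \<notin> closure {x. \<phi> x \<noteq> 0}"
  shows "\<phi> x = 0" "grad \<phi> x = 0"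
proof -
  define K where "K = closure {x. \<phi> x \<noteq> 0}"
  have *: "\<phi> y = 0" if "y \<in> - K" for y
    using that closure_subset[of "{x. \<phi> x \<noteq> 0}"] unfolding K_def by blast
  have x: "x \<in> - K" using assms(2) by (simp add: K_def)
  then show "\<phi> x = 0" by (rule *)
  have "open (- K)" by (simp add: K_def open_Compl)
  then have "has_grad \<phi> 0 x" by (rule grad_eq_0_outside[OF _ x *])
  then show "grad \<phi> x = 0" by (rule has_grad_unique)
qed

lemma test_functions_outside:
  assumes "\<phi> \<in> test_functions S" "x \<notin> S"
  shows "\<phi> x = 0" "grad \<phi> x = 0"
  using test_functions_support[OF assms(1), of x] assms by (auto simp: test_functions_iff)

lemma continuous_compact_support_bounded:
  fixes f :: "'a::t2_space \<Rightarrow> 'b::real_normed_vector"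
  assumes "continuous_on UNIV f" "compact K" "\<And>x. x \<notin> K \<Longrightarrow> f x = 0"
  shows "\<exists>B>0. \<forall>x. norm (f x) \<le> B"
proof -
  have "bounded (f ` K)"
    by (intro compact_imp_bounded compact_continuous_image continuous_on_subset[OF assms(1)] assms(2)) auto
  then obtain B where B: "B > 0" "\<And>x. x \<in> K \<Longrightarrow> norm (f x) \<le> B"
    unfolding bounded_pos by auto
  then have "norm (f x) \<le> B" for x
    using assms(3)[of x] by (cases "x \<in> K") auto
  then show ?thesis using B by blast
qed

lemma test_functions_bounded:
  assumes "\<phi> \<in> test_functions S"
  shows "\<exists>B>0. (\<forall>x. \<bar>\<phi> x\<bar> \<le> B) \<and> (\<forall>x. norm (grad \<phi> x) \<le> B)"
proof -
  have K: "compact (closure {x. \<phi> x \<noteq> 0})" using assms by (simp add: test_functions_iff)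
  obtain B1 where "B1 > 0" "\<forall>x. norm (\<phi> x) \<le> B1"
    using continuous_compact_support_bounded[OF test_functions_continuous[OF assms] K]
      test_functions_support[OF assms] by blast
  moreover obtain B2 where "B2 > 0" "\<forall>x. norm (grad \<phi> x) \<le> B2"
    using continuous_compact_support_bounded[OF test_functions_continuous_grad[OF assms] K]
      test_functions_support[OF assms] by blast
  ultimately show ?thesis by (intro exI[of _ "max B1 B2"]) (auto simp: le_max_iff_disj)
qed

lemma test_functions_partial: "\<phi> \<in> test_functions S \<Longrightarrow> partial i \<phi> \<in> test_functions S"
proof -
  assume A: "\<phi> \<in> test_functions S"
  let ?K = "closure {x. \<phi> x \<noteq> 0}"
  have "{x. partial i \<phi> x \<noteq> 0} \<subseteq> ?K"
    using test_functions_support(2)[OF A] by (auto simp: grad_def vec_eq_iff)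
  then have "closure {x. partial i \<phi> x \<noteq> 0} \<subseteq> ?K" by (metis closure_closure closure_mono)
  then show ?thesis using A smooth_on_partial[of UNIV \<phi> i]
    by (auto simp: test_functions_iff compact_eq_bounded_closed intro: bounded_subset)
qed

lemma test_functions_mult_smooth:
  assumes "\<phi> \<in> test_functions S" "S \<subseteq> T" "open T" "smooth_on T f"
  shows "(\<lambda>x. \<phi> x * f x) \<in> test_functions S"
  by (rule test_functionsI[OF assms(1-3)])
     (use assms smooth_on_mono[OF test_functions_smooth[OF assms(1)]] in \<open>auto intro!: smooth_on_mult\<close>)

lemma test_functions_mult:
  assumes "\<phi> \<in> test_functions S" "\<psi> \<in> test_functions T"
  shows "(\<lambda>x. \<phi> x * \<psi> x) \<in> test_functions S"
  by (rule test_functions_mult_smooth[OF assms(1) subset_UNIV open_UNIV test_functions_smooth[OF assms(2)]])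

lemma test_functions_lincomb:
  assumes "\<phi> \<in> test_functions S" "\<psi> \<in> test_functions S"
  shows "(\<lambda>x. a * \<phi> x + b * \<psi> x) \<in> test_functions S"
proof -
  let ?K = "closure {x. \<phi> x \<noteq> 0}" let ?L = "closure {x. \<psi> x \<noteq> 0}"
  have "closure {x. a * \<phi> x + b * \<psi> x \<noteq> 0} \<subseteq> closure ({x. \<phi> x \<noteq> 0} \<union> {x. \<psi> x \<noteq> 0})"
    by (intro closure_mono) auto
  also have "\<dots> = ?K \<union> ?L" by simp
  finally have "closure {x. a * \<phi> x + b * \<psi> x \<noteq> 0} \<subseteq> ?K \<union> ?L" .
  moreover have "smooth_on UNIV (\<lambda>x. a * \<phi> x + b * \<psi> x)"
    using assms by (intro smooth_on_add smooth_on_cmult) (auto simp: test_functions_iff)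
  ultimately show ?thesis using assms
    by (auto simp: test_functions_iff compact_eq_bounded_closed intro: bounded_subset[of "?K \<union> ?L"])
qed

section \<open>Integration by parts on the whole space\<close>

lemma translation_integral_lborel:
  fixes f :: "'a::euclidean_space \<Rightarrow> real"
  assumes "f \<in> borel_measurable borel"
  shows "(LINT x|lborel. f (x + c)) = (LINT x|lborel. f x)"
proof -
  have "(LINT x|lborel. f x) = (LINT x|distr lborel borel ((+) c). f x)"
    by (simp add: lborel_distr_plus)
  also have "\<dots> = (LINT x|lborel. f (c + x))"
    using assms by (intro integral_distr) auto
  finally show ?thesis by (simp add: add.commute)
qed

lemma has_grad_lipschitz:
  assumes "\<And>x. has_grad f (grad f x) x" "\<And>x. norm (grad f x) \<le> B"
  shows "\<bar>f x - f y\<bar> \<le> B * norm (x - y)"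
proof -
  have "onorm (\<lambda>h. grad f z \<bullet> h) \<le> B" for z
  proof (rule onorm_le)
    fix h
    have "\<bar>grad f z \<bullet> h\<bar> \<le> norm (grad f z) * norm h" by (rule Cauchy_Schwarz_ineq2)
    also have "\<dots> \<le> B * norm h" using assms(2) by (intro mult_right_mono) auto
    finally show "norm (grad f z \<bullet> h) \<le> B * norm h" by simp
  qed
  then show ?thesis
    using differentiable_bound[of UNIV f "\<lambda>z h. grad f z \<bullet> h" B x y] assms(1)
    by (simp add: has_grad_def has_derivative_at_withinI)
qed

text \<open>Difference quotients have integral 0 by translation invariance, and they converge
  boundedly, on a fixed ball, to the derivative. Dominated convergence thus takes the place of
  iterated integration.\<close>

lemma integral_partial_eq_0:
  assumes "f \<in> test_functions S"
  shows "(LINT x|lborel. partial i f x) = 0"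
proof -
  obtain B where B: "B > 0" "\<And>x. \<bar>f x\<bar> \<le> B" "\<And>x. norm (grad f x) \<le> B"
    using test_functions_bounded[OF assms] by blast
  define K where "K = closure {x. f x \<noteq> 0}"
  have "bounded K" using assms by (simp add: K_def test_functions_iff compact_imp_bounded)
  then obtain R where "R > 0" and RK: "\<forall>x\<in>K. norm x \<le> R" unfolding bounded_pos by blast
  have R: "f x = 0" if "norm x > R" for x
  proof -
    have "x \<notin> K" using RK that by force
    then show ?thesis using test_functions_support(1)[OF assms] unfolding K_def by blast
  qed
  have fm: "f \<in> borel_measurable borel"
    using test_functions_continuous[OF assms] by (intro borel_measurable_continuous_onI) auto
  have fi: "integrable lborel f"
  proof (rule Bochner_Integration.integrable_bound[where f="\<lambda>x. B * indicator (cball 0 R) x"])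
    show "integrable lborel (\<lambda>x::real^'a. B * indicator (cball 0 R) x)"
      using emeasure_lborel_cball_finite[of "0::real^'a" R]
      by (intro integrable_mult_right integrable_real_indicator) auto
    have "\<bar>f x\<bar> \<le> B * indicator (cball 0 R) x" for x
      using R[of x] B(2)[of x] by (cases "norm x \<le> R") auto
    then show "AE x in lborel. norm (f x) \<le> norm (B * indicator (cball 0 R) x)"
      using B(1) by (auto simp: abs_mult)
  qed (use fm in simp)
  define t :: "nat \<Rightarrow> real" where "t n = 1 / (real n + 1)" for n
  have t: "t n > 0" "t n \<le> 1" for n by (auto simp: t_def)
  have t0: "t \<longlonglongrightarrow> 0" unfolding t_def by (rule tendsto_inverse_Suc)
  define g where "g n x = (f (x + t n *\<^sub>R axis i 1) - f x) / t n" for n x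
  \<comment> \<open>Steps have length at most 1, so the quotients vanish outside radius R + 1;
    inside, the Lipschitz constant \<open>B\<close> bounds them for every n.\<close>
  have gb: "\<bar>g n x\<bar> \<le> B * indicator (cball 0 (R + 1)) x" for n x
  proof (cases "x \<in> cball 0 (R + 1)")
    case True
    have "\<bar>f (x + t n *\<^sub>R axis i 1) - f x\<bar> \<le> B * norm (t n *\<^sub>R axis i (1::real))"
      using has_grad_lipschitz[of f B "x + t n *\<^sub>R axis i 1" x] test_functions_has_grad[OF assms] B(3) by simp
    then show ?thesis using True t[of n] by (simp add: g_def field_simps)
  next
    case False
    have "norm x \<le> norm (x + t n *\<^sub>R axis i 1) + norm (t n *\<^sub>R axis i (1::real))"
      by (metis add_diff_cancel_right' norm_triangle_ineq4)
    then have "norm (x + t n *\<^sub>R axis i 1) > R" "norm x > R"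
      using False t[of n] by auto
    then show ?thesis using False R by (simp add: g_def)
  qed
  have fti: "integrable lborel (\<lambda>x. f (x + c))" for c
    using integrable_distr[of "(+) c" lborel borel f] fi by (simp add: lborel_distr_plus add.commute)
  have "(LINT x|lborel. g n x) = 0" for n
    unfolding g_def using fi fti translation_integral_lborel[OF fm] by simp
  moreover have "(\<lambda>n. LINT x|lborel. g n x) \<longlonglongrightarrow> (LINT x|lborel. partial i f x)"
  proof (rule integral_dominated_convergence[where w="\<lambda>x. B * indicator (cball 0 (R + 1)) x"])
    show "partial i f \<in> borel_measurable lborel"
      using test_functions_continuous[OF test_functions_partial[OF assms]]
      by (simp add: borel_measurable_continuous_onI)
    show "g n \<in> borel_measurable lborel" for n
      unfolding g_def using fm by measurable
    show "integrable lborel (\<lambda>x::real^'a. B * indicator (cball 0 (R + 1)) x)"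
      using emeasure_lborel_cball_finite[of "0::real^'a" "R+1"]
      by (intro integrable_mult_right integrable_real_indicator) auto
    show "AE x in lborel. (\<lambda>n. g n x) \<longlonglongrightarrow> partial i f x"
    proof (rule AE_I2)
      fix x
      let ?h = "\<lambda>s. f (x + s *\<^sub>R axis i 1)"
      have "((\<lambda>s. x + s *\<^sub>R axis i 1) has_derivative (\<lambda>s. s *\<^sub>R axis i (1::real))) (at 0)"
        by (auto intro!: derivative_eq_intros)
      moreover have "(f has_derivative (\<lambda>h. grad f x \<bullet> h)) (at (x + 0 *\<^sub>R axis i 1))"
        using test_functions_has_grad[OF assms, of x] by (simp add: has_grad_def)
      ultimately have "(?h has_derivative (\<lambda>s. grad f x \<bullet> (s *\<^sub>R axis i 1))) (at 0)"
        by (rule has_derivative_compose)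
      then have "(?h has_real_derivative partial i f x) (at 0)"
        by (simp add: has_field_derivative_def grad_def inner_axis mult.commute[of _ "partial i f x"])
      then have "((\<lambda>s. (?h s - ?h 0) / (s - 0)) \<longlongrightarrow> partial i f x) (at 0)"
        by (simp add: has_field_derivative_iff)
      moreover have "filterlim t (at 0) sequentially"
        using t t0 by (auto simp: filterlim_at less_imp_neq[symmetric])
      ultimately show "(\<lambda>n. g n x) \<longlonglongrightarrow> partial i f x"
        using filterlim_compose[of "\<lambda>s. (?h s - ?h 0) / (s - 0)" _ "at 0" t] by (simp add: g_def)
    qed
    show "AE x in lborel. norm (g n x) \<le> B * indicator (cball 0 (R + 1)) x" for n
      using gb by simp
  qed
  ultimately show ?thesis by (simp add: LIMSEQ_const_iff)
qed

section \<open>Bounded open domains and a divergence identity\<close>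

locale bounded_open =
  fixes \<Omega> :: "(real^'n::finite) set"
  assumes open_Om: "open \<Omega>" and bounded_Om: "bounded \<Omega>"
begin

abbreviation M :: "(real^'n) measure" where "M \<equiv> lebesgue_on \<Omega>"
abbreviation "\<T> \<equiv> test_functions \<Omega>"
abbreviation "\<D> \<equiv> test_functions (\<Omega> - {0})"

lemma Om_lmeasurable: "\<Omega> \<in> lmeasurable"
  using open_Om bounded_Om by (intro bounded_set_imp_lmeasurable) auto

lemma Om_sets: "\<Omega> \<in> sets lebesgue"
  using Om_lmeasurable by auto

sublocale M: finite_measure M
  using Om_lmeasurable by (rule finite_measure_lebesgue_on)

lemma D_subset_T: "\<phi> \<in> \<D> \<Longrightarrow> \<phi> \<in> \<T>"
  by (rule test_functions_mono) auto

lemma measurable_continuous: "continuous_on \<Omega> f \<Longrightarrow> f \<in> borel_measurable M"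
  by (rule continuous_imp_measurable_on_sets_lebesgue[OF _ Om_sets])

lemma measurable_norm [measurable]: "norm \<in> borel_measurable M"
  by (intro measurable_continuous continuous_intros)

lemma measurable_ident [measurable]: "(\<lambda>x. x) \<in> borel_measurable M"
  by (intro measurable_continuous continuous_intros)

lemma measurable_test: "\<phi> \<in> test_functions S \<Longrightarrow> \<phi> \<in> borel_measurable M"
  by (intro measurable_continuous test_functions_continuous)

lemma measurable_grad: "\<phi> \<in> test_functions S \<Longrightarrow> grad \<phi> \<in> borel_measurable M"
  by (intro measurable_continuous test_functions_continuous_grad)

lemma integrable_bounded:
  fixes f :: "real^'n \<Rightarrow> real"
  assumes "f \<in> borel_measurable M" "\<And>x. x \<in> \<Omega> \<Longrightarrow> \<bar>f x\<bar> \<le> B"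
  shows "integrable M f"
  using assms by (intro M.integrable_const_bound[of _ B]) (auto simp: AE_I2)

lemma integral_M_lborel:
  fixes f :: "real^'n \<Rightarrow> real"
  assumes "f \<in> borel_measurable borel" "\<And>x. x \<notin> \<Omega> \<Longrightarrow> f x = 0"
  shows "integral\<^sup>L M f = integral\<^sup>L lborel f"
proof -
  have "integral\<^sup>L M f = (LINT x|lebesgue. indicator \<Omega> x *\<^sub>R f x)"
    using Om_sets by (intro integral_restrict_space) auto
  also have "\<dots> = integral\<^sup>L lebesgue f"
    using assms(2) by (intro Bochner_Integration.integral_cong) (auto simp: indicator_def)
  also have "\<dots> = integral\<^sup>L lborel f"
    using assms(1) by (intro integral_completion) auto
  finally show ?thesis .
qed

lemma integral_partial_M:
  assumes "f \<in> \<T>"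
  shows "(LINT x|M. partial i f x) = 0"
proof -
  have "partial i f \<in> \<T>" using assms by (rule test_functions_partial)
  then show ?thesis
    using integral_M_lborel[of "partial i f"] integral_partial_eq_0[OF assms, of i]
    by (simp add: test_functions_outside borel_measurable_continuous_onI test_functions_continuous)
qed

text \<open>The divergence of the field f g x integrates to 0, and a gradient of \<open>g\<close>
  parallel to x makes its terms explicit. Support of \<open>f\<close> in \<open>T\<close> allows
  \<open>g\<close> to be singular at the origin. The weights 1, 1/(r^2 + d) and r^-2 will give the
  L^2 bound, a Hardy inequality and the substitution formula.\<close>

lemma integral_div_radial:
  assumes f: "f \<in> \<T>" "f \<in> test_functions T" and T: "open T" "smooth_on T g"
    and g: "\<And>x. x \<in> T \<Longrightarrow> has_grad g (\<gamma> x *\<^sub>R x) x"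
  shows "(LINT x|M. real CARD('n) * (f x * g x) + f x * \<gamma> x * (norm x)\<^sup>2 + g x * (grad f x \<bullet> x)) = 0"
proof -
  define h where "h i x = f x * (g x * x $ i)" for i x
  have T2: "h i \<in> test_functions (\<Omega> \<inter> T)" for i
  proof -
    have "f \<in> test_functions (\<Omega> \<inter> T)" using f by (auto simp: test_functions_iff)
    then show ?thesis unfolding h_def
      by (rule test_functions_mult_smooth[OF _ _ T(1)]) (auto intro!: smooth_on_mult T smooth_on_coord)
  qed
  then have hT: "h i \<in> \<T>" for i using test_functions_mono by blast
  have eq: "real CARD('n) * (f x * g x) + f x * \<gamma> x * (norm x)\<^sup>2 + g x * (grad f x \<bullet> x) =
      (\<Sum>i\<in>UNIV. partial i (h i) x)" for x
  proof (cases "x \<in> T")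
    case True
    have "has_grad (h i) (f x *\<^sub>R (g x *\<^sub>R axis i 1 + x $ i *\<^sub>R \<gamma> x *\<^sub>R x) + (g x * x $ i) *\<^sub>R grad f x) x" for i
      unfolding h_def
      by (intro has_grad_mult has_grad_coord g True test_functions_has_grad[OF f(1)])
    from partial_has_grad[OF this]
    have "(\<Sum>i\<in>UNIV. partial i (h i) x) =
        (\<Sum>i\<in>UNIV. f x * g x + f x * \<gamma> x * (x $ i * x $ i) + g x * (grad f x $ i * x $ i))"
      by (intro sum.cong) (auto simp: axis_def algebra_simps)
    also have "\<dots> = real CARD('n) * (f x * g x) + f x * \<gamma> x * (norm x)\<^sup>2 + g x * (grad f x \<bullet> x)"
      by (simp add: sum.distrib sum_distrib_left[symmetric] inner_vec_def power2_norm_eq_inner)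
    finally show ?thesis by simp
  next
    case False
    then have "partial i (h i) x = 0" for i
      using test_functions_outside[OF test_functions_partial[OF T2]] by blast
    then show ?thesis using False test_functions_outside[OF f(2)] by simp
  qed
  have "integrable M (\<lambda>x. partial i (h i) x)" for i
  proof -
    have *: "partial i (h i) \<in> \<T>" using hT test_functions_partial by blast
    then obtain B where "\<And>x. \<bar>partial i (h i) x\<bar> \<le> B" using test_functions_bounded by metis
    then show ?thesis using measurable_test[OF *] integrable_bounded by blast
  qed
  then show ?thesis unfolding eq by (simp add: integral_partial_M[OF hT])
qed

end

section \<open>Hardy's inequality and the ground state substitution\<close>

locale hardy_domain = bounded_open \<Omega> for \<Omega> :: "(real^'n::finite) set" +
  fixes \<mu> :: real
  assumes dim: "CARD('n) \<ge> 3" and zero_in: "0 \<in> \<Omega>"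
    and mu_pos: "0 < \<mu>" and mu_le: "\<mu> \<le> hardy_const CARD('n)"
begin

text \<open>The exponent \<open>a\<close> satisfies \<open>a\<^sup>2 = \<mu>\<^sup>*\<close>, and \<open>norm x powr (- a)\<close> is the virtual ground state of the critical
  Hardy operator.\<close>

definition a :: real where "a = (real CARD('n) - 2) / 2"
text \<open>The gap between \<mu> and its critical value: the weight of the potential that survives
  the substitution.\<close>

definition \<kappa> :: real where "\<kappa> = a\<^sup>2 - \<mu>"
definition radius :: real where "radius = (SOME R. R > 0 \<and> (\<forall>x\<in>\<Omega>. norm x \<le> R))"

lemma dim_eq: "real CARD('n) = 2 * a + 2" and a_pos: "a > 0"
  using dim by (auto simp: a_def field_simps)

lemma \<kappa>_nonneg: "\<kappa> \<ge> 0"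
  using mu_le by (simp add: \<kappa>_def a_def hardy_const_def)

lemma radius_pos: "radius > 0" and norm_le_radius: "x \<in> \<Omega> \<Longrightarrow> norm x \<le> radius"
proof -
  have "\<exists>R. R > 0 \<and> (\<forall>x\<in>\<Omega>. norm x \<le> R)" using bounded_Om unfolding bounded_pos by auto
  then have "radius > 0 \<and> (\<forall>x\<in>\<Omega>. norm x \<le> radius)" unfolding radius_def by (rule someI_ex)
  then show "radius > 0" "x \<in> \<Omega> \<Longrightarrow> norm x \<le> radius" by auto
qed

abbreviation form where "form \<phi> \<psi> \<equiv> hardy_form \<Omega> \<mu> \<phi> \<psi>"

lemma form_eq: "form \<phi> \<psi> = (LINT x|M. grad \<phi> x \<bullet> grad \<psi> x) - \<mu> * (LINT x|M. \<phi> x * \<psi> x / (norm x)\<^sup>2)"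
  unfolding hardy_form_def set_lebesgue_integral_def
  using Om_sets by (simp add: integral_restrict_space)

lemma integrable_test_bounded:
  assumes "\<phi> \<in> test_functions S" "f \<in> borel_measurable M" "\<And>x. \<bar>f x\<bar> \<le> C * \<bar>\<phi> x\<bar>" "C \<ge> 0"
  shows "integrable M f"
proof -
  obtain B where "\<And>x. \<bar>\<phi> x\<bar> \<le> B" using test_functions_bounded[OF assms(1)] by blast
  then have "\<bar>f x\<bar> \<le> C * B" for x
    using assms(3)[of x] assms(4) by (meson mult_left_mono order_trans)
  then show ?thesis using integrable_bounded assms(2) by blast
qed

lemma integrable_grad_grad:
  assumes "\<phi> \<in> test_functions S" "\<psi> \<in> test_functions T"
  shows "integrable M (\<lambda>x. grad \<phi> x \<bullet> grad \<psi> x)"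
proof -
  obtain B C where B: "\<And>x. norm (grad \<phi> x) \<le> B" and C: "\<And>x. norm (grad \<psi> x) \<le> C"
    using test_functions_bounded[OF assms(1)] test_functions_bounded[OF assms(2)] by metis
  show ?thesis
  proof (rule integrable_bounded)
    show "(\<lambda>x. grad \<phi> x \<bullet> grad \<psi> x) \<in> borel_measurable M"
      using measurable_grad[OF assms(1)] measurable_grad[OF assms(2)] by measurable
    show "\<bar>grad \<phi> x \<bullet> grad \<psi> x\<bar> \<le> B * C" for x
      using B[of x] C[of x] Cauchy_Schwarz_ineq2[of "grad \<phi> x" "grad \<psi> x"]
      by (smt (verit) mult_mono norm_ge_zero)
  qed
qed

lemma integrable_test: "\<phi> \<in> test_functions S \<Longrightarrow> integrable M \<phi>"
  by (rule integrable_test_bounded[of \<phi> _ _ 1]) (auto simp: measurable_test)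

text \<open>The divergence identity for the square of \<open>\<phi>\<close> with the weight 1/(r^2 +
  d), which is smooth on the whole space. The constant 4 is 4/(N - 2)^2 at N = 3 and serves all
  larger dimensions; the bound is uniform in \<open>d\<close>.\<close>

lemma hardy_regularized:
  assumes "\<phi> \<in> \<T>" "d > 0"
  shows "(LINT x|M. (\<phi> x)\<^sup>2 / (x \<bullet> x + d)) \<le> 4 * (LINT x|M. grad \<phi> x \<bullet> grad \<phi> x)"
proof -
  let ?g = "\<lambda>x::real^'n. 1 / (x \<bullet> x + d)" and ?\<gamma> = "\<lambda>x::real^'n. - 2 / (x \<bullet> x + d)\<^sup>2"
  let ?f = "\<lambda>x. \<phi> x * \<phi> x"
  have pos: "x \<bullet> x + d > 0" for x :: "real^'n" using assms(2) by (simp add: add_nonneg_pos)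
  have f: "?f \<in> \<T>" by (rule test_functions_mult[OF assms(1) assms(1)])
  have g1: "smooth_on UNIV ?g"
    by (intro smooth_on_inverse smooth_on_add smooth_on_norm2 smooth_on_const pos) auto
  have "has_grad ?g (?\<gamma> x *\<^sub>R x) x" for x
  proof -
    have "((\<lambda>s. 1 / (s + d)) has_real_derivative - 1 / (x \<bullet> x + d)\<^sup>2) (at (x \<bullet> x))"
      using pos[of x] by (auto intro!: derivative_eq_intros simp: power2_eq_square)
    from has_grad_compose[OF this has_grad_norm2] show ?thesis by simp
  qed
  note D = integral_div_radial[OF f test_functions_mono[OF f subset_UNIV] open_UNIV g1 this]
  have gf: "grad ?f x = (2 * \<phi> x) *\<^sub>R grad \<phi> x" for x
    using has_grad_unique[OF has_grad_mult[OF test_functions_has_grad[OF assms(1)] test_functions_has_grad[OF assms(1)]], of x]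
    by (simp add: scaleR_add_left[symmetric])
  have m[measurable]: "\<phi> \<in> borel_measurable M" "grad \<phi> \<in> borel_measurable M"
    using measurable_test measurable_grad assms(1) by blast+
  have ge: "real CARD('n) * (?f x * ?g x) + ?f x * ?\<gamma> x * (norm x)\<^sup>2 + ?g x * (grad ?f x \<bullet> x)
      \<ge> (1/2) * ((\<phi> x)\<^sup>2 / (x \<bullet> x + d)) - 2 * (grad \<phi> x \<bullet> grad \<phi> x)" for x
  proof -
    define s where "s = x \<bullet> x + d"
    have s0: "s > 0" using pos by (simp add: s_def)
    have s: "(norm x)\<^sup>2 \<le> s" using assms(2) by (simp add: s_def power2_norm_eq_inner)
    \<comment> \<open>Chosen for the square |b x + grad \<phi>|^2: twice that square absorbs the
      mixed term. All terms b^2 |x|^2 together amount to 10 b^2 |x|^2, at most (5/2) \<phi>^2/s, so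
      that 3 - 5/2 = 1/2 of \<phi>^2/s survives.\<close>
    define b where "b = \<phi> x / (2 * s)"
    have b1: "2 * \<phi> x / s = 4 * b" by (simp add: b_def)
    have b2: "(\<phi> x)\<^sup>2 * (norm x)\<^sup>2 / s\<^sup>2 = 4 * (b\<^sup>2 * (norm x)\<^sup>2)"
      using s0 by (simp add: b_def power_divide power_mult_distrib)
    have "(\<phi> x)\<^sup>2 * (norm x)\<^sup>2 / s\<^sup>2 \<le> (\<phi> x)\<^sup>2 * s / s\<^sup>2"
      using s by (intro divide_right_mono mult_left_mono) auto
    then have 1: "4 * (b\<^sup>2 * (norm x)\<^sup>2) \<le> (\<phi> x)\<^sup>2 / s"
      unfolding b2 using s0 by (simp add: power2_eq_square[of s])
    have 2: "real CARD('n) * ((\<phi> x)\<^sup>2 / s) \<ge> 3 * ((\<phi> x)\<^sup>2 / s)"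
      using dim s0 by (intro mult_right_mono) auto
    have "0 \<le> (norm (b *\<^sub>R x + grad \<phi> x))\<^sup>2 * 2" by simp
    also have "\<dots> = 2 * (b\<^sup>2 * (norm x)\<^sup>2) + 4 * b * (grad \<phi> x \<bullet> x) + 2 * (grad \<phi> x \<bullet> grad \<phi> x)"
      unfolding power2_norm_eq_inner
      by (simp add: inner_add_left inner_add_right inner_commute[of x "grad \<phi> x"] power2_eq_square[of b] algebra_simps)
    finally have 3: "0 \<le> 2 * (b\<^sup>2 * (norm x)\<^sup>2) + 4 * b * (grad \<phi> x \<bullet> x) + 2 * (grad \<phi> x \<bullet> grad \<phi> x)" .
    have "real CARD('n) * (?f x * ?g x) + ?f x * ?\<gamma> x * (norm x)\<^sup>2 + ?g x * (grad ?f x \<bullet> x)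
      = real CARD('n) * ((\<phi> x)\<^sup>2 / s) - 2 * ((\<phi> x)\<^sup>2 * (norm x)\<^sup>2 / s\<^sup>2) + 2 * \<phi> x / s * (grad \<phi> x \<bullet> x)"
      unfolding s_def[symmetric] gf by (simp add: power2_eq_square[of "\<phi> x"])
    also have "\<dots> = real CARD('n) * ((\<phi> x)\<^sup>2 / s) - 8 * (b\<^sup>2 * (norm x)\<^sup>2) + 4 * b * (grad \<phi> x \<bullet> x)"
      unfolding b1 b2 by simp
    finally show ?thesis unfolding s_def[symmetric] using 1 2 3 by linarith
  qed
  have i1: "integrable M (\<lambda>x. (\<phi> x)\<^sup>2 / (x \<bullet> x + d))"
  proof (rule integrable_test_bounded[OF f, of _ "1 / d"])
    show "(\<lambda>x. (\<phi> x)\<^sup>2 / (x \<bullet> x + d)) \<in> borel_measurable M" by measurable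
    have "\<phi> x ^ 2 / (x \<bullet> x + d) \<le> \<phi> x ^ 2 / d" for x
      using assms(2) by (intro divide_left_mono) (auto simp: add_nonneg_pos)
    then show "\<bar>(\<phi> x)\<^sup>2 / (x \<bullet> x + d)\<bar> \<le> 1 / d * \<bar>\<phi> x * \<phi> x\<bar>" for x
      using pos[of x] by (simp add: power2_eq_square abs_mult)
  qed (use assms(2) in simp)
  have i2: "integrable M (\<lambda>x. real CARD('n) * (?f x * ?g x) + ?f x * ?\<gamma> x * (norm x)\<^sup>2 + ?g x * (grad ?f x \<bullet> x))"
  proof -
    obtain B where B: "B > 0" "\<And>x. \<bar>\<phi> x\<bar> \<le> B" "\<And>x. norm (grad \<phi> x) \<le> B" using test_functions_bounded[OF assms(1)] by blast
    let ?F = "\<lambda>x. real CARD('n) * (?f x * ?g x) + ?f x * ?\<gamma> x * (norm x)\<^sup>2 + ?g x * (grad ?f x \<bullet> x)"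
    have "continuous_on UNIV ?F"
      using pos test_functions_continuous[OF assms(1)] test_functions_continuous_grad[OF assms(1)]
      unfolding gf
      by (intro continuous_intros) (auto simp: less_imp_neq[symmetric])
    moreover have "compact (closure {x. \<phi> x \<noteq> 0})" using assms(1) by (simp add: test_functions_iff)
    moreover have "?F x = 0" if "x \<notin> closure {x. \<phi> x \<noteq> 0}" for x
      unfolding gf test_functions_support[OF assms(1) that] by simp
    ultimately have "\<exists>C>0. \<forall>x. norm (?F x) \<le> C" by (rule continuous_compact_support_bounded)
    then obtain C where "\<And>x. norm (?F x) \<le> C" by blast
    moreover have "?F \<in> borel_measurable M"
      by (rule measurable_continuous[OF continuous_on_subset[OF \<open>continuous_on UNIV ?F\<close> subset_UNIV]])
    ultimately show ?thesis by (intro integrable_bounded[of _ C]) auto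
  qed
  have "(LINT x|M. (1/2) * ((\<phi> x)\<^sup>2 / (x \<bullet> x + d)) - 2 * (grad \<phi> x \<bullet> grad \<phi> x)) \<le> 0"
    unfolding D[symmetric]
    by (rule integral_mono[OF _ i2 ge])
       (intro Bochner_Integration.integrable_diff integrable_mult_right i1 integrable_grad_grad[OF assms(1,1)])
  moreover have "(LINT x|M. (1/2) * ((\<phi> x)\<^sup>2 / (x \<bullet> x + d)) - 2 * (grad \<phi> x \<bullet> grad \<phi> x)) =
     (1/2) * (LINT x|M. (\<phi> x)\<^sup>2 / (x \<bullet> x + d)) - 2 * (LINT x|M. grad \<phi> x \<bullet> grad \<phi> x)"
    by (subst Bochner_Integration.integral_diff)
       (intro integrable_mult_right i1 integrable_grad_grad[OF assms(1,1)] | simp only: integral_mult_right_zero)+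
  ultimately show ?thesis by linarith
qed

lemma AE_nonzero: "AE x in M. x \<noteq> 0"
  by (rule AE_I[where N="{0}"]) (use zero_in Om_sets in \<open>auto simp: emeasure_restrict_space sets_restrict_space_iff\<close>)

text \<open>Fatou's lemma as the regularisation \<open>d\<close> tends to 0. Integrability matters
  because a divergent potential term would silently count as 0 in a Bochner integral.\<close>

lemma integrable_hardy_sq:
  assumes "\<phi> \<in> \<T>"
  shows "integrable M (\<lambda>x. (\<phi> x)\<^sup>2 / (norm x)\<^sup>2)"
proof -
  have [measurable]: "\<phi> \<in> borel_measurable M" using measurable_test assms by blast
  define d where "d n = 1 / (real n + 1)" for n
  have d: "d n > 0" for n by (simp add: d_def)
  have d0: "d \<longlonglongrightarrow> 0" unfolding d_def by (rule tendsto_inverse_Suc)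
  let ?C = "4 * (LINT x|M. grad \<phi> x \<bullet> grad \<phi> x)"
  have f: "(\<lambda>x. \<phi> x * \<phi> x) \<in> \<T>" by (rule test_functions_mult[OF assms assms])
  have *: "(\<integral>\<^sup>+x. ennreal ((\<phi> x)\<^sup>2 / (x \<bullet> x + d n)) \<partial>M) \<le> ennreal ?C" for n
  proof -
    have "integrable M (\<lambda>x. (\<phi> x)\<^sup>2 / (x \<bullet> x + d n))"
    proof (rule integrable_test_bounded[OF f, of _ "1 / d n"])
      show "(\<lambda>x. (\<phi> x)\<^sup>2 / (x \<bullet> x + d n)) \<in> borel_measurable M" by measurable
      have "\<phi> x ^ 2 / (x \<bullet> x + d n) \<le> \<phi> x ^ 2 / d n" for x
        using d[of n] by (intro divide_left_mono) (auto simp: add_nonneg_pos)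
      then show "\<bar>(\<phi> x)\<^sup>2 / (x \<bullet> x + d n)\<bar> \<le> 1 / d n * \<bar>\<phi> x * \<phi> x\<bar>" for x
        using d[of n] by (simp add: power2_eq_square abs_mult add_nonneg_pos)
    qed (use d[of n] in simp)
    then have "(\<integral>\<^sup>+x. ennreal ((\<phi> x)\<^sup>2 / (x \<bullet> x + d n)) \<partial>M) = ennreal (LINT x|M. (\<phi> x)\<^sup>2 / (x \<bullet> x + d n))"
      using d[of n] by (intro nn_integral_eq_integral) (auto simp: add_nonneg_pos)
    then show ?thesis using hardy_regularized[OF assms d[of n]] by (simp add: ennreal_leI)
  qed
  have "(\<integral>\<^sup>+x. ennreal ((\<phi> x)\<^sup>2 / (norm x)\<^sup>2) \<partial>M) \<le> (\<integral>\<^sup>+x. liminf (\<lambda>n. ennreal ((\<phi> x)\<^sup>2 / (x \<bullet> x + d n))) \<partial>M)"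
  proof (rule nn_integral_mono_AE)
    show "AE x in M. ennreal ((\<phi> x)\<^sup>2 / (norm x)\<^sup>2) \<le> liminf (\<lambda>n. ennreal ((\<phi> x)\<^sup>2 / (x \<bullet> x + d n)))"
      using AE_nonzero
    proof eventually_elim
      case (elim x)
      have "(\<lambda>n. (\<phi> x)\<^sup>2 / (x \<bullet> x + d n)) \<longlonglongrightarrow> (\<phi> x)\<^sup>2 / (x \<bullet> x + 0)"
        using elim by (intro tendsto_intros d0) auto
      then have "(\<lambda>n. ennreal ((\<phi> x)\<^sup>2 / (x \<bullet> x + d n))) \<longlonglongrightarrow> ennreal ((\<phi> x)\<^sup>2 / (norm x)\<^sup>2)"
        by (simp add: power2_norm_eq_inner)
      from lim_imp_Liminf[OF _ this] show ?case by simp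
    qed
  qed
  also have "\<dots> \<le> liminf (\<lambda>n. \<integral>\<^sup>+x. ennreal ((\<phi> x)\<^sup>2 / (x \<bullet> x + d n)) \<partial>M)"
    by (rule nn_integral_liminf) measurable
  also have "\<dots> \<le> ennreal ?C"
    using * by (intro Liminf_le) auto
  finally have fin: "(\<integral>\<^sup>+x. ennreal ((\<phi> x)\<^sup>2 / (norm x)\<^sup>2) \<partial>M) \<le> ennreal ?C" .
  show ?thesis
    by (rule integrableI_bounded) (use le_less_trans[OF fin ennreal_less_top] in auto)
qed

lemma integrable_hardy:
  assumes "\<phi> \<in> \<T>" "\<psi> \<in> \<T>"
  shows "integrable M (\<lambda>x. \<phi> x * \<psi> x / (norm x)\<^sup>2)"
proof (rule Bochner_Integration.integrable_bound)
  have [measurable]: "\<phi> \<in> borel_measurable M" "\<psi> \<in> borel_measurable M" using measurable_test assms by blast+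
  show "integrable M (\<lambda>x. (\<phi> x)\<^sup>2 / (norm x)\<^sup>2 + (\<psi> x)\<^sup>2 / (norm x)\<^sup>2)"
    using integrable_hardy_sq assms by (intro Bochner_Integration.integrable_add) auto
  show "(\<lambda>x. \<phi> x * \<psi> x / (norm x)\<^sup>2) \<in> borel_measurable M" by measurable
  have "\<bar>\<phi> x * \<psi> x\<bar> / (norm x)\<^sup>2 \<le> ((\<phi> x)\<^sup>2 + (\<psi> x)\<^sup>2) / (norm x)\<^sup>2" for x
  proof (intro divide_right_mono)
    have "2 * (\<bar>\<phi> x\<bar> * \<bar>\<psi> x\<bar>) \<le> (\<phi> x)\<^sup>2 + (\<psi> x)\<^sup>2"
      using sum_squares_bound[of "\<bar>\<phi> x\<bar>" "\<bar>\<psi> x\<bar>"] by (simp add: mult.assoc)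
    moreover have "0 \<le> \<bar>\<phi> x\<bar> * \<bar>\<psi> x\<bar>" by simp
    ultimately show "\<bar>\<phi> x * \<psi> x\<bar> \<le> (\<phi> x)\<^sup>2 + (\<psi> x)\<^sup>2" unfolding abs_mult by linarith
  qed auto
  then show "AE x in M. norm (\<phi> x * \<psi> x / (norm x)\<^sup>2) \<le> norm ((\<phi> x)\<^sup>2 / (norm x)\<^sup>2 + (\<psi> x)\<^sup>2 / (norm x)\<^sup>2)"
    by (auto simp: add_divide_distrib)
qed

section \<open>The ground state substitution\<close>

lemma D_away:
  assumes "\<phi> \<in> \<D>"
  shows "\<exists>\<delta>>0. \<forall>x. norm x < \<delta> \<longrightarrow> \<phi> x = 0 \<and> grad \<phi> x = 0"
proof -
  let ?K = "closure {x. \<phi> x \<noteq> 0}"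
  have "open (- ?K)" "0 \<in> - ?K" using assms by (auto simp: test_functions_iff)
  then obtain \<delta> where "\<delta> > 0" "ball 0 \<delta> \<subseteq> - ?K" using open_contains_ball by metis
  then have "\<phi> x = 0 \<and> grad \<phi> x = 0" if "norm x < \<delta>" for x
    using test_functions_support[OF assms, of x] that by (auto simp: subset_iff)
  then show ?thesis using \<open>\<delta> > 0\<close> by blast
qed

text \<open>Away from the origin, \<open>hgrad \<phi>\<close> is \<open>|x|\<^sup>-\<^sup>a\<close> times the gradient of \<open>|x|\<^sup>a \<phi>\<close>. In terms of it the form becomes a
  Dirichlet form, which is what makes truncations available even for the critical \<open>\<mu>\<close>.\<close>

definition hgrad :: "(real^'n \<Rightarrow> real) \<Rightarrow> real^'n \<Rightarrow> real^'n" where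
  "hgrad \<phi> x = grad \<phi> x + (a * \<phi> x / (norm x)\<^sup>2) *\<^sub>R x"

lemma measurable_hgrad: "\<phi> \<in> test_functions S \<Longrightarrow> hgrad \<phi> \<in> borel_measurable M"
proof -
  assume "\<phi> \<in> test_functions S"
  then have [measurable]: "\<phi> \<in> borel_measurable M" "grad \<phi> \<in> borel_measurable M"
    using measurable_test measurable_grad by blast+
  show ?thesis unfolding hgrad_def by measurable
qed

lemma D_hgrad_bounded:
  assumes "\<phi> \<in> \<D>"
  shows "\<exists>B>0. \<forall>x. norm (hgrad \<phi> x) \<le> B \<and> \<bar>\<phi> x\<bar> / (norm x)\<^sup>2 \<le> B \<and> \<bar>\<phi> x\<bar> \<le> B"
proof -
  obtain \<delta> where d: "\<delta> > 0" "\<And>x. norm x < \<delta> \<Longrightarrow> \<phi> x = 0" "\<And>x. norm x < \<delta> \<Longrightarrow> grad \<phi> x = 0"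
    using D_away[OF assms] by blast
  obtain B where B: "B > 0" "\<And>x. \<bar>\<phi> x\<bar> \<le> B" "\<And>x. norm (grad \<phi> x) \<le> B"
    using test_functions_bounded[OF assms] by blast
  have 1: "\<bar>\<phi> x\<bar> / (norm x)\<^sup>2 \<le> B / \<delta>\<^sup>2" for x
  proof (cases "norm x < \<delta>")
    case False
    then show ?thesis using d(1) B by (intro frac_le power_mono) (auto simp: zero_less_power)
  qed (use d B in auto)
  have 2: "\<bar>\<phi> x\<bar> / norm x \<le> B / \<delta>" for x
  proof (cases "norm x < \<delta>")
    case False
    then show ?thesis using d(1) B by (intro frac_le) auto
  qed (use d B in auto)
  have "norm (hgrad \<phi> x) \<le> B + a * (B / \<delta>)" for x
  proof -
    have "norm (hgrad \<phi> x) \<le> norm (grad \<phi> x) + norm ((a * \<phi> x / (norm x)\<^sup>2) *\<^sub>R x)"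
      unfolding hgrad_def by (rule norm_triangle_ineq)
    also have "norm ((a * \<phi> x / (norm x)\<^sup>2) *\<^sub>R x) = a * (\<bar>\<phi> x\<bar> / norm x)"
      using a_pos by (auto simp: abs_mult power2_eq_square)
    also have "\<dots> \<le> a * (B / \<delta>)" using 2 a_pos by (intro mult_left_mono) auto
    finally show ?thesis using B(3)[of x] by linarith
  qed
  moreover have "B / \<delta>\<^sup>2 > 0" "a * (B / \<delta>) > 0" using B d a_pos by auto
  ultimately show ?thesis
    using 1 B by (intro exI[of _ "B + a * (B / \<delta>) + B / \<delta>\<^sup>2"]) (smt (verit, best))
qed

lemma integrable_hgrad:
  assumes "\<phi> \<in> \<D>" "\<psi> \<in> \<D>"
  shows "integrable M (\<lambda>x. hgrad \<phi> x \<bullet> hgrad \<psi> x)"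
proof -
  obtain B where B: "\<And>x. norm (hgrad \<phi> x) \<le> B" using D_hgrad_bounded[OF assms(1)] by metis
  obtain C where C: "\<And>x. norm (hgrad \<psi> x) \<le> C" using D_hgrad_bounded[OF assms(2)] by metis
  show ?thesis
  proof (rule integrable_bounded)
    show "(\<lambda>x. hgrad \<phi> x \<bullet> hgrad \<psi> x) \<in> borel_measurable M"
      using measurable_hgrad[OF assms(1)] measurable_hgrad[OF assms(2)] by measurable
    show "\<bar>hgrad \<phi> x \<bullet> hgrad \<psi> x\<bar> \<le> B * C" for x
      using B[of x] C[of x] Cauchy_Schwarz_ineq2[of "hgrad \<phi> x" "hgrad \<psi> x"]
      by (smt (verit) mult_mono norm_ge_zero)
  qed
qed

lemma integral_lin3:
  fixes f g h :: "real^'n \<Rightarrow> real"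
  assumes "integrable M f" "integrable M g" "integrable M h"
  shows "(LINT x|M. f x + c * g x - d * h x) = (LINT x|M. f x) + c * (LINT x|M. g x) - d * (LINT x|M. h x)"
  using assms by simp

text \<open>Expanding the product of the two \<open>hgrad\<close> produces a times the derivative of
  \<phi>\<psi> along x/r^2. By the divergence identity with weight r^-2 and N = 2a + 2, this
  integrates like -2a^2 \<phi>\<psi>/r^2. Together with the +a^2 of the quadratic term it leaves
  -a^2, and a^2 - \<mu> is \<kappa>.\<close>

lemma form_hgrad:
  assumes "\<phi> \<in> \<D>" "\<psi> \<in> \<D>"
  shows "form \<phi> \<psi> = (LINT x|M. hgrad \<phi> x \<bullet> hgrad \<psi> x) + \<kappa> * (LINT x|M. \<phi> x * \<psi> x / (norm x)\<^sup>2)"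
proof -
  note T = assms[THEN D_subset_T]
  let ?f = "\<lambda>x. \<phi> x * \<psi> x" and ?g = "\<lambda>x::real^'n. norm x powr (- 2)"
    and ?\<gamma> = "\<lambda>x::real^'n. - 2 * norm x powr (- 2 - 2)"
  have f: "?f \<in> \<D>" by (rule test_functions_mult[OF assms])
  have gD: "has_grad ?g (?\<gamma> x *\<^sub>R x) x" if "x \<in> -{0}" for x
  proof -
    have "x \<noteq> 0" using that by blast
    from has_grad_norm_powr[OF this, of "-2"] show ?thesis .
  qed
  have f0: "?f \<in> test_functions (-{0})" using f by (rule test_functions_mono) auto
  have o: "open (-{0::real^'n})" by (simp add: open_Compl)
  note D = integral_div_radial[where g="?g" and \<gamma>="?\<gamma>" and T="-{0}", OF D_subset_T[OF f] f0 o smooth_on_norm_powr gD]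
  have gf: "grad ?f x = \<phi> x *\<^sub>R grad \<psi> x + \<psi> x *\<^sub>R grad \<phi> x" for x
    by (rule has_grad_unique[OF has_grad_mult[OF test_functions_has_grad[OF T(1)] test_functions_has_grad[OF T(2)]]])
  have eq: "real CARD('n) * (?f x * ?g x) + ?f x * ?\<gamma> x * (norm x)\<^sup>2 + ?g x * (grad ?f x \<bullet> x)
      = 2 * a * (?f x / (norm x)\<^sup>2) + (\<phi> x * (grad \<psi> x \<bullet> x) + \<psi> x * (grad \<phi> x \<bullet> x)) / (norm x)\<^sup>2" for x
  proof (cases "x = 0")
    case False
    then have g: "?g x = 1 / (norm x)\<^sup>2" and p2: "norm x powr 2 = (norm x)\<^sup>2"
      by (simp_all add: powr_minus_divide)
    have p: "norm x powr (-2-2) * norm x powr 2 = norm x powr (-2)" by (simp only: powr_add[symmetric]) simp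
    have "?\<gamma> x * (norm x)\<^sup>2 = - 2 * (norm x powr (-2-2) * (norm x)\<^sup>2)" by (rule mult.assoc)
    also have "\<dots> = - 2 / (norm x)\<^sup>2" unfolding p[unfolded p2] g by simp
    finally have "?\<gamma> x * (norm x)\<^sup>2 = - 2 / (norm x)\<^sup>2" .
    then have "?f x * ?\<gamma> x * (norm x)\<^sup>2 = ?f x * (- 2 / (norm x)\<^sup>2)"
      by (simp only: mult.assoc[of "?f x"])
    then have "real CARD('n) * (?f x * ?g x) + ?f x * ?\<gamma> x * (norm x)\<^sup>2 + ?g x * (grad ?f x \<bullet> x) =
      (2 * a + 2) * (?f x * (1 / (norm x)\<^sup>2)) + ?f x * (- 2 / (norm x)\<^sup>2) + 1 / (norm x)\<^sup>2 * (grad ?f x \<bullet> x)"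
      unfolding dim_eq g by (simp only:)
    then show ?thesis unfolding gf inner_add_left inner_scaleR_left
      by (simp add: add_divide_distrib algebra_simps)
  qed simp
  \<comment> \<open>Arranged so that the bracket multiplied by \<open>a\<close> is the integrand of
    the divergence identity, whose integral is 0.\<close>
  have hg: "hgrad \<phi> x \<bullet> hgrad \<psi> x = grad \<phi> x \<bullet> grad \<psi> x +
      a * (2 * a * (?f x / (norm x)\<^sup>2) + (\<phi> x * (grad \<psi> x \<bullet> x) + \<psi> x * (grad \<phi> x \<bullet> x)) / (norm x)\<^sup>2)
      - a\<^sup>2 * (?f x / (norm x)\<^sup>2)" for x
  proof (cases "x = 0")
    case False
    define s where "s = (norm x)\<^sup>2"
    have s: "x \<bullet> x = s" "s \<noteq> 0" using False by (auto simp: s_def power2_norm_eq_inner)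
    have "hgrad \<phi> x \<bullet> hgrad \<psi> x = grad \<phi> x \<bullet> grad \<psi> x + (a * \<psi> x / s) * (grad \<phi> x \<bullet> x)
        + (a * \<phi> x / s) * (grad \<psi> x \<bullet> x) + (a * \<phi> x / s) * ((a * \<psi> x / s) * s)"
      unfolding hgrad_def s_def[symmetric] by (simp add: inner_add_left inner_add_right inner_commute[of x "grad \<psi> x"] s(1) add_divide_distrib algebra_simps)
    also have "(a * \<phi> x / s) * ((a * \<psi> x / s) * s) = a\<^sup>2 * (?f x / s)"
      using s(2) by (simp add: power2_eq_square)
    finally show ?thesis unfolding s_def[symmetric]
      by (simp add: add_divide_distrib algebra_simps power2_eq_square)
  qed (simp add: hgrad_def)
  let ?E = "\<lambda>x. 2 * a * (?f x / (norm x)\<^sup>2) + (\<phi> x * (grad \<psi> x \<bullet> x) + \<psi> x * (grad \<phi> x \<bullet> x)) / (norm x)\<^sup>2"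
  have D0: "(LINT x|M. ?E x) = 0" using D unfolding eq .
  note i1 = integrable_grad_grad[OF assms] and i2 = integrable_hardy[OF T]
  \<comment> \<open>Read off from \<open>hg\<close>: after division by a > 0 the bracket is a
    combination of the other three terms, which are integrable.\<close>
  have iE: "integrable M ?E"
  proof -
    have "integrable M (\<lambda>x. (hgrad \<phi> x \<bullet> hgrad \<psi> x - grad \<phi> x \<bullet> grad \<psi> x + a\<^sup>2 * (?f x / (norm x)\<^sup>2)) / a)"
      by (intro integrable_divide_zero Bochner_Integration.integrable_add Bochner_Integration.integrable_diff
          integrable_mult_right integrable_hgrad[OF assms] i1 i2)
    moreover have "(hgrad \<phi> x \<bullet> hgrad \<psi> x - grad \<phi> x \<bullet> grad \<psi> x + a\<^sup>2 * (?f x / (norm x)\<^sup>2)) / a = ?E x" for x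
      unfolding hg using a_pos by simp
    ultimately show ?thesis by simp
  qed
  have "(LINT x|M. hgrad \<phi> x \<bullet> hgrad \<psi> x) = (LINT x|M. grad \<phi> x \<bullet> grad \<psi> x) - a\<^sup>2 * (LINT x|M. ?f x / (norm x)\<^sup>2)"
    unfolding hg using integral_lin3[OF i1 iE i2, of a "a\<^sup>2"] D0 by simp
  then show ?thesis unfolding form_eq \<kappa>_def by (simp add: algebra_simps)
qed

lemma form_ge_hgrad: "\<phi> \<in> \<D> \<Longrightarrow> (LINT x|M. (norm (hgrad \<phi> x))\<^sup>2) \<le> form \<phi> \<phi>"
  unfolding form_hgrad power2_norm_eq_inner using \<kappa>_nonneg by (simp add: Bochner_Integration.integral_nonneg)

text \<open>An improved Hardy inequality, valid up to the critical \<mu>. Rewritten with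
  \<open>hgrad\<close>, the divergence of \<phi>^2 x is (N - 2a) \<phi>^2 plus 2 \<phi> times the
  inner product of \<open>hgrad \<phi>\<close> with x, and N - 2a = 2. Young's inequality and |x| <=
  \<open>radius\<close> do the rest.\<close>

lemma L2_bound_D:
  assumes "\<phi> \<in> \<D>"
  shows "(LINT x|M. (\<phi> x)\<^sup>2) \<le> radius\<^sup>2 * form \<phi> \<phi>"
proof -
  note T = D_subset_T[OF assms]
  let ?f = "\<lambda>x. \<phi> x * \<phi> x"
  have f: "?f \<in> \<T>" by (rule test_functions_mult[OF T T])
  have g1: "has_grad (\<lambda>_. 1) (0 *\<^sub>R x) x" for x :: "real^'n" using has_grad_const[of 1 x] by simp
  note D = integral_div_radial[where g="\<lambda>_. 1" and \<gamma>="\<lambda>_. 0" and T=UNIV,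
      OF f test_functions_mono[OF f subset_UNIV] open_UNIV smooth_on_const g1]
  have gf: "grad ?f x = (2 * \<phi> x) *\<^sub>R grad \<phi> x" for x
    using has_grad_unique[OF has_grad_mult[OF test_functions_has_grad[OF T] test_functions_has_grad[OF T]], of x]
    by (simp add: scaleR_add_left[symmetric])
  have ge: "real CARD('n) * ?f x + grad ?f x \<bullet> x \<ge> (\<phi> x)\<^sup>2 - radius\<^sup>2 * (hgrad \<phi> x \<bullet> hgrad \<phi> x)"
    if "x \<in> \<Omega>" for x
  proof -
    have 1: "\<phi> x * (hgrad \<phi> x \<bullet> x) = \<phi> x * (grad \<phi> x \<bullet> x) + a * (\<phi> x)\<^sup>2"
    proof (cases "x = 0")
      case True
      then have "\<phi> x = 0" using test_functions_outside[OF assms] by auto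
      then show ?thesis by simp
    next
      case False
      then show ?thesis
        by (simp add: hgrad_def inner_add_left power2_norm_eq_inner algebra_simps power2_eq_square[of "\<phi> x"])
    qed
    have "\<bar>\<phi> x * (hgrad \<phi> x \<bullet> x)\<bar> \<le> \<bar>\<phi> x\<bar> * (norm (hgrad \<phi> x) * norm x)"
      unfolding abs_mult by (intro mult_left_mono Cauchy_Schwarz_ineq2) auto
    also have "\<dots> \<le> \<bar>\<phi> x\<bar> * (norm (hgrad \<phi> x) * radius)"
      using norm_le_radius[OF that] by (intro mult_left_mono) auto
    finally have 2: "2 * \<bar>\<phi> x * (hgrad \<phi> x \<bullet> x)\<bar> \<le> 2 * \<bar>\<phi> x\<bar> * (radius * norm (hgrad \<phi> x))" by (simp add: algebra_simps)
    also have "\<dots> \<le> \<bar>\<phi> x\<bar>\<^sup>2 + (radius * norm (hgrad \<phi> x))\<^sup>2" by (rule sum_squares_bound)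
    also have "\<dots> = (\<phi> x)\<^sup>2 + radius\<^sup>2 * (hgrad \<phi> x \<bullet> hgrad \<phi> x)"
      by (simp add: power_mult_distrib power2_norm_eq_inner)
    finally have "2 * (\<phi> x * (hgrad \<phi> x \<bullet> x)) \<ge> - ((\<phi> x)\<^sup>2 + radius\<^sup>2 * (hgrad \<phi> x \<bullet> hgrad \<phi> x))" by linarith
    moreover have "real CARD('n) * ?f x + grad ?f x \<bullet> x = 2 * (\<phi> x)\<^sup>2 + 2 * (\<phi> x * (hgrad \<phi> x \<bullet> x))"
      unfolding 1 gf dim_eq by (simp add: algebra_simps power2_eq_square)
    ultimately show ?thesis by linarith
  qed
  have i1: "integrable M (\<lambda>x. (\<phi> x)\<^sup>2)"
    using integrable_test[OF f] by (simp add: power2_eq_square)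
  note i2 = integrable_hgrad[OF assms assms]
  have i3: "integrable M (\<lambda>x. real CARD('n) * ?f x + grad ?f x \<bullet> x)"
  proof -
    obtain B where B: "\<And>x. \<bar>?f x\<bar> \<le> B" "\<And>x. norm (grad ?f x) \<le> B" using test_functions_bounded[OF f] by metis
    show ?thesis
    proof (rule integrable_bounded)
    show "(\<lambda>x. real CARD('n) * ?f x + grad ?f x \<bullet> x) \<in> borel_measurable M"
      using measurable_test[OF f] measurable_grad[OF f] by measurable
    fix x assume "x \<in> \<Omega>"
    have "\<bar>grad ?f x \<bullet> x\<bar> \<le> norm (grad ?f x) * norm x" by (rule Cauchy_Schwarz_ineq2)
    also have "\<dots> \<le> B * radius" using B norm_le_radius[OF \<open>x \<in> \<Omega>\<close>] by (intro mult_mono) (auto intro: order_trans[OF norm_ge_zero])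
    finally have 1: "\<bar>grad ?f x \<bullet> x\<bar> \<le> B * radius" .
    have 2: "\<bar>real CARD('n) * ?f x\<bar> \<le> real CARD('n) * B"
      using mult_left_mono[OF B(1)[of x], of "real CARD('n)"] by (simp add: abs_mult)
    show "\<bar>real CARD('n) * ?f x + grad ?f x \<bullet> x\<bar> \<le> real CARD('n) * B + B * radius"
      using 1 2 by linarith
    qed
  qed
  have "(LINT x|M. (\<phi> x)\<^sup>2 - radius\<^sup>2 * (hgrad \<phi> x \<bullet> hgrad \<phi> x)) \<le> (LINT x|M. real CARD('n) * ?f x + grad ?f x \<bullet> x)"
    using i1 i2 i3 ge by (intro integral_mono) auto
  also have "\<dots> = 0" using D by simp
  finally have "(LINT x|M. (\<phi> x)\<^sup>2) \<le> radius\<^sup>2 * (LINT x|M. hgrad \<phi> x \<bullet> hgrad \<phi> x)" using i1 i2 by simp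
  also have "\<dots> \<le> radius\<^sup>2 * form \<phi> \<phi>"
    using form_ge_hgrad[OF assms] by (intro mult_left_mono) (auto simp: power2_norm_eq_inner)
  finally show ?thesis .
qed

end

section \<open>Square integrable functions and cutoff at the origin\<close>

lemma smooth_on_scale:
  assumes "smooth_on UNIV f"
  shows "smooth_on UNIV (\<lambda>x. f (c *\<^sub>R x))"
    and "has_grad (\<lambda>x. f (c *\<^sub>R x)) (c *\<^sub>R grad f (c *\<^sub>R x)) x"
proof -
  have *: "has_grad (\<lambda>x. g (c *\<^sub>R x)) (c *\<^sub>R grad g (c *\<^sub>R x)) x" if "g differentiable at (c *\<^sub>R x)" for g :: "real^'a \<Rightarrow> real" and x
  proof -
    have "((\<lambda>x. c *\<^sub>R x) has_derivative (\<lambda>h. c *\<^sub>R h)) (at x)"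
      by (auto intro!: derivative_eq_intros)
    from has_derivative_compose[OF this has_grad_grad[OF that, unfolded has_grad_def]]
    show ?thesis by (simp add: has_grad_def)
  qed
  have "smooth_on_upto k UNIV (\<lambda>x. g (c *\<^sub>R x))" if "smooth_on_upto k UNIV g" for k and g :: "real^'a \<Rightarrow> real"
    using that
  proof (induction k arbitrary: g)
    case 0
    then show ?case by (auto intro!: continuous_on_compose2[of UNIV g] continuous_intros)
  next
    case (Suc k)
    have h: "has_grad (\<lambda>x. g (c *\<^sub>R x)) (c *\<^sub>R grad g (c *\<^sub>R x)) x" for x
      using Suc.prems by (intro *) auto
    have "partial i (\<lambda>x. g (c *\<^sub>R x)) = (\<lambda>x. c * partial i g (c *\<^sub>R x))" for i
      using partial_has_grad[OF h] by (auto simp: grad_def)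
    moreover have "smooth_on_upto k UNIV (\<lambda>x. c * partial i g (c *\<^sub>R x))" for i
      using Suc by (intro smooth_on_upto_mult smooth_on_upto_const) auto
    ultimately show ?case using has_grad_differentiable[OF h] by simp
  qed
  then show "smooth_on UNIV (\<lambda>x. f (c *\<^sub>R x))" using assms by (simp add: smooth_on_def)
  show "has_grad (\<lambda>x. f (c *\<^sub>R x)) (c *\<^sub>R grad f (c *\<^sub>R x)) x"
    by (rule *[OF smooth_onD_differentiable[OF assms UNIV_I]])
qed

context bounded_open begin

text \<open>The L^2 theory is developed for functions with a seminorm rather than for classes, since
  \<open>fn_of\<close> yields functions.\<close>

definition sq :: "(real^'n \<Rightarrow> real) \<Rightarrow> bool" where
  "sq f \<longleftrightarrow> f \<in> borel_measurable M \<and> integrable M (\<lambda>x. (f x)\<^sup>2)"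

definition n2 :: "(real^'n \<Rightarrow> real) \<Rightarrow> real" where
  "n2 f = sqrt (LINT x|M. (f x)\<^sup>2)"

lemma sqD: "sq f \<Longrightarrow> f \<in> borel_measurable M" "sq f \<Longrightarrow> integrable M (\<lambda>x. (f x)\<^sup>2)"
  by (auto simp: sq_def)

lemma n2_nonneg: "n2 f \<ge> 0" by (simp add: n2_def Bochner_Integration.integral_nonneg)

lemma n2_sq: "(n2 f)\<^sup>2 = (LINT x|M. (f x)\<^sup>2)"
  by (simp add: n2_def Bochner_Integration.integral_nonneg)

lemma sq_bound:
  assumes "f \<in> borel_measurable M" "sq g" "AE x in M. \<bar>f x\<bar> \<le> c * \<bar>g x\<bar>"
  shows "sq f"
proof -
  have "integrable M (\<lambda>x. (f x)\<^sup>2)"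
  proof (rule Bochner_Integration.integrable_bound)
    show "integrable M (\<lambda>x. c\<^sup>2 * (g x)\<^sup>2)" using sqD[OF assms(2)] by simp
    show "AE x in M. norm ((f x)\<^sup>2) \<le> norm (c\<^sup>2 * (g x)\<^sup>2)"
      using assms(3)
    proof eventually_elim
      case (elim x)
      then have "\<bar>f x\<bar>\<^sup>2 \<le> (c * \<bar>g x\<bar>)\<^sup>2" by (intro power_mono) auto
      then show ?case by (simp add: power_mult_distrib)
    qed
  qed (use assms(1) in simp)
  then show ?thesis using assms(1) by (simp add: sq_def)
qed

lemma integrable_mult_sq:
  assumes "sq f" "sq g"
  shows "integrable M (\<lambda>x. f x * g x)"
proof (rule Bochner_Integration.integrable_bound)
  show "integrable M (\<lambda>x. (f x)\<^sup>2 + (g x)\<^sup>2)" using assms by (simp add: sq_def)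
  show "(\<lambda>x. f x * g x) \<in> borel_measurable M"
    by (intro borel_measurable_times sqD(1) assms)
  have "\<bar>f x * g x\<bar> \<le> (f x)\<^sup>2 + (g x)\<^sup>2" for x
  proof -
    have "2 * (\<bar>f x\<bar> * \<bar>g x\<bar>) \<le> (f x)\<^sup>2 + (g x)\<^sup>2"
      using sum_squares_bound[of "\<bar>f x\<bar>" "\<bar>g x\<bar>"] by (simp add: mult.assoc)
    moreover have "0 \<le> \<bar>f x\<bar> * \<bar>g x\<bar>" by simp
    ultimately show ?thesis unfolding abs_mult by linarith
  qed
  then show "AE x in M. norm (f x * g x) \<le> norm ((f x)\<^sup>2 + (g x)\<^sup>2)" by simp
qed

lemma sq_cmult: assumes "sq f" shows "sq (\<lambda>x. c * f x)"
  unfolding sq_def power_mult_distrib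
  by (intro conjI borel_measurable_times borel_measurable_const integrable_mult_right sqD assms)

lemma sq_add: assumes "sq f" "sq g" shows "sq (\<lambda>x. f x + g x)"
proof -
  have "integrable M (\<lambda>x. (f x)\<^sup>2 + (g x)\<^sup>2 + 2 * (f x * g x))"
    using assms integrable_mult_sq[OF assms] by (auto simp: sq_def)
  then have "integrable M (\<lambda>x. (f x + g x)\<^sup>2)" by (simp add: power2_sum mult.assoc)
  then show ?thesis unfolding sq_def by (intro conjI borel_measurable_add sqD(1) assms)
qed

lemma sq_diff: assumes "sq f" "sq g" shows "sq (\<lambda>x. f x - g x)"
  using sq_add[OF assms(1) sq_cmult[OF assms(2), of "-1"]] by simp

lemma sq_const: "sq (\<lambda>_. c)" by (simp add: sq_def)

text \<open>Young's inequality 2|fg| <= f^2/t + t g^2, which is optimal when t is the quotient of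
  the two norms.\<close>

lemma cauchy_schwarz:
  assumes "sq f" "sq g"
  shows "(LINT x|M. \<bar>f x * g x\<bar>) \<le> n2 f * n2 g"
proof -
  have i: "integrable M (\<lambda>x. \<bar>f x * g x\<bar>)" using integrable_mult_sq[OF assms] by simp
  let ?B = "LINT x|M. \<bar>f x * g x\<bar>"
  have *: "2 * ?B \<le> (n2 f)\<^sup>2 / t + t * (n2 g)\<^sup>2" if "t > 0" for t
  proof -
    have "2 * \<bar>f x * g x\<bar> \<le> (f x)\<^sup>2 / t + t * (g x)\<^sup>2" for x
    proof -
      have s: "sqrt t * sqrt t = t" "sqrt t \<noteq> 0" using that by auto
      have "2 * (\<bar>f x\<bar> / sqrt t) * (sqrt t * \<bar>g x\<bar>) \<le> (\<bar>f x\<bar> / sqrt t)\<^sup>2 + (sqrt t * \<bar>g x\<bar>)\<^sup>2"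
        by (rule sum_squares_bound)
      also have "2 * (\<bar>f x\<bar> / sqrt t) * (sqrt t * \<bar>g x\<bar>) = 2 * \<bar>f x * g x\<bar>" using s(2) by (simp add: abs_mult)
      also have "(\<bar>f x\<bar> / sqrt t)\<^sup>2 + (sqrt t * \<bar>g x\<bar>)\<^sup>2 = (f x)\<^sup>2 / t + t * (g x)\<^sup>2"
        using that by (simp add: power_divide power_mult_distrib)
      finally show ?thesis .
    qed
    then have "(LINT x|M. 2 * \<bar>f x * g x\<bar>) \<le> (LINT x|M. (f x)\<^sup>2 / t + t * (g x)\<^sup>2)"
      using i assms by (intro integral_mono) (auto simp: sq_def)
    also have "\<dots> = (n2 f)\<^sup>2 / t + t * (n2 g)\<^sup>2" using assms by (simp add: sq_def n2_sq)
    finally show ?thesis by simp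
  qed
  let ?a = "n2 f" and ?c = "n2 g"
  \<comment> \<open>The optimal t is perturbed by e in numerator and denominator, so that vanishing
    norms need no separate case.\<close>
  have "?B \<le> ?a * ?c + e * (?a + ?c) / 2" if "e > 0" for e
  proof -
    have p: "?a + e > 0" "?c + e > 0" using n2_nonneg[of f] n2_nonneg[of g] that by auto
    have "2 * ?B \<le> ?a\<^sup>2 / ((?a + e) / (?c + e)) + (?a + e) / (?c + e) * ?c\<^sup>2"
      using p by (intro *) auto
    also have "?a\<^sup>2 / ((?a + e) / (?c + e)) = (?c + e) * (?a * (?a / (?a + e)))" using p by (simp add: power2_eq_square field_simps)
    also have "\<dots> \<le> (?c + e) * (?a * 1)" using p n2_nonneg[of f] that by (intro mult_left_mono) auto
    also have "(?a + e) / (?c + e) * ?c\<^sup>2 = (?a + e) * (?c * (?c / (?c + e)))" using p by (simp add: power2_eq_square field_simps)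
    also have "\<dots> \<le> (?a + e) * (?c * 1)" using p n2_nonneg[of g] that by (intro mult_left_mono) auto
    finally show ?thesis by (simp add: field_simps)
  qed
  note ** = this
  show ?thesis
  proof (rule field_le_epsilon)
    fix e :: real assume "e > 0"
    define d where "d = 2 * e / (?a + ?c + 1)"
    have "d > 0" using \<open>e > 0\<close> n2_nonneg[of f] n2_nonneg[of g] by (simp add: d_def add_nonneg_pos)
    have "d * (?a + ?c) / 2 \<le> d * (?a + ?c + 1) / 2" using \<open>d > 0\<close> by simp
    also have "\<dots> = e" unfolding d_def using n2_nonneg[of f] n2_nonneg[of g] by (simp add: add_nonneg_eq_0_iff field_simps)
    finally show "?B \<le> ?a * ?c + e" using **[OF \<open>d > 0\<close>] by linarith
  qed
qed

lemma cauchy_schwarz_abs: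
  assumes "sq f" "sq g"
  shows "\<bar>LINT x|M. f x * g x\<bar> \<le> n2 f * n2 g"
  using cauchy_schwarz[OF assms] integral_abs_bound[of M "\<lambda>x. f x * g x"] by linarith

lemma n2_triangle:
  assumes "sq f" "sq g"
  shows "n2 (\<lambda>x. f x + g x) \<le> n2 f + n2 g"
proof (rule power2_le_imp_le)
  have "(n2 (\<lambda>x. f x + g x))\<^sup>2 = (LINT x|M. (f x)\<^sup>2 + (g x)\<^sup>2 + 2 * (f x * g x))"
    by (simp add: n2_sq power2_sum mult.assoc)
  also have "\<dots> = (n2 f)\<^sup>2 + (n2 g)\<^sup>2 + 2 * (LINT x|M. f x * g x)"
    using assms integrable_mult_sq[OF assms] by (simp add: n2_sq sq_def)
  also have "\<dots> \<le> (n2 f)\<^sup>2 + (n2 g)\<^sup>2 + 2 * (n2 f * n2 g)"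
    using cauchy_schwarz_abs[OF assms] by linarith
  finally show "(n2 (\<lambda>x. f x + g x))\<^sup>2 \<le> (n2 f + n2 g)\<^sup>2" by (simp add: power2_sum mult.assoc)
qed (simp add: n2_nonneg)

lemma n2_minus: "n2 (\<lambda>x. f x - g x) = n2 (\<lambda>x. g x - f x)"
  unfolding n2_def by (simp add: power2_commute)

lemma n2_triangle_diff:
  assumes "sq f" "sq g" "sq h"
  shows "n2 (\<lambda>x. f x - h x) \<le> n2 (\<lambda>x. f x - g x) + n2 (\<lambda>x. g x - h x)"
  using n2_triangle[OF sq_diff[OF assms(1,2)] sq_diff[OF assms(2,3)]] by simp

lemma n2_eq_0: assumes "sq f" "n2 f = 0" shows "AE x in M. f x = 0"
proof -
  have "(LINT x|M. (f x)\<^sup>2) = 0" using assms(2) n2_sq[of f] by simp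
  then show ?thesis
    using integral_nonneg_eq_0_iff_AE[of M "\<lambda>x. (f x)\<^sup>2"] sqD[OF assms(1)] by simp
qed

lemma n2_mono:
  assumes "sq f" "sq g" "AE x in M. \<bar>f x\<bar> \<le> \<bar>g x\<bar>"
  shows "n2 f \<le> n2 g"
  unfolding n2_def
proof (intro real_sqrt_le_mono integral_mono_AE)
  show "AE x in M. (f x)\<^sup>2 \<le> (g x)\<^sup>2" using assms(3) by (auto simp: abs_le_square_iff)
qed (use assms in \<open>auto simp: sq_def\<close>)

lemma L1_le_n2: "sq f \<Longrightarrow> (LINT x|M. \<bar>f x\<bar>) \<le> n2 f * n2 (\<lambda>_. 1)"
  using cauchy_schwarz[OF _ sq_const[of 1]] by simp

lemma sq_integrable: "sq f \<Longrightarrow> integrable M f"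
  using integrable_mult_sq[OF _ sq_const[of 1]] by simp

lemma n2_AE_subseq:
  assumes "\<And>n. sq (f n)" "sq g" "(\<lambda>n. n2 (\<lambda>x. f n x - g x)) \<longlonglongrightarrow> 0"
  shows "\<exists>r::nat \<Rightarrow> nat. strict_mono r \<and> (AE x in M. (\<lambda>n. f (r n) x) \<longlonglongrightarrow> g x)"
proof -
  have "(\<lambda>n. n2 (\<lambda>x. f n x - g x) * n2 (\<lambda>_. 1)) \<longlonglongrightarrow> 0 * n2 (\<lambda>_. 1)"
    using assms(3) by (intro tendsto_intros)
  then have lim: "(\<lambda>n. n2 (\<lambda>x. f n x - g x) * n2 (\<lambda>_. 1)) \<longlonglongrightarrow> 0" by simp
  have le: "norm (LINT x|M. norm (f n x - g x)) \<le> n2 (\<lambda>x. f n x - g x) * n2 (\<lambda>_. 1)" for n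
    using L1_le_n2[OF sq_diff[OF assms(1,2)], of n] by (simp add: Bochner_Integration.integral_nonneg)
  have to0: "(\<lambda>n. LINT x|M. norm (f n x - g x)) \<longlonglongrightarrow> 0"
    by (rule Lim_null_comparison[OF _ lim]) (intro always_eventually allI le)
  have int: "integrable M (\<lambda>x. f n x - g x)" for n using sq_integrable[OF sq_diff[OF assms(1,2)]] .
  from tendsto_L1_AE_subseq[OF int to0]
  obtain r :: "nat \<Rightarrow> nat" where r: "strict_mono r" "AE x in M. (\<lambda>n. f (r n) x - g x) \<longlonglongrightarrow> 0"
    by (elim exE conjE)
  have "AE x in M. (\<lambda>n. f (r n) x) \<longlonglongrightarrow> g x"
    using r(2) by eventually_elim (simp add: LIM_zero_iff)
  then show ?thesis using r(1) by blast
qed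

lemma integral_tendsto_sq:
  assumes "\<And>n. sq (f n)" "sq g" "sq h" "(\<lambda>n. n2 (\<lambda>x. f n x - g x)) \<longlonglongrightarrow> 0"
  shows "(\<lambda>n. LINT x|M. f n x * h x) \<longlonglongrightarrow> (LINT x|M. g x * h x)"
proof -
  have "(\<lambda>n. n2 (\<lambda>x. f n x - g x) * n2 h) \<longlonglongrightarrow> 0 * n2 h" using assms(4) by (intro tendsto_intros)
  then have lim: "(\<lambda>n. n2 (\<lambda>x. f n x - g x) * n2 h) \<longlonglongrightarrow> 0" by simp
  have le: "norm ((LINT x|M. f n x * h x) - (LINT x|M. g x * h x)) \<le> n2 (\<lambda>x. f n x - g x) * n2 h" for n
    unfolding real_norm_def left_diff_distrib[symmetric]
      Bochner_Integration.integral_diff[OF integrable_mult_sq[OF assms(1,3)] integrable_mult_sq[OF assms(2,3)], symmetric]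
    by (rule cauchy_schwarz_abs[OF sq_diff[OF assms(1,2)] assms(3)])
  have "(\<lambda>n. (LINT x|M. f n x * h x) - (LINT x|M. g x * h x)) \<longlonglongrightarrow> 0"
    by (rule Lim_null_comparison[OF _ lim]) (intro always_eventually allI le)
  then show ?thesis by (rule LIM_zero_cancel)
qed

lemma sq_test: assumes "\<phi> \<in> test_functions S" shows "sq \<phi>"
proof -
  obtain B where "\<forall>x. \<bar>\<phi> x\<bar> \<le> B" using test_functions_bounded[OF assms] by blast
  then show ?thesis
    using sq_bound[OF measurable_test[OF assms] sq_const[of 1], of B] by simp
qed

end

section \<open>Zero capacity of the origin and the weak form of the operator\<close>

context hardy_domain begin

lemma form_le_grad:
  assumes "\<phi> \<in> \<T>"
  shows "form \<phi> \<phi> \<le> (LINT x|M. grad \<phi> x \<bullet> grad \<phi> x)"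
proof -
  have "0 \<le> (LINT x|M. \<phi> x * \<phi> x / (norm x)\<^sup>2)" by (intro Bochner_Integration.integral_nonneg) auto
  then show ?thesis unfolding form_eq using mu_pos by simp
qed

text \<open>A cutoff at radius of order 1/c costs at most a multiple of c^2 in the squared gradient,
  on a set of volume at most a multiple of c^-3 because the dimension is at least 3. Hence the form
  and the L^2 norm of the removed piece \<open>\<rho> n\<close> both tend to 0.\<close>

lemma D_approx:
  assumes "\<phi> \<in> \<T>"
  shows "\<exists>\<psi> e. (\<forall>n. \<psi> n \<in> \<D>) \<and> e \<longlonglongrightarrow> (0::real) \<and>
     (\<forall>n. form (\<lambda>x. \<phi> x - \<psi> n x) (\<lambda>x. \<phi> x - \<psi> n x) \<le> e n \<and> n2 (\<lambda>x. \<phi> x - \<psi> n x) \<le> e n)"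
proof -
  obtain \<zeta> :: "real^'n \<Rightarrow> real" where z0: "smooth_on UNIV \<zeta>" and z: "\<forall>x. 0 \<le> \<zeta> x \<and> \<zeta> x \<le> 1 \<and>
     (norm x \<le> 1 \<longrightarrow> \<zeta> x = 0) \<and> (norm x \<ge> 2 \<longrightarrow> \<zeta> x = 1)" using cutoff_exists by blast
  define \<eta> where "\<eta> x = 1 - \<zeta> x" for x
  have \<eta>s: "smooth_on UNIV \<eta>" unfolding \<eta>_def by (intro smooth_on_diff smooth_on_const z0) auto
  have \<eta>b: "0 \<le> \<eta> x" "\<eta> x \<le> 1" for x using z[rule_format, of x] by (auto simp: \<eta>_def)
  have \<eta>1: "\<eta> x = 1" if "norm x \<le> 1" for x using z[rule_format, of x] that by (simp add: \<eta>_def)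
  have \<eta>0: "\<eta> x = 0" if "norm x \<ge> 2" for x using z[rule_format, of x] that by (simp add: \<eta>_def)
  have "closure {x. \<eta> x \<noteq> 0} \<subseteq> cball 0 2"
    by (intro closure_minimal) (use \<eta>0 in \<open>force simp: not_le\<close>)+
  then have "\<eta> \<in> test_functions UNIV"
    using \<eta>s by (auto simp: test_functions_iff compact_eq_bounded_closed intro: bounded_subset[OF bounded_cball])
  then obtain E where E: "E > 0" "\<forall>x. norm (grad \<eta> x) \<le> E" using test_functions_bounded by blast
  obtain B where B: "B > 0" "\<forall>x. \<bar>\<phi> x\<bar> \<le> B" "\<forall>x. norm (grad \<phi> x) \<le> B" using test_functions_bounded[OF assms] by blast
  define c where "c n = real n + 1" for n
  have c: "c n \<ge> 1" for n by (simp add: c_def)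
  define \<rho> where "\<rho> n x = \<phi> x * \<eta> (c n *\<^sub>R x)" for n x
  have \<rho>T: "\<rho> n \<in> \<T>" for n
    unfolding \<rho>_def by (rule test_functions_mult_smooth[OF assms subset_UNIV open_UNIV smooth_on_scale(1)[OF \<eta>s]])
  define \<psi> where "\<psi> n x = \<phi> x - \<rho> n x" for n x
  have \<psi>D: "\<psi> n \<in> \<D>" for n
  proof -
    have "(\<lambda>x. 1 * \<phi> x + (-1) * \<rho> n x) \<in> \<T>" by (rule test_functions_lincomb[OF assms \<rho>T])
    then have T: "\<psi> n \<in> \<T>" by (simp add: \<psi>_def[abs_def])
    have "\<psi> n x = 0" if "x \<in> ball 0 (1 / c n)" for x
    proof -
      have "norm (c n *\<^sub>R x) \<le> 1" using that c[of n] by (simp add: field_simps)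
      then show ?thesis by (simp add: \<psi>_def \<rho>_def \<eta>1)
    qed
    then have "{x. \<psi> n x \<noteq> 0} \<subseteq> - ball 0 (1 / c n)" by blast
    then have "closure {x. \<psi> n x \<noteq> 0} \<subseteq> - ball 0 (1 / c n)" by (intro closure_minimal) auto
    moreover have "(0::real^'n) \<in> ball 0 (1 / c n)" using c[of n] by simp
    ultimately have "0 \<notin> closure {x. \<psi> n x \<noteq> 0}" by blast
    then show ?thesis using T by (auto simp: test_functions_iff)
  qed
  let ?A = "\<lambda>n. cball (0::real^'n) (2 / c n)"
  have g\<rho>: "norm (grad (\<rho> n) x) \<le> B + B * (c n * E)" for n x
  proof -
    have "grad (\<rho> n) x = \<phi> x *\<^sub>R (c n *\<^sub>R grad \<eta> (c n *\<^sub>R x)) + \<eta> (c n *\<^sub>R x) *\<^sub>R grad \<phi> x"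
      unfolding \<rho>_def by (rule has_grad_unique[OF has_grad_mult[OF test_functions_has_grad[OF assms] smooth_on_scale(2)[OF \<eta>s]]])
    also have "norm \<dots> \<le> \<bar>\<phi> x\<bar> * (c n * norm (grad \<eta> (c n *\<^sub>R x))) + \<eta> (c n *\<^sub>R x) * norm (grad \<phi> x)"
      using c[of n] \<eta>b by (intro order_trans[OF norm_triangle_ineq]) (simp add: abs_mult)
    also have "\<dots> \<le> B * (c n * E) + 1 * B"
      using B E c[of n] \<eta>b[of "c n *\<^sub>R x"] by (intro add_mono mult_mono) auto
    finally show ?thesis by simp
  qed
  have out: "\<rho> n x = 0" "grad (\<rho> n) x = 0" if "x \<notin> ?A n" for n x
  proof -
    have z: "\<rho> n y = 0" if "y \<in> - ?A n" for y
    proof -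
      have "norm (c n *\<^sub>R y) \<ge> 2" using that c[of n] by (simp add: field_simps)
      then show ?thesis by (simp add: \<rho>_def \<eta>0)
    qed
    then show "\<rho> n x = 0" using that by blast
    have "open (- ?A n)" "x \<in> - ?A n" using that by auto
    then show "grad (\<rho> n) x = 0" using grad_eq_0_outside[of "- ?A n" x "\<rho> n", OF _ _ z] has_grad_unique by blast
  qed
  define V where "V = unit_ball_vol (real CARD('n)) * 2 ^ CARD('n)"
  have V0: "V \<ge> 0" by (simp add: V_def)
  have meas: "measure M (?A n \<inter> \<Omega>) \<le> V / c n ^ 3" for n
  proof -
    have "measure M (?A n \<inter> \<Omega>) = measure lebesgue (?A n \<inter> \<Omega>)"
      using Om_sets by (intro measure_restrict_space) auto
    also have "\<dots> \<le> measure lebesgue (?A n)"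
      using Om_sets by (intro measure_mono_fmeasurable) auto
    also have "\<dots> = unit_ball_vol (real CARD('n)) * (2 / c n) ^ CARD('n)"
      using c[of n] by (simp add: content_cball)
    also have "\<dots> = V / c n ^ CARD('n)" by (simp add: V_def power_divide)
    also have "\<dots> \<le> V / c n ^ 3"
      using c[of n] dim V0 by (intro divide_left_mono power_increasing) auto
    finally show ?thesis .
  qed
  \<comment> \<open>An integrand at most K, and nonpositive outside the ball of radius 2/c,
    integrates to at most K times the volume bound. This is applied to the squared gradient and to
    the square of \<open>\<rho> n\<close>.\<close>
  have bound: "(LINT x|M. f x) \<le> K * (V / c n ^ 3)"
    if "integrable M f" "\<And>x. f x \<le> K" "\<And>x. x \<notin> ?A n \<Longrightarrow> f x \<le> 0" "K \<ge> 0" for f K n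
  proof -
    have mA: "?A n \<inter> \<Omega> \<in> sets M" using Om_sets by (auto simp: sets_restrict_space_iff)
    have "(LINT x|M. f x) \<le> (LINT x|M. K * indicator (?A n \<inter> \<Omega>) x)"
    proof (rule integral_mono)
      show "integrable M (\<lambda>x. K * indicator (?A n \<inter> \<Omega>) x)"
        using mA by (intro integrable_mult_right integrable_real_indicator M.emeasure_finite[unfolded less_top]) (auto simp: less_top[symmetric])
      show "f x \<le> K * indicator (?A n \<inter> \<Omega>) x" if "x \<in> space M" for x
        using that \<open>\<And>x. f x \<le> K\<close>[of x] \<open>\<And>x. x \<notin> ?A n \<Longrightarrow> f x \<le> 0\<close>[of x] by (cases "x \<in> ?A n") auto
    qed fact
    also have "\<dots> = K * measure M (?A n \<inter> \<Omega>)"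
      using mA by (simp add: Int_assoc)
    also have "\<dots> \<le> K * (V / c n ^ 3)" using meas that(4) by (intro mult_left_mono) auto
    finally show ?thesis .
  qed
  have cinf: "(\<lambda>n. 1 / c n) \<longlonglongrightarrow> 0"
    unfolding c_def by (rule tendsto_inverse_Suc)
  have fb: "form (\<rho> n) (\<rho> n) \<le> B\<^sup>2 * (1 + E)\<^sup>2 * V * (1 / c n)" for n
  proof -
    have "(LINT x|M. grad (\<rho> n) x \<bullet> grad (\<rho> n) x) \<le> (B + B * (c n * E))\<^sup>2 * (V / c n ^ 3)"
    proof (rule bound)
      show "grad (\<rho> n) x \<bullet> grad (\<rho> n) x \<le> (B + B * (c n * E))\<^sup>2" for x
        unfolding power2_norm_eq_inner[symmetric] using g\<rho> by (intro power_mono) auto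
    qed (auto simp: integrable_grad_grad[OF \<rho>T \<rho>T] out)
    also have "\<dots> \<le> (c n * (B * (1 + E)))\<^sup>2 * (V / c n ^ 3)"
    proof (intro mult_right_mono power_mono)
      have "B * 1 \<le> B * c n" using B(1) c[of n] by (intro mult_left_mono) auto
      then show "B + B * (c n * E) \<le> c n * (B * (1 + E))" by (simp add: algebra_simps)
    qed (use B E c[of n] V0 in auto)
    also have "\<dots> = B\<^sup>2 * (1 + E)\<^sup>2 * V * (1 / c n)"
      using c[of n] by (simp add: power_mult_distrib power2_eq_square power3_eq_cube)
    finally show ?thesis using form_le_grad[OF \<rho>T] by (meson order_trans)
  qed
  have nb: "(n2 (\<rho> n))\<^sup>2 \<le> B\<^sup>2 * V * (1 / c n)" for n
  proof -
    have "(LINT x|M. (\<rho> n x)\<^sup>2) \<le> B\<^sup>2 * (V / c n ^ 3)"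
    proof (rule bound)
      show "integrable M (\<lambda>x. (\<rho> n x)\<^sup>2)" using sqD sq_test[OF \<rho>T] by blast
      show "(\<rho> n x)\<^sup>2 \<le> B\<^sup>2" for x
      proof -
        have "\<bar>\<rho> n x\<bar> \<le> B * 1" unfolding \<rho>_def abs_mult using B \<eta>b by (intro mult_mono) auto
        then show ?thesis using B(1) by (simp add: abs_le_square_iff[symmetric])
      qed
    qed (auto simp: out)
    also have "\<dots> \<le> B\<^sup>2 * (V / c n)"
      using c[of n] V0 by (intro mult_left_mono divide_left_mono) (auto intro: power_increasing[of 1 3, simplified])
    finally show ?thesis by (simp add: n2_sq)
  qed
  have diff: "(\<lambda>x. \<phi> x - \<psi> n x) = \<rho> n" for n by (simp add: \<psi>_def fun_eq_iff)
  define e where "e n = B\<^sup>2 * (1 + E)\<^sup>2 * V * (1 / c n) + sqrt (B\<^sup>2 * V * (1 / c n))" for n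
  have "e \<longlonglongrightarrow> B\<^sup>2 * (1 + E)\<^sup>2 * V * 0 + sqrt (B\<^sup>2 * V * 0)"
    unfolding e_def by (intro tendsto_intros cinf)
  then have "e \<longlonglongrightarrow> 0" by simp
  moreover have "form (\<rho> n) (\<rho> n) \<le> e n" for n
  proof -
    have "0 \<le> sqrt (B\<^sup>2 * V * (1 / c n))" using V0 c[of n] by simp
    then show ?thesis using fb[of n] unfolding e_def by linarith
  qed
  moreover have "n2 (\<rho> n) \<le> e n" for n
  proof -
    have "n2 (\<rho> n) \<le> sqrt (B\<^sup>2 * V * (1 / c n))" using nb by (rule real_le_rsqrt)
    moreover have "0 \<le> B\<^sup>2 * (1 + E)\<^sup>2 * V * (1 / c n)" using V0 c[of n] by simp
    ultimately show ?thesis unfolding e_def by linarith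
  qed
  ultimately show ?thesis using \<psi>D by (intro exI[of _ \<psi>] exI[of _ e]) (simp add: diff)
qed

definition hardy_op :: "(real^'n \<Rightarrow> real) \<Rightarrow> real^'n \<Rightarrow> real" where
  "hardy_op \<psi> x = - (\<Sum>i\<in>UNIV. partial i (partial i \<psi>) x) - \<mu> * (\<psi> x / (norm x)\<^sup>2)"

lemma sq_hardy_op: assumes "\<psi> \<in> \<D>" shows "sq (hardy_op \<psi>)"
proof -
  note m = measurable_test[OF assms]
  have s1: "sq (\<lambda>x. \<psi> x / (norm x)\<^sup>2)"
  proof -
    obtain B where "\<forall>x. \<bar>\<psi> x\<bar> / (norm x)\<^sup>2 \<le> B" using D_hgrad_bounded[OF assms] by blast
    moreover have "(\<lambda>x. \<psi> x / (norm x)\<^sup>2) \<in> borel_measurable M" using m by measurable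
    ultimately show ?thesis using sq_bound[OF _ sq_const[of 1], of "\<lambda>x. \<psi> x / (norm x)\<^sup>2" B] by simp
  qed
  have "sq (\<lambda>x. \<Sum>i\<in>I. partial i (partial i \<psi>) x)" if "finite I" for I :: "'n set"
    using that by induction
      (auto intro!: sq_add sq_const[of 0, simplified] sq_test[OF test_functions_partial[OF test_functions_partial[OF assms]]])
  then have s2: "sq (\<lambda>x. \<Sum>i\<in>UNIV. partial i (partial i \<psi>) x)" by simp
  show ?thesis
    unfolding hardy_op_def[abs_def]
    using sq_diff[OF sq_cmult[OF s2, of "-1"] sq_cmult[OF s1, of \<mu>]] by simp
qed

text \<open>All derivatives are moved onto \<open>\<psi>\<close>. Since \<open>\<psi>\<close>
  vanishes near the origin, \<open>hardy_op \<psi>\<close> is square integrable, which makes the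
  form L^2 continuous in \<open>\<phi>\<close>.\<close>

lemma form_hardy_op:
  assumes "\<phi> \<in> \<T>" "\<psi> \<in> \<D>"
  shows "form \<phi> \<psi> = (LINT x|M. \<phi> x * hardy_op \<psi> x)"
proof -
  note T = D_subset_T[OF assms(2)]
  note P = test_functions_partial[OF T] and PP = test_functions_partial[OF test_functions_partial[OF T]]
  have s: "sq \<phi>" using sq_test[OF assms(1)] .
  have i1: "integrable M (\<lambda>x. partial i \<phi> x * partial i \<psi> x)" for i
    using sq_test[OF test_functions_partial[OF assms(1)]] sq_test[OF P] by (rule integrable_mult_sq)
  have i2: "integrable M (\<lambda>x. \<phi> x * partial i (partial i \<psi>) x)" for i
    using s sq_test[OF PP] by (rule integrable_mult_sq)
  have "(LINT x|M. partial i \<phi> x * partial i \<psi> x) = - (LINT x|M. \<phi> x * partial i (partial i \<psi>) x)" for i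
  proof -
    have "has_grad (\<lambda>x. \<phi> x * partial i \<psi> x) (\<phi> x *\<^sub>R grad (partial i \<psi>) x + partial i \<psi> x *\<^sub>R grad \<phi> x) x" for x
      by (rule has_grad_mult[OF test_functions_has_grad[OF assms(1)] test_functions_has_grad[OF P]])
    from partial_has_grad[OF this]
    have "partial i (\<lambda>x. \<phi> x * partial i \<psi> x) x = \<phi> x * partial i (partial i \<psi>) x + partial i \<phi> x * partial i \<psi> x" for x
      by (simp add: grad_def)
    then have "(LINT x|M. \<phi> x * partial i (partial i \<psi>) x + partial i \<phi> x * partial i \<psi> x) = 0"
      using integral_partial_M[OF test_functions_mult[OF assms(1) P], of i i] by simp
    then show ?thesis using i1 i2 by simp
  qed
  then have "(LINT x|M. grad \<phi> x \<bullet> grad \<psi> x) = - (\<Sum>i\<in>UNIV. LINT x|M. \<phi> x * partial i (partial i \<psi>) x)"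
    using i1 by (simp add: inner_vec_def grad_def sum_negf)
  then have g: "(LINT x|M. grad \<phi> x \<bullet> grad \<psi> x) = - (LINT x|M. \<phi> x * (\<Sum>i\<in>UNIV. partial i (partial i \<psi>) x))"
    using i2 by (simp add: sum_distrib_left)
  have i3: "integrable M (\<lambda>x. \<phi> x * (\<Sum>i\<in>UNIV. partial i (partial i \<psi>) x))"
    using i2 by (simp add: sum_distrib_left)
  have i4: "integrable M (\<lambda>x. \<phi> x * \<psi> x / (norm x)\<^sup>2)" using integrable_hardy[OF assms(1) T] .
  have e: "\<phi> x * hardy_op \<psi> x = 0 + (-1) * (\<phi> x * (\<Sum>i\<in>UNIV. partial i (partial i \<psi>) x)) - \<mu> * (\<phi> x * \<psi> x / (norm x)\<^sup>2)" for x
    by (simp add: hardy_op_def algebra_simps)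
  have "(LINT x|M. \<phi> x * hardy_op \<psi> x) = (LINT x|M. 0) + (-1) * (LINT x|M. \<phi> x * (\<Sum>i\<in>UNIV. partial i (partial i \<psi>) x))
      - \<mu> * (LINT x|M. \<phi> x * \<psi> x / (norm x)\<^sup>2)"
    unfolding e by (rule integral_lin3[OF _ i3 i4]) simp
  then show ?thesis unfolding form_eq g by simp
qed

end

section \<open>The completion as a space of functions\<close>

lemma test_functions_diff:
  assumes "\<phi> \<in> test_functions S" "\<psi> \<in> test_functions S"
  shows "(\<lambda>x. \<phi> x - \<psi> x) \<in> test_functions S"
  using test_functions_lincomb[OF assms, of 1 "-1"] by simp

context bounded_open begin

lemma n2_lim_unique:
  assumes "\<And>n. sq (f n)" "sq g" "sq h" "(\<lambda>n. n2 (\<lambda>x. f n x - g x)) \<longlonglongrightarrow> 0" "(\<lambda>n. n2 (\<lambda>x. f n x - h x)) \<longlonglongrightarrow> 0"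
  shows "AE x in M. g x = h x"
proof -
  have "(\<lambda>n. n2 (\<lambda>x. f n x - g x) + n2 (\<lambda>x. f n x - h x)) \<longlonglongrightarrow> 0 + 0" using assms(4,5) by (rule tendsto_add)
  moreover have "n2 (\<lambda>x. g x - h x) \<le> n2 (\<lambda>x. f n x - g x) + n2 (\<lambda>x. f n x - h x)" for n
    using n2_triangle_diff[OF assms(2) assms(1) assms(3), of n] unfolding n2_minus[of g] by simp
  ultimately have "n2 (\<lambda>x. g x - h x) \<le> 0 + 0" by (intro LIMSEQ_le_const) auto
  then have "n2 (\<lambda>x. g x - h x) = 0" using n2_nonneg[of "\<lambda>x. g x - h x"] by simp
  from n2_eq_0[OF sq_diff[OF assms(2,3)] this] show ?thesis by eventually_elim simp
qed

lemma nn_integral_sq: "sq f \<Longrightarrow> (\<integral>\<^sup>+x. ennreal ((f x)\<^sup>2) \<partial>M) = ennreal ((n2 f)\<^sup>2)"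
  unfolding n2_sq by (intro nn_integral_eq_integral) (auto simp: sq_def)

lemma sq_nn_integral:
  assumes "f \<in> borel_measurable M" "(\<integral>\<^sup>+x. ennreal ((f x)\<^sup>2) \<partial>M) < \<infinity>"
  shows "sq f"
  unfolding sq_def using assms by (auto intro!: integrableI_bounded)

text \<open>On a finite measure an L^2 Cauchy sequence is Cauchy in L^1 and so has an a.e.
  convergent subsequence. Fatou's lemma along it turns the Cauchy bounds into L^2 convergence of the
  full sequence.\<close>

lemma L2_complete:
  assumes sq: "\<And>n. sq (f n)"
    and cau: "\<And>e. e > 0 \<Longrightarrow> \<exists>N. \<forall>i\<ge>N. \<forall>j\<ge>N. n2 (\<lambda>x. f i x - f j x) < e"
  shows "\<exists>g. sq g \<and> (\<lambda>n. n2 (\<lambda>x. f n x - g x)) \<longlonglongrightarrow> 0"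
proof -
  let ?c = "n2 (\<lambda>_. 1) + 1"
  have c: "?c > 0" using n2_nonneg[of "\<lambda>_. 1"] by linarith
  have cau1: "\<exists>N. \<forall>i\<ge>N. \<forall>j\<ge>N. (LINT x|M. norm (f i x - f j x)) < e" if "e > 0" for e
  proof -
    obtain N where N: "\<forall>i\<ge>N. \<forall>j\<ge>N. n2 (\<lambda>x. f i x - f j x) < e / ?c" using cau[of "e / ?c"] c \<open>e > 0\<close> by auto
    have "(LINT x|M. norm (f i x - f j x)) < e" if "i \<ge> N" "j \<ge> N" for i j
    proof -
      have "(LINT x|M. norm (f i x - f j x)) \<le> n2 (\<lambda>x. f i x - f j x) * n2 (\<lambda>_. 1)"
        using L1_le_n2[OF sq_diff[OF sq sq], of i j] by simp
      also have "\<dots> \<le> n2 (\<lambda>x. f i x - f j x) * ?c" by (intro mult_left_mono n2_nonneg) auto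
      also have "\<dots> < e / ?c * ?c" using N that c by (intro mult_strict_right_mono) auto
      finally show ?thesis using c by simp
    qed
    then show ?thesis by blast
  qed
  obtain r where r: "strict_mono r" "AE x in M. Cauchy (\<lambda>i. f (r i) x)"
    using cauchy_L1_AE_cauchy_subseq[OF sq_integrable[OF sq] cau1] by blast
  define g where "g x = lim (\<lambda>i. f (r i) x)" for x
  have fm: "f n \<in> borel_measurable M" for n using sqD(1)[OF sq] .
  have gm: "g \<in> borel_measurable M" unfolding g_def using fm by (intro borel_measurable_lim_metric)
  have lim: "AE x in M. (\<lambda>i. f (r i) x) \<longlonglongrightarrow> g x"
    using r(2) by eventually_elim (simp add: g_def Cauchy_convergent_iff convergent_LIMSEQ_iff)
  have key: "\<exists>N. \<forall>n\<ge>N. (\<integral>\<^sup>+x. ennreal ((f n x - g x)\<^sup>2) \<partial>M) \<le> ennreal (e\<^sup>2)" if "e > 0" for e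
  proof -
    obtain N where N: "\<forall>i\<ge>N. \<forall>j\<ge>N. n2 (\<lambda>x. f i x - f j x) < e" using cau[OF \<open>e > 0\<close>] by blast
    have "(\<integral>\<^sup>+x. ennreal ((f n x - g x)\<^sup>2) \<partial>M) \<le> ennreal (e\<^sup>2)" if "n \<ge> N" for n
    proof -
      have "(\<integral>\<^sup>+x. ennreal ((f n x - g x)\<^sup>2) \<partial>M) \<le> (\<integral>\<^sup>+x. liminf (\<lambda>i. ennreal ((f n x - f (r i) x)\<^sup>2)) \<partial>M)"
      proof (rule nn_integral_mono_AE)
        show "AE x in M. ennreal ((f n x - g x)\<^sup>2) \<le> liminf (\<lambda>i. ennreal ((f n x - f (r i) x)\<^sup>2))"
          using lim
        proof eventually_elim
          case (elim x)
          then have "(\<lambda>i. ennreal ((f n x - f (r i) x)\<^sup>2)) \<longlonglongrightarrow> ennreal ((f n x - g x)\<^sup>2)"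
            by (intro tendsto_ennrealI tendsto_intros)
          from lim_imp_Liminf[OF _ this] show ?case by simp
        qed
      qed
      also have "\<dots> \<le> liminf (\<lambda>i. \<integral>\<^sup>+x. ennreal ((f n x - f (r i) x)\<^sup>2) \<partial>M)"
        using fm by (intro nn_integral_liminf) measurable
      also have "\<dots> \<le> ennreal (e\<^sup>2)"
      proof (rule Liminf_le)
        have "(\<integral>\<^sup>+x. ennreal ((f n x - f (r i) x)\<^sup>2) \<partial>M) \<le> ennreal (e\<^sup>2)" if "i \<ge> N" for i
        proof -
          have "r i \<ge> N" using seq_suble[OF r(1), of i] that by linarith
          then have "n2 (\<lambda>x. f n x - f (r i) x) \<le> e" using N \<open>n \<ge> N\<close> by (simp add: less_imp_le)
          then show ?thesis unfolding nn_integral_sq[OF sq_diff[OF sq sq]]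
            using n2_nonneg by (intro ennreal_leI power_mono) auto
        qed
        then show "\<forall>\<^sub>F i in sequentially. (\<integral>\<^sup>+x. ennreal ((f n x - f (r i) x)\<^sup>2) \<partial>M) \<le> ennreal (e\<^sup>2)"
          by (rule eventually_sequentiallyI)
      qed simp
      finally show ?thesis .
    qed
    then show ?thesis by blast
  qed
  have sqg: "sq g"
  proof -
    obtain N where N: "(\<integral>\<^sup>+x. ennreal ((f N x - g x)\<^sup>2) \<partial>M) \<le> ennreal (1\<^sup>2)" using key[of 1] by auto
    have "sq (\<lambda>x. f N x - g x)"
      by (rule sq_nn_integral) (use fm gm le_less_trans[OF N ennreal_less_top] in auto)
    from sq_diff[OF sq this, of N] show ?thesis by simp
  qed
  have "(\<lambda>n. n2 (\<lambda>x. f n x - g x)) \<longlonglongrightarrow> 0"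
  proof (rule LIMSEQ_I)
    fix e :: real assume "e > 0"
    obtain N where N: "\<forall>n\<ge>N. (\<integral>\<^sup>+x. ennreal ((f n x - g x)\<^sup>2) \<partial>M) \<le> ennreal ((e/2)\<^sup>2)"
      using key[of "e/2"] \<open>e > 0\<close> by auto
    have "norm (n2 (\<lambda>x. f n x - g x) - 0) < e" if "n \<ge> N" for n
    proof -
      have "ennreal ((n2 (\<lambda>x. f n x - g x))\<^sup>2) \<le> ennreal ((e/2)\<^sup>2)"
        using N that unfolding nn_integral_sq[OF sq_diff[OF sq sqg]] by blast
      then have "(n2 (\<lambda>x. f n x - g x))\<^sup>2 \<le> (e/2)\<^sup>2" by (simp add: ennreal_le_iff)
      then have "n2 (\<lambda>x. f n x - g x) \<le> e/2" by (rule power2_le_imp_le) (use \<open>e > 0\<close> in simp)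
      then show ?thesis using \<open>e > 0\<close> n2_nonneg[of "\<lambda>x. f n x - g x"] by simp
    qed
    then show "\<exists>no. \<forall>n\<ge>no. norm (n2 (\<lambda>x. f n x - g x) - 0) < e" by blast
  qed
  then show ?thesis using sqg by blast
qed

end

locale hardy_model = hardy_domain \<Omega> \<mu> for \<Omega> :: "(real^'n::finite) set" and \<mu> :: real +
  fixes emb :: "(real^'n \<Rightarrow> real) \<Rightarrow> 'h::{real_inner,complete_space}"
  assumes model: "is_H_mu \<Omega> \<mu> emb"
begin

lemma emb_inner: "\<phi> \<in> \<T> \<Longrightarrow> \<psi> \<in> \<T> \<Longrightarrow> emb \<phi> \<bullet> emb \<psi> = form \<phi> \<psi>"
  using model unfolding is_H_mu_def by blast

lemma emb_diff: assumes "\<phi> \<in> \<T>" "\<psi> \<in> \<T>" shows "emb (\<lambda>x. \<phi> x - \<psi> x) = emb \<phi> - emb \<psi>"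
proof -
  have "emb (\<lambda>x. 1 * \<phi> x + (-1) * \<psi> x) = 1 *\<^sub>R emb \<phi> + (-1) *\<^sub>R emb \<psi>"
    using model assms unfolding is_H_mu_def by blast
  then show ?thesis by simp
qed

lemma norm_emb: "\<phi> \<in> \<T> \<Longrightarrow> (norm (emb \<phi>))\<^sup>2 = form \<phi> \<phi>"
  by (simp add: power2_norm_eq_inner emb_inner)

lemma norm_emb_diff: "\<phi> \<in> \<T> \<Longrightarrow> \<psi> \<in> \<T> \<Longrightarrow>
    (norm (emb \<phi> - emb \<psi>))\<^sup>2 = form (\<lambda>x. \<phi> x - \<psi> x) (\<lambda>x. \<phi> x - \<psi> x)"
  using norm_emb[OF test_functions_diff] by (simp add: emb_diff)

text \<open>Extends \<open>L2_bound_D\<close> across the origin by approximation; this is why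
  \<open>D_approx\<close> controls the form and the L^2 norm simultaneously.\<close>

lemma L2_bound_T: assumes "\<phi> \<in> \<T>" shows "n2 \<phi> \<le> radius * norm (emb \<phi>)"
proof -
  have D: "n2 \<psi> \<le> radius * norm (emb \<psi>)" if "\<psi> \<in> \<D>" for \<psi>
  proof (rule power2_le_imp_le)
    show "(n2 \<psi>)\<^sup>2 \<le> (radius * norm (emb \<psi>))\<^sup>2"
      unfolding power_mult_distrib norm_emb[OF D_subset_T[OF that]] n2_sq by (rule L2_bound_D[OF that])
  qed (use radius_pos in simp)
  obtain \<psi> and e :: "nat \<Rightarrow> real" where \<psi>: "\<forall>n. \<psi> n \<in> \<D>" "e \<longlonglongrightarrow> 0"
    "\<forall>n. form (\<lambda>x. \<phi> x - \<psi> n x) (\<lambda>x. \<phi> x - \<psi> n x) \<le> e n \<and> n2 (\<lambda>x. \<phi> x - \<psi> n x) \<le> e n"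
    using D_approx[OF assms] by blast
  have le: "n2 \<phi> \<le> radius * (norm (emb \<phi>) + sqrt (e n)) + e n" for n
  proof -
    have T: "\<psi> n \<in> \<T>" using \<psi>(1) D_subset_T by blast
    have "n2 \<phi> \<le> n2 (\<lambda>x. \<phi> x - \<psi> n x) + n2 (\<psi> n)"
      using n2_triangle[OF sq_diff[OF sq_test[OF assms] sq_test[OF T]] sq_test[OF T]] by simp
    moreover have "norm (emb \<phi> - emb (\<psi> n)) \<le> sqrt (e n)"
      by (rule real_le_rsqrt) (use norm_emb_diff[OF assms T] \<psi>(3) in simp)
    then have "norm (emb (\<psi> n)) \<le> norm (emb \<phi>) + sqrt (e n)"
      using norm_triangle_sub[of "emb (\<psi> n)" "emb \<phi>"] by (simp add: norm_minus_commute)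
    then have "radius * norm (emb (\<psi> n)) \<le> radius * (norm (emb \<phi>) + sqrt (e n))"
      using radius_pos by (intro mult_left_mono) auto
    moreover have "n2 (\<psi> n) \<le> radius * norm (emb (\<psi> n))" using D \<psi>(1) by blast
    moreover have "n2 (\<lambda>x. \<phi> x - \<psi> n x) \<le> e n" using \<psi>(3) by blast
    ultimately show ?thesis by linarith
  qed
  have "(\<lambda>n. radius * (norm (emb \<phi>) + sqrt (e n)) + e n) \<longlonglongrightarrow> radius * (norm (emb \<phi>) + sqrt 0) + 0"
    by (intro tendsto_intros \<psi>(2))
  then have "n2 \<phi> \<le> radius * (norm (emb \<phi>) + sqrt 0) + 0"
    by (rule LIMSEQ_le_const) (use le in blast)
  then show ?thesis by simp
qed

lemma D_dense: assumes "e > 0" shows "\<exists>\<phi>\<in>\<D>. norm (emb \<phi> - u) < e"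
proof -
  have "u \<in> closure (emb ` \<T>)" using model unfolding is_H_mu_def by auto
  then obtain \<phi> where \<phi>: "\<phi> \<in> \<T>" "norm (emb \<phi> - u) < e / 2"
    using assms unfolding closure_approachable dist_norm by (metis half_gt_zero imageE)
  obtain \<psi> and d :: "nat \<Rightarrow> real" where \<psi>: "\<forall>n. \<psi> n \<in> \<D>" "d \<longlonglongrightarrow> 0"
    "\<forall>n. form (\<lambda>x. \<phi> x - \<psi> n x) (\<lambda>x. \<phi> x - \<psi> n x) \<le> d n \<and> n2 (\<lambda>x. \<phi> x - \<psi> n x) \<le> d n"
    using D_approx[OF \<phi>(1)] by blast
  have "\<forall>\<^sub>F n in sequentially. d n < (e/2)\<^sup>2" using \<psi>(2) assms by (intro order_tendstoD) auto
  then obtain n where n: "d n < (e/2)\<^sup>2" using eventually_happens by fastforce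
  have T: "\<psi> n \<in> \<T>" using \<psi>(1) D_subset_T by blast
  have "(norm (emb \<phi> - emb (\<psi> n)))\<^sup>2 < (e/2)\<^sup>2" using norm_emb_diff[OF \<phi>(1) T] \<psi>(3) n by (metis le_less_trans)
  then have "norm (emb \<phi> - emb (\<psi> n)) < e/2" by (rule power2_less_imp_less) (use assms in simp)
  then have "norm (emb (\<psi> n) - u) < e"
    using \<phi>(2) norm_triangle_ineq[of "emb (\<psi> n) - emb \<phi>" "emb \<phi> - u"] by (simp add: norm_minus_commute)
  then show ?thesis using \<psi>(1) by blast
qed

lemma D_seq: "\<exists>\<phi>. (\<forall>n::nat. \<phi> n \<in> \<D>) \<and> (\<lambda>n. emb (\<phi> n)) \<longlonglongrightarrow> u"
proof -
  have "\<forall>n::nat. \<exists>\<phi>. \<phi> \<in> \<D> \<and> norm (emb \<phi> - u) < 1 / (real n + 1)" using D_dense by (auto simp: Bex_def)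
  then obtain \<phi> where \<phi>: "\<forall>n::nat. \<phi> n \<in> \<D> \<and> norm (emb (\<phi> n) - u) < 1 / (real n + 1)" by metis
  have "(\<lambda>n. emb (\<phi> n) - u) \<longlonglongrightarrow> 0"
    by (rule Lim_null_comparison[OF _ tendsto_inverse_Suc]) (use \<phi> in \<open>auto intro!: always_eventually less_imp_le\<close>)
  then have "(\<lambda>n. emb (\<phi> n)) \<longlonglongrightarrow> u" by (rule LIM_zero_cancel)
  then show ?thesis using \<phi> by blast
qed

section \<open>Representatives of elements of the completion\<close>

abbreviation fn :: "'h \<Rightarrow> real^'n \<Rightarrow> real" where "fn \<equiv> fn_of \<Omega> emb"

text \<open>The definition asks only for measurability of \<open>f\<close>. As the integrals tend to
  0, one of them is finite, and then \<open>f\<close> differs from a test function by a square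
  integrable function.\<close>

lemma represents_iff:
  "represents \<Omega> emb u f \<longleftrightarrow> sq f \<and> (\<exists>\<phi>. (\<forall>n. \<phi> n \<in> \<T>) \<and> (\<lambda>n. emb (\<phi> n)) \<longlonglongrightarrow> u \<and>
     (\<lambda>n. n2 (\<lambda>x. \<phi> n x - f x)) \<longlonglongrightarrow> 0)" (is "?L \<longleftrightarrow> ?R")
proof
  assume ?L
  then obtain \<phi> where fm: "f \<in> borel_measurable M" and \<phi>: "\<forall>n. \<phi> n \<in> \<T>" "(\<lambda>n. emb (\<phi> n)) \<longlonglongrightarrow> u"
    "(\<lambda>n. \<integral>\<^sup>+x. ennreal ((\<phi> n x - f x)\<^sup>2) \<partial>M) \<longlonglongrightarrow> 0" unfolding represents_def by blast
  have "\<forall>\<^sub>F n in sequentially. (\<integral>\<^sup>+x. ennreal ((\<phi> n x - f x)\<^sup>2) \<partial>M) < 1"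
    using \<phi>(3) by (rule order_tendstoD) simp
  then obtain n where n: "(\<integral>\<^sup>+x. ennreal ((\<phi> n x - f x)\<^sup>2) \<partial>M) < 1" using eventually_happens by fastforce
  have T: "\<phi> n \<in> \<T>" using \<phi>(1) by blast
  have "sq (\<lambda>x. \<phi> n x - f x)"
  proof (rule sq_nn_integral)
    show "(\<lambda>x. \<phi> n x - f x) \<in> borel_measurable M" using measurable_test[OF T] fm by simp
    show "(\<integral>\<^sup>+x. ennreal ((\<phi> n x - f x)\<^sup>2) \<partial>M) < \<infinity>" using less_trans[OF n] by simp
  qed
  from sq_diff[OF sq_test[OF T] this] have f: "sq f" by simp
  have s: "sq (\<lambda>x. \<phi> n x - f x)" for n using sq_diff[OF sq_test f] \<phi>(1) by blast
  have "(\<lambda>n. ennreal ((n2 (\<lambda>x. \<phi> n x - f x))\<^sup>2)) \<longlonglongrightarrow> 0" using \<phi>(3) unfolding nn_integral_sq[OF s] .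
  then have "(\<lambda>n. (n2 (\<lambda>x. \<phi> n x - f x))\<^sup>2) \<longlonglongrightarrow> 0" by (simp add: ennreal_tendsto_0_iff)
  then have "(\<lambda>n. sqrt ((n2 (\<lambda>x. \<phi> n x - f x))\<^sup>2)) \<longlonglongrightarrow> sqrt 0" by (rule tendsto_real_sqrt)
  then have "(\<lambda>n. n2 (\<lambda>x. \<phi> n x - f x)) \<longlonglongrightarrow> 0" by (simp add: n2_nonneg)
  then show ?R using f \<phi>(1,2) by blast
next
  assume ?R
  then obtain \<phi> where f: "sq f" and \<phi>: "\<forall>n. \<phi> n \<in> \<T>" "(\<lambda>n. emb (\<phi> n)) \<longlonglongrightarrow> u"
    "(\<lambda>n. n2 (\<lambda>x. \<phi> n x - f x)) \<longlonglongrightarrow> 0" by blast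
  have s: "sq (\<lambda>x. \<phi> n x - f x)" for n using sq_diff[OF sq_test f] \<phi>(1) by blast
  have "(\<lambda>n. (n2 (\<lambda>x. \<phi> n x - f x))\<^sup>2) \<longlonglongrightarrow> 0\<^sup>2" using \<phi>(3) by (rule tendsto_power)
  then have "(\<lambda>n. ennreal ((n2 (\<lambda>x. \<phi> n x - f x))\<^sup>2)) \<longlonglongrightarrow> 0" by (simp add: ennreal_tendsto_0_iff)
  then have "(\<lambda>n. \<integral>\<^sup>+x. ennreal ((\<phi> n x - f x)\<^sup>2) \<partial>M) \<longlonglongrightarrow> 0" unfolding nn_integral_sq[OF s] .
  then show ?L unfolding represents_def using sqD(1)[OF f] \<phi>(1,2) by blast
qed

lemma n2_emb_diff: "\<phi> \<in> \<T> \<Longrightarrow> \<psi> \<in> \<T> \<Longrightarrow> n2 (\<lambda>x. \<phi> x - \<psi> x) \<le> radius * norm (emb \<phi> - emb \<psi>)"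
  using L2_bound_T[OF test_functions_diff] by (simp add: emb_diff)

lemma represents_ex: "\<exists>f. represents \<Omega> emb u f"
proof -
  obtain \<phi> where \<phi>: "\<forall>n::nat. \<phi> n \<in> \<D>" "(\<lambda>n. emb (\<phi> n)) \<longlonglongrightarrow> u" using D_seq by blast
  have T: "\<phi> n \<in> \<T>" for n using \<phi>(1) D_subset_T by blast
  have "\<exists>f. sq f \<and> (\<lambda>n. n2 (\<lambda>x. \<phi> n x - f x)) \<longlonglongrightarrow> 0"
  proof (rule L2_complete[OF sq_test[OF T]])
    fix e :: real assume "e > 0"
    have "Cauchy (\<lambda>n. emb (\<phi> n))" using \<phi>(2) by (rule LIMSEQ_imp_Cauchy)
    then obtain N where N: "\<forall>i\<ge>N. \<forall>j\<ge>N. norm (emb (\<phi> i) - emb (\<phi> j)) < e / radius"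
      using \<open>e > 0\<close> radius_pos unfolding Cauchy_iff by (meson divide_pos_pos)
    have "n2 (\<lambda>x. \<phi> i x - \<phi> j x) < e" if "i \<ge> N" "j \<ge> N" for i j
    proof -
      have "radius * norm (emb (\<phi> i) - emb (\<phi> j)) < radius * (e / radius)"
        using N that radius_pos by (intro mult_strict_left_mono) auto
      then show ?thesis using n2_emb_diff[OF T T, of i j] radius_pos by simp
    qed
    then show "\<exists>N. \<forall>i\<ge>N. \<forall>j\<ge>N. n2 (\<lambda>x. \<phi> i x - \<phi> j x) < e" by blast
  qed
  then show ?thesis unfolding represents_iff using T \<phi>(2) by blast
qed

lemma fn_represents: "represents \<Omega> emb u (fn u)"
  unfolding fn_of_def using represents_ex by (rule someI_ex)

lemma sq_fn: "sq (fn u)" using fn_represents represents_iff by blast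

text \<open>Every approximating sequence converges to the chosen representative, not only the one
  that comes with it: two such sequences approach each other in the completion, hence in
  L^2.\<close>

lemma fn_conv:
  assumes "\<And>n. \<phi> n \<in> \<T>" "(\<lambda>n. emb (\<phi> n)) \<longlonglongrightarrow> u"
  shows "(\<lambda>n. n2 (\<lambda>x. \<phi> n x - fn u x)) \<longlonglongrightarrow> 0"
proof -
  obtain \<psi> where \<psi>: "\<forall>n. \<psi> n \<in> \<T>" "(\<lambda>n. emb (\<psi> n)) \<longlonglongrightarrow> u" "(\<lambda>n. n2 (\<lambda>x. \<psi> n x - fn u x)) \<longlonglongrightarrow> 0"
    using fn_represents[of u] unfolding represents_iff by blast
  have T: "\<psi> n \<in> \<T>" for n using \<psi>(1) by blast
  have "(\<lambda>n. radius * norm (emb (\<phi> n) - emb (\<psi> n)) + n2 (\<lambda>x. \<psi> n x - fn u x)) \<longlonglongrightarrow> radius * norm (u - u) + 0"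
    by (intro tendsto_intros assms(2) \<psi>(2,3))
  then have lim: "(\<lambda>n. radius * norm (emb (\<phi> n) - emb (\<psi> n)) + n2 (\<lambda>x. \<psi> n x - fn u x)) \<longlonglongrightarrow> 0" by simp
  have le: "norm (n2 (\<lambda>x. \<phi> n x - fn u x)) \<le> radius * norm (emb (\<phi> n) - emb (\<psi> n)) + n2 (\<lambda>x. \<psi> n x - fn u x)" for n
    using n2_triangle_diff[OF sq_test[OF assms(1)] sq_test[OF T] sq_fn[of u], of n n]
      n2_emb_diff[OF assms(1) T, of n n] n2_nonneg[of "\<lambda>x. \<phi> n x - fn u x"] by simp
  show ?thesis by (rule Lim_null_comparison[OF _ lim]) (intro always_eventually allI le)
qed

lemma fn_bound: "n2 (fn u) \<le> radius * norm u"
proof -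
  obtain \<phi> where \<phi>: "\<forall>n::nat. \<phi> n \<in> \<D>" "(\<lambda>n. emb (\<phi> n)) \<longlonglongrightarrow> u" using D_seq by blast
  have T: "\<phi> n \<in> \<T>" for n using \<phi>(1) D_subset_T by blast
  have "(\<lambda>n. radius * norm (emb (\<phi> n)) + n2 (\<lambda>x. \<phi> n x - fn u x)) \<longlonglongrightarrow> radius * norm u + 0"
    by (intro tendsto_intros \<phi>(2) fn_conv T)
  moreover have "n2 (fn u) \<le> radius * norm (emb (\<phi> n)) + n2 (\<lambda>x. \<phi> n x - fn u x)" for n
  proof -
    have "n2 (fn u) \<le> n2 (\<lambda>x. fn u x - \<phi> n x) + n2 (\<phi> n)"
      using n2_triangle[OF sq_diff[OF sq_fn sq_test[OF T]] sq_test[OF T], of u n n] by simp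
    then show ?thesis using L2_bound_T[OF T, of n] unfolding n2_minus[of "fn u"] by linarith
  qed
  ultimately have "n2 (fn u) \<le> radius * norm u + 0" by (intro LIMSEQ_le_const) auto
  then show ?thesis by simp
qed

text \<open>Almost everywhere only, since the three representatives are chosen
  independently.\<close>

lemma fn_diff: "AE x in M. fn (u - v) x = fn u x - fn v x"
proof -
  obtain \<phi> where \<phi>: "\<forall>n::nat. \<phi> n \<in> \<D>" "(\<lambda>n. emb (\<phi> n)) \<longlonglongrightarrow> u" using D_seq by blast
  obtain \<psi> where \<psi>: "\<forall>n::nat. \<psi> n \<in> \<D>" "(\<lambda>n. emb (\<psi> n)) \<longlonglongrightarrow> v" using D_seq by blast
  have T: "\<phi> n \<in> \<T>" "\<psi> n \<in> \<T>" for n using \<phi>(1) \<psi>(1) D_subset_T by blast+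
  note Td = test_functions_diff[OF T(1) T(2)]
  have "(\<lambda>n. emb (\<lambda>x. \<phi> n x - \<psi> n x)) \<longlonglongrightarrow> u - v"
    unfolding emb_diff[OF T] by (intro tendsto_diff \<phi>(2) \<psi>(2))
  from fn_conv[of "\<lambda>n x. \<phi> n x - \<psi> n x", OF Td this]
  have 1: "(\<lambda>n. n2 (\<lambda>x. \<phi> n x - \<psi> n x - fn (u - v) x)) \<longlonglongrightarrow> 0" .
  have "(\<lambda>n. n2 (\<lambda>x. \<phi> n x - fn u x) + n2 (\<lambda>x. \<psi> n x - fn v x)) \<longlonglongrightarrow> 0 + 0"
    by (intro tendsto_add fn_conv T \<phi>(2) \<psi>(2))
  then have lim: "(\<lambda>n. n2 (\<lambda>x. \<phi> n x - fn u x) + n2 (\<lambda>x. \<psi> n x - fn v x)) \<longlonglongrightarrow> 0" by simp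
  have le: "norm (n2 (\<lambda>x. \<phi> n x - \<psi> n x - (fn u x - fn v x))) \<le> n2 (\<lambda>x. \<phi> n x - fn u x) + n2 (\<lambda>x. \<psi> n x - fn v x)" for n
  proof -
    have "n2 (\<lambda>x. (\<phi> n x - fn u x) + (fn v x - \<psi> n x)) \<le> n2 (\<lambda>x. \<phi> n x - fn u x) + n2 (\<lambda>x. fn v x - \<psi> n x)"
      by (intro n2_triangle sq_diff sq_fn sq_test[OF T(1)] sq_test[OF T(2)])
    then show ?thesis unfolding n2_minus[of "fn v"]
      using n2_nonneg[of "\<lambda>x. \<phi> n x - \<psi> n x - (fn u x - fn v x)"] by (simp add: algebra_simps)
  qed
  have "(\<lambda>n. n2 (\<lambda>x. \<phi> n x - \<psi> n x - (fn u x - fn v x))) \<longlonglongrightarrow> 0"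
    by (rule Lim_null_comparison[OF _ lim]) (intro always_eventually allI le)
  from n2_lim_unique[of "\<lambda>n x. \<phi> n x - \<psi> n x", OF sq_test[OF Td] sq_fn sq_diff[OF sq_fn sq_fn] 1 this]
  show ?thesis .
qed

lemma fn_lipschitz: "n2 (\<lambda>x. fn u x - fn v x) \<le> radius * norm (u - v)"
proof -
  have "n2 (\<lambda>x. fn u x - fn v x) \<le> n2 (fn (u - v))"
    by (rule n2_mono[OF sq_diff[OF sq_fn sq_fn] sq_fn]) (use fn_diff[of u v] in eventually_elim, simp)
  then show ?thesis using fn_bound[of "u - v"] by linarith
qed

lemma fn_emb: assumes "\<phi> \<in> \<T>" shows "AE x in M. fn (emb \<phi>) x = \<phi> x"
proof -
  have "(\<lambda>n::nat. n2 (\<lambda>x. \<phi> x - fn (emb \<phi>) x)) \<longlonglongrightarrow> 0"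
    by (rule fn_conv) (auto simp: assms)
  then show ?thesis
    by (intro n2_lim_unique[of "\<lambda>_. \<phi>"] sq_test[OF assms] sq_fn) (auto simp: n2_def)
qed

lemma D_approx_AE:
  "\<exists>\<phi>. (\<forall>n::nat. \<phi> n \<in> \<D>) \<and> (\<lambda>n. emb (\<phi> n)) \<longlonglongrightarrow> u \<and> (\<lambda>n. n2 (\<lambda>x. \<phi> n x - fn u x)) \<longlonglongrightarrow> 0 \<and>
     (AE x in M. (\<lambda>n. \<phi> n x) \<longlonglongrightarrow> fn u x)"
proof -
  obtain \<phi> where \<phi>: "\<forall>n::nat. \<phi> n \<in> \<D>" "(\<lambda>n. emb (\<phi> n)) \<longlonglongrightarrow> u" using D_seq by blast
  have T: "\<phi> n \<in> \<T>" for n using \<phi>(1) D_subset_T by blast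
  obtain r :: "nat \<Rightarrow> nat" where r: "strict_mono r" "AE x in M. (\<lambda>n. \<phi> (r n) x) \<longlonglongrightarrow> fn u x"
    using n2_AE_subseq[OF sq_test[OF T] sq_fn fn_conv[OF T \<phi>(2)]] by blast
  have "(\<lambda>n. emb (\<phi> (r n))) \<longlonglongrightarrow> u" using LIMSEQ_subseq_LIMSEQ[OF \<phi>(2) r(1)] by (simp add: o_def)
  then show ?thesis using \<phi>(1) r(2) fn_conv[of "\<lambda>n. \<phi> (r n)", OF T] by (intro exI[of _ "\<lambda>n. \<phi> (r n)"]) blast
qed

text \<open>For \<open>\<psi>\<close> supported away from the origin, \<open>hardy_form \<Omega> \<mu> \<phi> \<psi>\<close> is an \<open>L\<^sup>2\<close>-pairing of \<open>\<phi>\<close> with a bounded function, so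
  \<open>L\<^sup>2\<close>-limits of bounded sequences are weak limits.\<close>

lemma weak_conv:
  assumes c: "\<And>n. c n \<in> \<D>" and K: "\<And>n. norm (emb (c n)) \<le> K" and lim: "(\<lambda>n. n2 (\<lambda>x. c n x - fn u x)) \<longlonglongrightarrow> 0"
  shows "(\<lambda>n. emb (c n) \<bullet> v) \<longlonglongrightarrow> u \<bullet> v"
proof -
  have cT: "c n \<in> \<T>" for n using c D_subset_T by blast
  have D: "(\<lambda>n. emb (c n) \<bullet> emb \<psi>) \<longlonglongrightarrow> u \<bullet> emb \<psi>" if "\<psi> \<in> \<D>" for \<psi>
  proof -
    note \<psi>T = D_subset_T[OF that]
    \<comment> \<open>The limit depends on the L^2 limit alone. A sequence that converges to
      \<open>u\<close> in the completion as well identifies it as the inner product of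
      \<open>u\<close> with \<open>emb \<psi>\<close>.\<close>
    have gen: "(\<lambda>n. emb (d n) \<bullet> emb \<psi>) \<longlonglongrightarrow> (LINT x|M. fn u x * hardy_op \<psi> x)"
      if d: "\<And>n. d n \<in> \<T>" "(\<lambda>n. n2 (\<lambda>x. d n x - fn u x)) \<longlonglongrightarrow> 0" for d :: "nat \<Rightarrow> _"
      unfolding emb_inner[OF d(1) \<psi>T] form_hardy_op[OF d(1) \<open>\<psi> \<in> \<D>\<close>]
      by (rule integral_tendsto_sq[OF sq_test[OF d(1)] sq_fn sq_hardy_op[OF \<open>\<psi> \<in> \<D>\<close>] d(2)])
    obtain \<phi> where \<phi>: "\<forall>n::nat. \<phi> n \<in> \<D>" "(\<lambda>n. emb (\<phi> n)) \<longlonglongrightarrow> u" using D_seq by blast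
    have T: "\<phi> n \<in> \<T>" for n using \<phi>(1) D_subset_T by blast
    have "(\<lambda>n. emb (\<phi> n) \<bullet> emb \<psi>) \<longlonglongrightarrow> u \<bullet> emb \<psi>" by (intro tendsto_intros \<phi>(2))
    then have "u \<bullet> emb \<psi> = (LINT x|M. fn u x * hardy_op \<psi> x)"
      by (rule LIMSEQ_unique[OF _ gen[OF T fn_conv[OF T \<phi>(2)]]])
    then show ?thesis using gen[OF cT lim] by simp
  qed
  have K0: "K \<ge> 0" using K[of 0] norm_ge_zero order_trans by blast
  show ?thesis
  proof (rule LIMSEQ_I)
    fix e :: real assume "e > 0"
    define d where "d = e / (2 * (K + norm u + 1))"
    have d: "d > 0" using \<open>e > 0\<close> K0 by (simp add: d_def add_nonneg_pos)
    obtain \<psi> where \<psi>: "\<psi> \<in> \<D>" "norm (emb \<psi> - v) < d" using D_dense[OF d] by blast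
    obtain N where N: "\<forall>n\<ge>N. norm (emb (c n) \<bullet> emb \<psi> - u \<bullet> emb \<psi>) < e / 2"
      using LIMSEQ_D[OF D[OF \<psi>(1)], of "e/2"] \<open>e > 0\<close> by auto
    have "norm (emb (c n) \<bullet> v - u \<bullet> v) < e" if "n \<ge> N" for n
    proof -
      have eq: "emb (c n) \<bullet> v - u \<bullet> v = (emb (c n) \<bullet> emb \<psi> - u \<bullet> emb \<psi>) - (emb (c n) - u) \<bullet> (emb \<psi> - v)"
        by (simp add: inner_diff_left inner_diff_right)
      have "\<bar>(emb (c n) - u) \<bullet> (emb \<psi> - v)\<bar> \<le> norm (emb (c n) - u) * norm (emb \<psi> - v)" by (rule Cauchy_Schwarz_ineq2)
      also have "\<dots> \<le> (K + norm u + 1) * d"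
        using K[of n] \<psi>(2) norm_triangle_ineq4[of "emb (c n)" u] K0 by (intro mult_mono) auto
      also have "\<dots> = e / 2" unfolding d_def using K0 by (simp add: add_nonneg_eq_0_iff field_simps)
      finally have "\<bar>(emb (c n) - u) \<bullet> (emb \<psi> - v)\<bar> \<le> e / 2" .
      moreover have "\<bar>emb (c n) \<bullet> emb \<psi> - u \<bullet> emb \<psi>\<bar> < e / 2" using N that by simp
      ultimately show ?thesis unfolding eq real_norm_def by linarith
    qed
    then show "\<exists>no. \<forall>n\<ge>no. norm (emb (c n) \<bullet> v - u \<bullet> v) < e" by blast
  qed
qed

text \<open>Weak convergence, with norms asymptotically at most that of the limit, is strong
  convergence: expand the square of the norm of \<open>emb (c n) - u\<close>. When
  \<open>c n\<close> arises by a contraction from approximants of \<open>u\<close>, the norms of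
  those approximants serve as \<open>b\<close>.\<close>

lemma strong_conv:
  assumes c: "\<And>n. c n \<in> \<D>" and le: "\<And>n. norm (emb (c n)) \<le> b n" and b: "b \<longlonglongrightarrow> norm u"
    and lim: "(\<lambda>n. n2 (\<lambda>x. c n x - fn u x)) \<longlonglongrightarrow> 0"
  shows "(\<lambda>n. emb (c n)) \<longlonglongrightarrow> u"
proof -
  obtain K where K: "\<And>n. norm (b n) \<le> K" using convergent_imp_Bseq[OF convergentI[OF b]] by (auto simp: Bseq_def)
  have "norm (emb (c n)) \<le> K" for n using le[of n] K[of n] by simp
  from weak_conv[OF c this lim, of u]
  have w: "(\<lambda>n. emb (c n) \<bullet> u) \<longlonglongrightarrow> u \<bullet> u" .
  have "(\<lambda>n. (b n)\<^sup>2 - 2 * (emb (c n) \<bullet> u) + u \<bullet> u) \<longlonglongrightarrow> (norm u)\<^sup>2 - 2 * (u \<bullet> u) + u \<bullet> u"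
    by (intro tendsto_intros b w)
  then have l: "(\<lambda>n. (b n)\<^sup>2 - 2 * (emb (c n) \<bullet> u) + u \<bullet> u) \<longlonglongrightarrow> 0" by (simp add: power2_norm_eq_inner)
  have le2: "norm ((norm (emb (c n) - u))\<^sup>2) \<le> (b n)\<^sup>2 - 2 * (emb (c n) \<bullet> u) + u \<bullet> u" for n
  proof -
    have "(norm (emb (c n)))\<^sup>2 \<le> (b n)\<^sup>2" using le by (intro power_mono) auto
    then show ?thesis unfolding real_norm_def abs_of_nonneg[OF zero_le_power2]
      by (simp add: power2_norm_eq_inner inner_diff_left inner_diff_right inner_commute[of u "emb (c n)"])
  qed
  have "(\<lambda>n. (norm (emb (c n) - u))\<^sup>2) \<longlonglongrightarrow> 0"
    by (rule Lim_null_comparison[OF _ l]) (intro always_eventually allI le2)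
  then have "(\<lambda>n. sqrt ((norm (emb (c n) - u))\<^sup>2)) \<longlonglongrightarrow> sqrt 0" by (rule tendsto_real_sqrt)
  then have "(\<lambda>n. norm (emb (c n) - u)) \<longlonglongrightarrow> 0" by simp
  then have "(\<lambda>n. emb (c n) - u) \<longlonglongrightarrow> 0" by (rule tendsto_norm_zero_cancel)
  then show ?thesis by (rule LIM_zero_cancel)
qed

end

section \<open>Contractions and nonnegative approximation\<close>

text \<open>Used with a limit function as the bound \<open>b\<close>, whose modulus then serves as
  dominating function.\<close>

definition clamp_abs :: "real \<Rightarrow> real \<Rightarrow> real" where
  "clamp_abs b s = max (- \<bar>b\<bar>) (min s \<bar>b\<bar>)"

lemma clamp_abs_le: "\<bar>clamp_abs b s\<bar> \<le> \<bar>b\<bar>"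
  by (auto simp: clamp_abs_def)

lemma clamp_abs_id: "\<bar>s\<bar> \<le> \<bar>b\<bar> \<Longrightarrow> clamp_abs b s = s"
  by (auto simp: clamp_abs_def)

text \<open>What is cut off is the part of |s| beyond |b|, which is at most |p| - |b|.\<close>

lemma clamp_abs_dist: "\<bar>s\<bar> \<le> \<bar>p\<bar> \<Longrightarrow> \<bar>s - clamp_abs b s\<bar> \<le> \<bar>p - b\<bar>"
  by (auto simp: clamp_abs_def max_def min_def abs_if split: if_splits)

lemma tendsto_clamp_abs: "(f \<longlongrightarrow> l) F \<Longrightarrow> ((\<lambda>x. clamp_abs b (f x)) \<longlongrightarrow> clamp_abs b l) F"
  unfolding clamp_abs_def by (intro tendsto_intros)

context bounded_open begin

lemma AE_lim_le:
  assumes "\<And>n::nat. AE x in M. \<bar>c n x\<bar> \<le> \<bar>\<phi> n x :: real\<bar>" "AE x in M. (\<lambda>n. c n x) \<longlonglongrightarrow> g x"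
    "AE x in M. (\<lambda>n. \<phi> n x) \<longlonglongrightarrow> f x"
  shows "AE x in M. \<bar>g x\<bar> \<le> \<bar>f x\<bar>"
proof -
  have "AE x in M. \<forall>n. \<bar>c n x\<bar> \<le> \<bar>\<phi> n x\<bar>" using assms(1) by (simp add: AE_all_countable)
  then show ?thesis using assms(2,3)
  proof eventually_elim
    case (elim x)
    show ?case by (rule LIMSEQ_le[OF tendsto_rabs[OF elim(2)] tendsto_rabs[OF elim(3)]]) (use elim(1) in blast)
  qed
qed

text \<open>Dominated convergence with a dominating sequence that varies and converges in L^1.
  Clamping \<open>c n\<close> at |f| gives a sequence dominated by |f|, and what the clamping
  removes is at most |\<phi> n - f|.\<close>

lemma L1_dominated:
  fixes c \<phi> :: "nat \<Rightarrow> real^'n \<Rightarrow> real"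
  assumes ci: "\<And>n. c n \<in> borel_measurable M" and \<phi>i: "\<And>n. integrable M (\<phi> n)" and fi: "integrable M f"
    and gm: "g \<in> borel_measurable M"
    and le: "\<And>n. AE x in M. \<bar>c n x\<bar> \<le> \<bar>\<phi> n x\<bar>" and cl: "AE x in M. (\<lambda>n. c n x) \<longlonglongrightarrow> g x"
    and \<phi>l: "AE x in M. (\<lambda>n. \<phi> n x) \<longlonglongrightarrow> f x"
    and L1: "(\<lambda>n. LINT x|M. \<bar>\<phi> n x - f x\<bar>) \<longlonglongrightarrow> 0"
  shows "integrable M g" "\<And>n. integrable M (c n)" "(\<lambda>n. LINT x|M. c n x) \<longlonglongrightarrow> (LINT x|M. g x)"
proof -
  have gf: "AE x in M. \<bar>g x\<bar> \<le> \<bar>f x\<bar>" by (rule AE_lim_le[OF le cl \<phi>l])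
  show gi: "integrable M g" by (rule Bochner_Integration.integrable_bound[OF fi gm]) (use gf in simp)
  show ci': "integrable M (c n)" for n
    by (rule Bochner_Integration.integrable_bound[OF \<phi>i[of n] ci]) (use le[of n] in simp)
  let ?d = "\<lambda>n x. clamp_abs (f x) (c n x)"
  have dm: "?d n \<in> borel_measurable M" for n
    using ci[of n] borel_measurable_integrable[OF fi] unfolding clamp_abs_def by measurable
  have db: "AE x in M. norm (?d n x) \<le> \<bar>f x\<bar>" for n using clamp_abs_le by simp
  have dl: "AE x in M. (\<lambda>n. ?d n x) \<longlonglongrightarrow> g x"
    using cl gf
  proof eventually_elim
    case (elim x)
    have "(\<lambda>n. ?d n x) \<longlonglongrightarrow> clamp_abs (f x) (g x)" by (rule tendsto_clamp_abs[OF elim(1)])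
    then show ?case using clamp_abs_id[OF elim(2)] by simp
  qed
  have fa: "integrable M (\<lambda>x. \<bar>f x\<bar>)" using fi by simp
  have di: "integrable M (?d n)" for n
    by (rule Bochner_Integration.integrable_bound[OF fa dm]) (use clamp_abs_le in simp)
  have 1: "(\<lambda>n. LINT x|M. ?d n x) \<longlonglongrightarrow> (LINT x|M. g x)"
    by (rule integral_dominated_convergence[OF gm dm fa dl db])
  have le2: "norm ((LINT x|M. c n x) - (LINT x|M. ?d n x)) \<le> (LINT x|M. \<bar>\<phi> n x - f x\<bar>)" for n
  proof -
    have "norm (LINT x|M. c n x - ?d n x) \<le> (LINT x|M. \<bar>c n x - ?d n x\<bar>)"
      unfolding real_norm_def by (rule integral_abs_bound)
    also have "\<dots> \<le> (LINT x|M. \<bar>\<phi> n x - f x\<bar>)"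
    proof (rule integral_mono_AE)
      show "AE x in M. \<bar>c n x - ?d n x\<bar> \<le> \<bar>\<phi> n x - f x\<bar>"
        using le[of n] by eventually_elim (rule clamp_abs_dist)
    qed (intro Bochner_Integration.integrable_abs Bochner_Integration.integrable_diff ci' di \<phi>i fi)+
    finally show ?thesis by (simp only: Bochner_Integration.integral_diff[OF ci' di])
  qed
  have "(\<lambda>n. (LINT x|M. c n x) - (LINT x|M. ?d n x)) \<longlonglongrightarrow> 0"
    by (rule Lim_null_comparison[OF _ L1]) (intro always_eventually allI le2)
  from tendsto_add[OF this 1] show "(\<lambda>n. LINT x|M. c n x) \<longlonglongrightarrow> (LINT x|M. g x)" by simp
qed

lemma L2_dominated:
  assumes c: "\<And>n. c n \<in> borel_measurable M" and \<phi>: "\<And>n. sq (\<phi> n)" and f: "sq f" and gm: "g \<in> borel_measurable M"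
    and le: "\<And>n. AE x in M. \<bar>c n x\<bar> \<le> \<bar>\<phi> n x\<bar>" and cl: "AE x in M. (\<lambda>n. c n x) \<longlonglongrightarrow> g x"
    and \<phi>l: "AE x in M. (\<lambda>n. \<phi> n x) \<longlonglongrightarrow> f x"
    and L2: "(\<lambda>n. n2 (\<lambda>x. \<phi> n x - f x)) \<longlonglongrightarrow> 0"
  shows "sq g" "(\<lambda>n. n2 (\<lambda>x. c n x - g x)) \<longlonglongrightarrow> 0"
proof -
  have gf: "AE x in M. \<bar>g x\<bar> \<le> \<bar>f x\<bar>" by (rule AE_lim_le[OF le cl \<phi>l])
  show gs: "sq g" by (rule sq_bound[OF gm f, where c=1]) (use gf in simp)
  have cs: "sq (c n)" for n by (rule sq_bound[OF c[of n] \<phi>[of n], where c=1]) (use le[of n] in simp)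
  let ?d = "\<lambda>n x. clamp_abs (f x) (c n x)"
  have dm: "?d n \<in> borel_measurable M" for n
    using c[of n] sqD(1)[OF f] unfolding clamp_abs_def by measurable
  have ds: "sq (?d n)" for n by (rule sq_bound[OF dm[of n] f, where c=1]) (use clamp_abs_le in simp)
  have 1: "(\<lambda>n. LINT x|M. (?d n x - g x)\<^sup>2) \<longlonglongrightarrow> (LINT x|M. 0)"
  proof (rule integral_dominated_convergence[where w="\<lambda>x. 4 * (f x)\<^sup>2"])
    show "(\<lambda>x. (?d n x - g x)\<^sup>2) \<in> borel_measurable M" for n using dm[of n] gm by measurable
    show "integrable M (\<lambda>x. 4 * (f x)\<^sup>2)" using sqD(2)[OF f] by simp
    show "AE x in M. (\<lambda>n. (?d n x - g x)\<^sup>2) \<longlonglongrightarrow> 0"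
      using cl gf
    proof eventually_elim
      case (elim x)
      have "(\<lambda>n. (?d n x - g x)\<^sup>2) \<longlonglongrightarrow> (clamp_abs (f x) (g x) - g x)\<^sup>2"
        by (intro tendsto_intros tendsto_clamp_abs[OF elim(1)])
      then show ?case using clamp_abs_id[OF elim(2)] by simp
    qed
    show "AE x in M. norm ((?d n x - g x)\<^sup>2) \<le> 4 * (f x)\<^sup>2" for n
      using gf
    proof eventually_elim
      case (elim x)
      have "\<bar>?d n x - g x\<bar> \<le> 2 * \<bar>f x\<bar>" using clamp_abs_le[of "f x" "c n x"] elim by linarith
      then have "\<bar>?d n x - g x\<bar>\<^sup>2 \<le> (2 * \<bar>f x\<bar>)\<^sup>2" by (rule power_mono) simp
      then show ?case by (simp add: power_mult_distrib)
    qed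
  qed simp
  then have "(\<lambda>n. sqrt (LINT x|M. (?d n x - g x)\<^sup>2)) \<longlonglongrightarrow> sqrt (LINT x|M. 0)" by (rule tendsto_real_sqrt)
  then have 1: "(\<lambda>n. n2 (\<lambda>x. ?d n x - g x)) \<longlonglongrightarrow> 0" by (simp add: n2_def)
  have lim: "(\<lambda>n. n2 (\<lambda>x. \<phi> n x - f x) + n2 (\<lambda>x. ?d n x - g x)) \<longlonglongrightarrow> 0" using tendsto_add[OF L2 1] by simp
  have le2: "norm (n2 (\<lambda>x. c n x - g x)) \<le> n2 (\<lambda>x. \<phi> n x - f x) + n2 (\<lambda>x. ?d n x - g x)" for n
  proof -
    have "n2 (\<lambda>x. c n x - g x) \<le> n2 (\<lambda>x. c n x - ?d n x) + n2 (\<lambda>x. ?d n x - g x)"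
      by (rule n2_triangle_diff[OF cs ds gs])
    moreover have "n2 (\<lambda>x. c n x - ?d n x) \<le> n2 (\<lambda>x. \<phi> n x - f x)"
    proof (rule n2_mono[OF sq_diff[OF cs ds] sq_diff[OF \<phi> f]])
      show "AE x in M. \<bar>c n x - ?d n x\<bar> \<le> \<bar>\<phi> n x - f x\<bar>"
        using le[of n] by eventually_elim (rule clamp_abs_dist)
    qed
    ultimately show ?thesis using n2_nonneg[of "\<lambda>x. c n x - g x"] by simp
  qed
  show "(\<lambda>n. n2 (\<lambda>x. c n x - g x)) \<longlonglongrightarrow> 0"
    by (rule Lim_null_comparison[OF _ lim]) (intro always_eventually allI le2)
qed

end

section \<open>Contractions after the ground state substitution\<close>

context hardy_domain begin

text \<open>\<open>lift \<phi>\<close> is the function w of the substitution, and \<open>drp\<close>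
  undoes it off the origin. At the origin itself both give 0, because 0 to any power is 0 for
  \<open>powr\<close>.\<close>

definition lift :: "(real^'n \<Rightarrow> real) \<Rightarrow> real^'n \<Rightarrow> real" where
  "lift \<phi> x = norm x powr a * \<phi> x"

definition drp :: "(real^'n \<Rightarrow> real) \<Rightarrow> real^'n \<Rightarrow> real" where
  "drp W x = norm x powr (- a) * W x"

lemma drp_lift: "x \<noteq> 0 \<Longrightarrow> norm x powr (- a) * (norm x powr a * s) = s"
  by (simp add: powr_minus)

lemma has_grad_lift:
  assumes "has_grad \<phi> (grad \<phi> x) x" "x \<noteq> 0"
  shows "has_grad (lift \<phi>) (norm x powr a *\<^sub>R hgrad \<phi> x) x"
proof -
  have "has_grad (lift \<phi>) (norm x powr a *\<^sub>R grad \<phi> x + \<phi> x *\<^sub>R ((a * norm x powr (a - 2)) *\<^sub>R x)) x"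
    unfolding lift_def[abs_def] by (rule has_grad_mult[OF has_grad_norm_powr[OF assms(2)] assms(1)])
  moreover have "norm x powr (a - 2) = norm x powr a / (norm x)\<^sup>2" using assms(2) by (simp add: powr_diff)
  ultimately show ?thesis unfolding hgrad_def by (simp add: scaleR_add_right algebra_simps)
qed

text \<open>For W obtained from a lift by a smooth real function, the powers of r in this lemma and
  in \<open>has_grad_lift\<close> cancel, and \<open>hgrad\<close> is merely multiplied by the slope
  of that function.\<close>

lemma hgrad_drp:
  assumes "has_grad W G x" "x \<noteq> 0"
  shows "hgrad (drp W) x = norm x powr (- a) *\<^sub>R G"
proof -
  have "has_grad (drp W) (norm x powr (- a) *\<^sub>R G + W x *\<^sub>R ((- a * norm x powr (- a - 2)) *\<^sub>R x)) x"
    unfolding drp_def[abs_def] by (rule has_grad_mult[OF has_grad_norm_powr[OF assms(2)] assms(1)])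
  from has_grad_unique[OF this]
  have "grad (drp W) x = norm x powr (- a) *\<^sub>R G + W x *\<^sub>R ((- a * norm x powr (- a - 2)) *\<^sub>R x)" .
  moreover have "norm x powr (- a - 2) = norm x powr (- a) / (norm x)\<^sup>2" using assms(2) by (simp add: powr_diff)
  ultimately show ?thesis unfolding hgrad_def drp_def by (simp add: algebra_simps)
qed

lemma smooth_on_lift: "\<phi> \<in> \<D> \<Longrightarrow> smooth_on (-{0}) (lift \<phi>)"
  unfolding lift_def[abs_def]
  by (intro smooth_on_mult smooth_on_norm_powr smooth_on_mono[OF test_functions_smooth]) (auto simp: open_Compl)

lemma drp_D:
  assumes "\<phi> \<in> \<D>" "smooth_on (-{0}) W" "\<And>x. \<phi> x = 0 \<Longrightarrow> W x = 0"
  shows "drp W \<in> \<D>"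
proof (rule test_functionsI[OF assms(1)])
  show "smooth_on (-{0}) (drp W)" unfolding drp_def[abs_def]
    by (intro smooth_on_mult smooth_on_norm_powr assms(2)) (simp add: open_Compl)
  show "drp W x = 0" if "\<phi> x = 0" for x using assms(3)[OF that] by (simp add: drp_def)
qed (auto simp: open_Compl)

lemma D_zero: "\<phi> \<in> \<D> \<Longrightarrow> \<phi> 0 = 0"
  using test_functions_outside(1)[of \<phi> "\<Omega> - {0}" 0] by simp

text \<open>Both terms of \<open>form_hgrad\<close> are monotone, the second because \<kappa> >= 0.
  The original expression of the form does not show this, since its potential term enters with a
  minus sign.\<close>

lemma form_mono:
  assumes "\<tau> \<in> \<D>" "\<phi> \<in> \<D>" "\<And>x. x \<noteq> 0 \<Longrightarrow> norm (hgrad \<tau> x) \<le> norm (hgrad \<phi> x)" "\<And>x. x \<noteq> 0 \<Longrightarrow> \<bar>\<tau> x\<bar> \<le> \<bar>\<phi> x\<bar>"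
  shows "form \<tau> \<tau> \<le> form \<phi> \<phi>"
proof -
  have "(LINT x|M. hgrad \<tau> x \<bullet> hgrad \<tau> x) \<le> (LINT x|M. hgrad \<phi> x \<bullet> hgrad \<phi> x)"
  proof (rule integral_mono_AE[OF integrable_hgrad[OF assms(1,1)] integrable_hgrad[OF assms(2,2)]])
    show "AE x in M. hgrad \<tau> x \<bullet> hgrad \<tau> x \<le> hgrad \<phi> x \<bullet> hgrad \<phi> x"
      using AE_nonzero
    proof eventually_elim
      case (elim x)
      show ?case unfolding power2_norm_eq_inner[symmetric] by (rule power_mono[OF assms(3)[OF elim]]) simp
    qed
  qed
  moreover have "(LINT x|M. \<tau> x * \<tau> x / (norm x)\<^sup>2) \<le> (LINT x|M. \<phi> x * \<phi> x / (norm x)\<^sup>2)"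
  proof (rule integral_mono_AE)
    show "AE x in M. \<tau> x * \<tau> x / (norm x)\<^sup>2 \<le> \<phi> x * \<phi> x / (norm x)\<^sup>2"
      using AE_nonzero
    proof eventually_elim
      case (elim x)
      show ?case unfolding power2_eq_square[symmetric]
        by (rule divide_right_mono) (use assms(4)[OF elim] in \<open>auto simp: abs_le_square_iff\<close>)
    qed
  qed (use integrable_hardy D_subset_T assms in blast)+
  ultimately show ?thesis unfolding form_hgrad[OF assms(1,1)] form_hgrad[OF assms(2,2)]
    using \<kappa>_nonneg by (intro add_mono mult_left_mono)
qed

text \<open>A smooth absolute value with slope at most 1, lowered by \<delta> so that it vanishes at
  0 and does not enlarge supports.\<close>

definition sabs :: "real \<Rightarrow> real \<Rightarrow> real" where
  "sabs \<delta> s = sqrt (s\<^sup>2 + \<delta>\<^sup>2) - \<delta>"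

lemma sabs_bounds:
  assumes "\<delta> > 0"
  shows "0 \<le> sabs \<delta> s" "sabs \<delta> s \<le> \<bar>s\<bar>" "\<bar>s\<bar> - \<delta> \<le> sabs \<delta> s"
proof -
  have "sqrt (\<delta>\<^sup>2) \<le> sqrt (s\<^sup>2 + \<delta>\<^sup>2)" by (intro real_sqrt_le_mono) simp
  then show "0 \<le> sabs \<delta> s" using assms by (simp add: sabs_def)
  have "sqrt (s\<^sup>2) \<le> sqrt (s\<^sup>2 + \<delta>\<^sup>2)" by (intro real_sqrt_le_mono) simp
  then show "\<bar>s\<bar> - \<delta> \<le> sabs \<delta> s" by (simp add: sabs_def)
  show "sabs \<delta> s \<le> \<bar>s\<bar>" using sqrt_add_le_add_sqrt[of "s\<^sup>2" "\<delta>\<^sup>2"] assms by (simp add: sabs_def)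
qed

lemma sabs_deriv:
  assumes "\<delta> > 0"
  shows "\<exists>d. (sabs \<delta> has_real_derivative d) (at s) \<and> \<bar>d\<bar> \<le> 1"
proof -
  have pos: "s\<^sup>2 + \<delta>\<^sup>2 > 0" using assms by (simp add: add_nonneg_pos)
  have 1: "(sabs \<delta> has_real_derivative s / sqrt (s\<^sup>2 + \<delta>\<^sup>2)) (at s)"
    unfolding sabs_def[abs_def] using pos
    by (auto intro!: derivative_eq_intros simp: field_simps)
  have "sqrt (s\<^sup>2) \<le> sqrt (s\<^sup>2 + \<delta>\<^sup>2)" by (intro real_sqrt_le_mono) simp
  then have "\<bar>s / sqrt (s\<^sup>2 + \<delta>\<^sup>2)\<bar> \<le> 1" using pos by (simp add: abs_divide)
  then show ?thesis using 1 by blast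
qed

definition sabs_D :: "real \<Rightarrow> (real^'n \<Rightarrow> real) \<Rightarrow> real^'n \<Rightarrow> real" where
  "sabs_D \<delta> \<phi> = drp (\<lambda>x. sabs \<delta> (lift \<phi> x))"

lemma sabs_D:
  assumes "\<phi> \<in> \<D>" "\<delta> > 0"
  shows "sabs_D \<delta> \<phi> \<in> \<D>" "0 \<le> sabs_D \<delta> \<phi> x" "\<bar>sabs_D \<delta> \<phi> x\<bar> \<le> \<bar>\<phi> x\<bar>"
    "x \<noteq> 0 \<Longrightarrow> \<bar>sabs_D \<delta> \<phi> x - \<bar>\<phi> x\<bar>\<bar> \<le> norm x powr (- a) * \<delta>" "form (sabs_D \<delta> \<phi>) (sabs_D \<delta> \<phi>) \<le> form \<phi> \<phi>"
proof -
  have "smooth_on (-{0}) (\<lambda>x. (lift \<phi> x * lift \<phi> x + \<delta>\<^sup>2) powr (1/2) - \<delta>)"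
    using assms(2) by (intro smooth_on_diff smooth_on_powr smooth_on_add smooth_on_mult smooth_on_lift assms(1) smooth_on_const)
      (auto simp: open_Compl add_nonneg_pos)
  then have "smooth_on (-{0}) (\<lambda>x. sabs \<delta> (lift \<phi> x))"
    by (simp add: sabs_def powr_half_sqrt power2_eq_square)
  then show D: "sabs_D \<delta> \<phi> \<in> \<D>"
    unfolding sabs_D_def using assms(2) by (intro drp_D[OF assms(1)]) (auto simp: lift_def sabs_def)
  show "0 \<le> sabs_D \<delta> \<phi> x" unfolding sabs_D_def drp_def using sabs_bounds[OF assms(2)] by simp
  have b: "\<bar>sabs_D \<delta> \<phi> x\<bar> \<le> \<bar>\<phi> x\<bar>" for x
  proof (cases "x = 0")
    case True then show ?thesis using D_zero[OF D] by simp
  next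
    case False
    have "\<bar>sabs_D \<delta> \<phi> x\<bar> \<le> norm x powr (- a) * \<bar>lift \<phi> x\<bar>"
      unfolding sabs_D_def drp_def abs_mult using sabs_bounds[OF assms(2)] by (simp add: mult_left_mono)
    also have "\<dots> = \<bar>\<phi> x\<bar>" unfolding lift_def abs_mult using drp_lift[OF False] by simp
    finally show ?thesis .
  qed
  then show "\<bar>sabs_D \<delta> \<phi> x\<bar> \<le> \<bar>\<phi> x\<bar>" .
  show "\<bar>sabs_D \<delta> \<phi> x - \<bar>\<phi> x\<bar>\<bar> \<le> norm x powr (- a) * \<delta>" if "x \<noteq> 0"
  proof -
    have e: "\<bar>\<phi> x\<bar> = norm x powr (- a) * \<bar>lift \<phi> x\<bar>" unfolding lift_def abs_mult using drp_lift[OF that] by simp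
    have "\<bar>sabs \<delta> (lift \<phi> x) - \<bar>lift \<phi> x\<bar>\<bar> \<le> \<delta>" using sabs_bounds[OF assms(2), of "lift \<phi> x"] by linarith
    then have "norm x powr (- a) * \<bar>sabs \<delta> (lift \<phi> x) - \<bar>lift \<phi> x\<bar>\<bar> \<le> norm x powr (- a) * \<delta>"
      by (intro mult_left_mono) auto
    moreover have "\<bar>sabs_D \<delta> \<phi> x - \<bar>\<phi> x\<bar>\<bar> = norm x powr (- a) * \<bar>sabs \<delta> (lift \<phi> x) - \<bar>lift \<phi> x\<bar>\<bar>"
      unfolding e sabs_D_def drp_def right_diff_distrib[symmetric] abs_mult by simp
    ultimately show ?thesis by simp
  qed
  show "form (sabs_D \<delta> \<phi>) (sabs_D \<delta> \<phi>) \<le> form \<phi> \<phi>"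
  proof (rule form_mono[OF D assms(1) _ b])
    fix x :: "real^'n" assume x: "x \<noteq> 0"
    obtain d where d: "(sabs \<delta> has_real_derivative d) (at (lift \<phi> x))" "\<bar>d\<bar> \<le> 1"
      using sabs_deriv[OF assms(2)] by blast
    have "hgrad (sabs_D \<delta> \<phi>) x = norm x powr (- a) *\<^sub>R (d *\<^sub>R (norm x powr a *\<^sub>R hgrad \<phi> x))"
      unfolding sabs_D_def
      by (rule hgrad_drp[OF has_grad_compose[OF d(1) has_grad_lift[OF test_functions_has_grad[OF assms(1)] x]] x])
    also have "\<dots> = d *\<^sub>R hgrad \<phi> x" using drp_lift[OF x, of d] by (simp add: mult.commute mult.left_commute)
    finally show "norm (hgrad (sabs_D \<delta> \<phi>) x) \<le> norm (hgrad \<phi> x)"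
      using d(2) mult_right_mono[OF d(2) norm_ge_zero[of "hgrad \<phi> x"]] by simp
  qed
qed

lemma sabs_D_tendsto:
  assumes "\<And>n. \<phi> n \<in> \<D>" "(\<lambda>n. \<phi> n x) \<longlonglongrightarrow> l" "x \<noteq> 0"
  shows "(\<lambda>n. sabs_D (1 / (real n + 1)) (\<phi> n) x) \<longlonglongrightarrow> \<bar>l\<bar>"
proof -
  have lim: "(\<lambda>n. norm x powr (- a) * (1 / (real n + 1))) \<longlonglongrightarrow> 0"
    using tendsto_mult_left[OF tendsto_inverse_Suc, of "norm x powr (- a)"] by simp
  have le: "norm (sabs_D (1 / (real n + 1)) (\<phi> n) x - \<bar>\<phi> n x\<bar>) \<le> norm x powr (- a) * (1 / (real n + 1))" for n
    unfolding real_norm_def by (rule sabs_D(4)[OF assms(1) _ assms(3)]) simp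
  have "(\<lambda>n. sabs_D (1 / (real n + 1)) (\<phi> n) x - \<bar>\<phi> n x\<bar>) \<longlonglongrightarrow> 0"
    by (rule Lim_null_comparison[OF _ lim]) (intro always_eventually allI le)
  from tendsto_add[OF this tendsto_rabs[OF assms(2)]] show ?thesis by simp
qed

end

context hardy_model begin

lemma norm_sabs_D: "\<phi> \<in> \<D> \<Longrightarrow> \<delta> > 0 \<Longrightarrow> norm (emb (sabs_D \<delta> \<phi>)) \<le> norm (emb \<phi>)"
  by (rule power2_le_imp_le) (simp_all add: norm_emb[OF D_subset_T] sabs_D)

text \<open>Smoothed absolute values of arbitrary approximants: L^2 convergence survives by
  domination, the norms do not grow, and \<open>strong_conv\<close> gives back convergence in the
  completion.\<close>

lemma nonneg_approx:
  assumes "AE x in M. 0 \<le> fn u x"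
  shows "\<exists>c. (\<forall>n::nat. c n \<in> \<D> \<and> (\<forall>x. 0 \<le> c n x)) \<and> (\<lambda>n. emb (c n)) \<longlonglongrightarrow> u \<and>
     (\<lambda>n. n2 (\<lambda>x. c n x - fn u x)) \<longlonglongrightarrow> 0 \<and> (AE x in M. (\<lambda>n. c n x) \<longlonglongrightarrow> fn u x)"
proof -
  obtain \<phi> where \<phi>: "\<forall>n::nat. \<phi> n \<in> \<D>" "(\<lambda>n. emb (\<phi> n)) \<longlonglongrightarrow> u" "(\<lambda>n. n2 (\<lambda>x. \<phi> n x - fn u x)) \<longlonglongrightarrow> 0"
    "AE x in M. (\<lambda>n. \<phi> n x) \<longlonglongrightarrow> fn u x" using D_approx_AE by blast
  have \<phi>D: "\<phi> n \<in> \<D>" for n using \<phi>(1) by blast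
  define c where "c n = sabs_D (1 / (real n + 1)) (\<phi> n)" for n
  have cD: "c n \<in> \<D>" and c0: "0 \<le> c n x" and cb: "\<bar>c n x\<bar> \<le> \<bar>\<phi> n x\<bar>" for n x
    unfolding c_def by (intro sabs_D \<phi>D; simp)+
  have cl: "AE x in M. (\<lambda>n. c n x) \<longlonglongrightarrow> fn u x"
    using \<phi>(4) AE_nonzero assms
  proof eventually_elim
    case (elim x)
    from sabs_D_tendsto[OF \<phi>D elim(1,2)] elim(3) show ?case by (simp add: c_def)
  qed
  have cb': "AE x in M. \<bar>c n x\<bar> \<le> \<bar>\<phi> n x\<bar>" for n using cb by simp
  have L: "(\<lambda>n. n2 (\<lambda>x. c n x - fn u x)) \<longlonglongrightarrow> 0"
    by (rule L2_dominated(2)[OF measurable_test[OF cD] sq_test[OF \<phi>D] sq_fn sqD(1)[OF sq_fn] cb' cl \<phi>(4) \<phi>(3)])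
  have "norm (emb (c n)) \<le> norm (emb (\<phi> n))" for n unfolding c_def by (intro norm_sabs_D \<phi>D) simp
  then have "(\<lambda>n. emb (c n)) \<longlonglongrightarrow> u"
    by (rule strong_conv[OF cD _ tendsto_norm[OF \<phi>(2)] L])
  then show ?thesis using cD c0 cl L by blast
qed

end

section \<open>Closedness of the set of nonnegative solutions\<close>

context hardy_model begin

lemma set_lint_M: "(LINT x:\<Omega>|lebesgue. h x) = (LINT x|M. h x)" for h :: "real^'n \<Rightarrow> real"
  unfolding set_lebesgue_integral_def using Om_sets by (simp add: integral_restrict_space)

lemma set_integrable_M: "set_integrable lebesgue \<Omega> h \<longleftrightarrow> integrable M h" for h :: "real^'n \<Rightarrow> real"
  unfolding set_integrable_def using Om_sets by (simp add: integrable_restrict_space)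

text \<open>The functional bound makes w \<phi> n Cauchy in L^1, and Fatou's lemma identifies the
  limit from a.e. convergence. A weighted integral thereby extends from test functions to the whole
  completion.\<close>

lemma weighted_conv:
  assumes wm: "w \<in> borel_measurable M"
    and wi: "\<And>\<phi>. \<phi> \<in> \<D> \<Longrightarrow> integrable M (\<lambda>x. w x * \<phi> x)"
    and wb: "\<And>\<phi>. \<phi> \<in> \<D> \<Longrightarrow> (LINT x|M. \<bar>w x * \<phi> x\<bar>) \<le> C * norm (emb \<phi>)"
    and \<phi>: "\<And>n::nat. \<phi> n \<in> \<D>" "(\<lambda>n. emb (\<phi> n)) \<longlonglongrightarrow> \<psi>" "AE x in M. (\<lambda>n. \<phi> n x) \<longlonglongrightarrow> fn \<psi> x"
  shows "integrable M (\<lambda>x. w x * fn \<psi> x)" "(\<lambda>n. LINT x|M. \<bar>w x * \<phi> n x - w x * fn \<psi> x\<bar>) \<longlonglongrightarrow> 0"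
proof -
  have fm: "(\<lambda>x. w x * fn \<psi> x) \<in> borel_measurable M" using wm sqD(1)[OF sq_fn[of \<psi>]] by measurable
  have pm: "(\<lambda>x. w x * \<phi> n x) \<in> borel_measurable M" for n by (rule borel_measurable_integrable[OF wi[OF \<phi>(1)]])
  have Cb: "(\<integral>\<^sup>+x. ennreal \<bar>w x * \<phi> n x - w x * \<phi> m x\<bar> \<partial>M) \<le> ennreal (C * norm (emb (\<phi> n) - emb (\<phi> m)))" for n m
  proof -
    have D: "(\<lambda>x. \<phi> n x - \<phi> m x) \<in> \<D>" by (rule test_functions_diff[OF \<phi>(1) \<phi>(1)])
    have "(\<integral>\<^sup>+x. ennreal \<bar>w x * \<phi> n x - w x * \<phi> m x\<bar> \<partial>M) = (\<integral>\<^sup>+x. ennreal \<bar>w x * (\<phi> n x - \<phi> m x)\<bar> \<partial>M)"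
      by (simp add: right_diff_distrib)
    also have "\<dots> = ennreal (LINT x|M. \<bar>w x * (\<phi> n x - \<phi> m x)\<bar>)"
      using wi[OF D] by (intro nn_integral_eq_integral) auto
    also have "\<dots> \<le> ennreal (C * norm (emb (\<phi> n) - emb (\<phi> m)))"
      using wb[OF D] emb_diff[OF D_subset_T[OF \<phi>(1)] D_subset_T[OF \<phi>(1)], of n m] by (intro ennreal_leI) simp
    finally show ?thesis .
  qed
  have bound: "(\<integral>\<^sup>+x. ennreal \<bar>w x * \<phi> n x - w x * fn \<psi> x\<bar> \<partial>M) \<le> ennreal (C * norm (emb (\<phi> n) - \<psi>))" for n
  proof -
    have "(\<integral>\<^sup>+x. ennreal \<bar>w x * \<phi> n x - w x * fn \<psi> x\<bar> \<partial>M) \<le> (\<integral>\<^sup>+x. liminf (\<lambda>m. ennreal \<bar>w x * \<phi> n x - w x * \<phi> m x\<bar>) \<partial>M)"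
    proof (rule nn_integral_mono_AE)
      show "AE x in M. ennreal \<bar>w x * \<phi> n x - w x * fn \<psi> x\<bar> \<le> liminf (\<lambda>m. ennreal \<bar>w x * \<phi> n x - w x * \<phi> m x\<bar>)"
        using \<phi>(3)
      proof eventually_elim
        case (elim x)
        then have "(\<lambda>m. ennreal \<bar>w x * \<phi> n x - w x * \<phi> m x\<bar>) \<longlonglongrightarrow> ennreal \<bar>w x * \<phi> n x - w x * fn \<psi> x\<bar>"
          by (intro tendsto_ennrealI tendsto_intros)
        from lim_imp_Liminf[OF _ this] show ?case by simp
      qed
    qed
    also have "\<dots> \<le> liminf (\<lambda>m. \<integral>\<^sup>+x. ennreal \<bar>w x * \<phi> n x - w x * \<phi> m x\<bar> \<partial>M)"
      by (intro nn_integral_liminf measurable_compose[OF _ measurable_ennreal] borel_measurable_abs borel_measurable_diff pm)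
    also have "\<dots> \<le> liminf (\<lambda>m. ennreal (C * norm (emb (\<phi> n) - emb (\<phi> m))))"
      by (intro Liminf_mono always_eventually allI Cb)
    also have "\<dots> = ennreal (C * norm (emb (\<phi> n) - \<psi>))"
      by (intro lim_imp_Liminf tendsto_ennrealI tendsto_intros \<phi>(2)) simp
    finally show ?thesis .
  qed
  have di: "integrable M (\<lambda>x. w x * \<phi> n x - w x * fn \<psi> x)" for n
    by (rule integrableI_bounded) (use pm fm le_less_trans[OF bound ennreal_less_top] in auto)
  from Bochner_Integration.integrable_diff[OF wi[OF \<phi>(1)[of 0]] di[of 0]]
  show "integrable M (\<lambda>x. w x * fn \<psi> x)" by simp
  have le: "norm (LINT x|M. \<bar>w x * \<phi> n x - w x * fn \<psi> x\<bar>) \<le> \<bar>C\<bar> * norm (emb (\<phi> n) - \<psi>)" for n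
  proof -
    have "ennreal (LINT x|M. \<bar>w x * \<phi> n x - w x * fn \<psi> x\<bar>) = (\<integral>\<^sup>+x. ennreal \<bar>w x * \<phi> n x - w x * fn \<psi> x\<bar> \<partial>M)"
      using di[of n] by (intro nn_integral_eq_integral[symmetric]) auto
    also have "\<dots> \<le> ennreal (C * norm (emb (\<phi> n) - \<psi>))" by (rule bound)
    also have "\<dots> \<le> ennreal (\<bar>C\<bar> * norm (emb (\<phi> n) - \<psi>))"
      by (intro ennreal_leI mult_right_mono) auto
    finally have "ennreal (LINT x|M. \<bar>w x * \<phi> n x - w x * fn \<psi> x\<bar>) \<le> ennreal (\<bar>C\<bar> * norm (emb (\<phi> n) - \<psi>))" .
    then show ?thesis by (simp add: ennreal_le_iff Bochner_Integration.integral_nonneg)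
  qed
  have "(\<lambda>n. \<bar>C\<bar> * norm (emb (\<phi> n) - \<psi>)) \<longlonglongrightarrow> \<bar>C\<bar> * norm (\<psi> - \<psi>)" by (intro tendsto_intros \<phi>(2))
  then have lim: "(\<lambda>n. \<bar>C\<bar> * norm (emb (\<phi> n) - \<psi>)) \<longlonglongrightarrow> 0" by simp
  show "(\<lambda>n. LINT x|M. \<bar>w x * \<phi> n x - w x * fn \<psi> x\<bar>) \<longlonglongrightarrow> 0"
    by (rule Lim_null_comparison[OF _ lim]) (intro always_eventually allI le)
qed

text \<open>If the equation holds for test functions only, testing with smoothed absolute values shows that the
  nonlinear term is a bounded functional.\<close>

lemma weighted_bound:
  assumes wm: "w \<in> borel_measurable M" and w0: "AE x in M. 0 \<le> w x"
    and wi: "\<And>\<phi>. \<phi> \<in> \<D> \<Longrightarrow> integrable M (\<lambda>x. w x * \<phi> x)"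
    and eq: "\<And>\<phi>. \<phi> \<in> \<D> \<Longrightarrow> u \<bullet> emb \<phi> = l * (LINT x|M. fn u x * \<phi> x) - (LINT x|M. w x * \<phi> x)"
    and "\<phi> \<in> \<D>"
  shows "(LINT x|M. \<bar>w x * \<phi> x\<bar>) \<le> (\<bar>l\<bar> * (radius * norm u) * radius + norm u) * norm (emb \<phi>)"
proof -
  let ?C = "\<bar>l\<bar> * (radius * norm u) * radius + norm u"
  define \<tau> where "\<tau> n = sabs_D (1 / (real n + 1)) \<phi>" for n
  have D: "\<tau> n \<in> \<D>" and \<tau>0: "0 \<le> \<tau> n x" and \<tau>b: "\<bar>\<tau> n x\<bar> \<le> \<bar>\<phi> x\<bar>"
    and \<tau>n: "norm (emb (\<tau> n)) \<le> norm (emb \<phi>)" for n x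
    unfolding \<tau>_def by (intro sabs_D norm_sabs_D \<open>\<phi> \<in> \<D>\<close>; simp)+
  have le: "(LINT x|M. w x * \<tau> n x) \<le> ?C * norm (emb \<phi>)" for n
  proof -
    have 1: "(LINT x|M. w x * \<tau> n x) = l * (LINT x|M. fn u x * \<tau> n x) - u \<bullet> emb (\<tau> n)" using eq[OF D, of n] by simp
    have "\<bar>LINT x|M. fn u x * \<tau> n x\<bar> \<le> n2 (fn u) * n2 (\<tau> n)" by (rule cauchy_schwarz_abs[OF sq_fn sq_test[OF D]])
    also have "\<dots> \<le> (radius * norm u) * (radius * norm (emb \<phi>))"
    proof (intro mult_mono fn_bound n2_nonneg)
      show "n2 (\<tau> n) \<le> radius * norm (emb \<phi>)"
        using L2_bound_T[OF D_subset_T[OF D], of n] mult_left_mono[OF \<tau>n[of n], of radius] radius_pos by linarith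
    qed (use radius_pos in simp)
    finally have 2: "\<bar>l\<bar> * \<bar>LINT x|M. fn u x * \<tau> n x\<bar> \<le> \<bar>l\<bar> * ((radius * norm u) * (radius * norm (emb \<phi>)))"
      by (intro mult_left_mono) auto
    have "\<bar>u \<bullet> emb (\<tau> n)\<bar> \<le> norm u * norm (emb (\<tau> n))" by (rule Cauchy_Schwarz_ineq2)
    also have "\<dots> \<le> norm u * norm (emb \<phi>)" by (intro mult_left_mono \<tau>n) auto
    finally have 3: "\<bar>u \<bullet> emb (\<tau> n)\<bar> \<le> norm u * norm (emb \<phi>)" .
    have "l * (LINT x|M. fn u x * \<tau> n x) \<le> \<bar>l\<bar> * \<bar>LINT x|M. fn u x * \<tau> n x\<bar>" unfolding abs_mult[symmetric] by simp
    with 2 3 have "(LINT x|M. w x * \<tau> n x) \<le> \<bar>l\<bar> * ((radius * norm u) * (radius * norm (emb \<phi>))) + norm u * norm (emb \<phi>)"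
      unfolding 1 by linarith
    then show ?thesis by (simp add: algebra_simps)
  qed
  have "(\<lambda>n. LINT x|M. w x * \<tau> n x) \<longlonglongrightarrow> (LINT x|M. \<bar>w x * \<phi> x\<bar>)"
  proof (rule integral_dominated_convergence[where w="\<lambda>x. \<bar>w x * \<phi> x\<bar>"])
    show "(\<lambda>x. \<bar>w x * \<phi> x\<bar>) \<in> borel_measurable M" using borel_measurable_integrable[OF wi[OF \<open>\<phi> \<in> \<D>\<close>]] by simp
    show "(\<lambda>x. w x * \<tau> n x) \<in> borel_measurable M" for n by (rule borel_measurable_integrable[OF wi[OF D]])
    show "integrable M (\<lambda>x. \<bar>w x * \<phi> x\<bar>)" using wi[OF \<open>\<phi> \<in> \<D>\<close>] by simp
    show "AE x in M. (\<lambda>n. w x * \<tau> n x) \<longlonglongrightarrow> \<bar>w x * \<phi> x\<bar>"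
      using w0 AE_nonzero
    proof eventually_elim
      case (elim x)
      have "(\<lambda>n. \<tau> n x) \<longlonglongrightarrow> \<bar>\<phi> x\<bar>" unfolding \<tau>_def
        by (rule sabs_D_tendsto[of "\<lambda>_. \<phi>"]) (use \<open>\<phi> \<in> \<D>\<close> elim in auto)
      then have "(\<lambda>n. w x * \<tau> n x) \<longlonglongrightarrow> w x * \<bar>\<phi> x\<bar>" by (rule tendsto_mult_left)
      then show ?case using elim by (simp add: abs_mult)
    qed
    show "AE x in M. norm (w x * \<tau> n x) \<le> \<bar>w x * \<phi> x\<bar>" for n
      using \<tau>b by (auto simp: abs_mult intro!: mult_left_mono)
  qed
  then show ?thesis by (rule LIMSEQ_le_const2) (use le in blast)
qed

end

section \<open>The nonlinear term and the equation for solutions\<close>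

locale hardy_problem = hardy_model \<Omega> \<mu> emb
  for \<Omega> :: "(real^'n::finite) set" and \<mu> :: real
    and emb :: "(real^'n \<Rightarrow> real) \<Rightarrow> 'h::{real_inner,complete_space}" +
  fixes \<gamma> :: real
  assumes \<gamma>_pos: "0 < \<gamma>"
begin

definition nl :: "real \<Rightarrow> real" where
  "nl s = \<bar>s\<bar> powr (2 * \<gamma>) * s"

abbreviation sol :: "real \<Rightarrow> 'h \<Rightarrow> bool" where "sol l u \<equiv> is_solution \<Omega> emb \<gamma> l u"
abbreviation nnsol :: "real \<Rightarrow> 'h \<Rightarrow> bool" where "nnsol l u \<equiv> nontrivial_nonneg_solution \<Omega> emb \<gamma> l u"

lemma sol_iff: "sol l u \<longleftrightarrow> (\<forall>\<psi>. integrable M (\<lambda>x. nl (fn u x) * fn \<psi> x) \<and>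
    u \<bullet> \<psi> = l * (LINT x|M. fn u x * fn \<psi> x) - (LINT x|M. nl (fn u x) * fn \<psi> x))"
  unfolding is_solution_def set_lint_M set_integrable_M nl_def by (simp add: mult.assoc)

lemma nl_tendsto: "(f \<longlongrightarrow> l) F \<Longrightarrow> ((\<lambda>x. nl (f x)) \<longlongrightarrow> nl l) F"
  unfolding nl_def using \<gamma>_pos by (intro tendsto_intros) auto

lemma nl_measurable: "f \<in> borel_measurable M \<Longrightarrow> (\<lambda>x. nl (f x)) \<in> borel_measurable M"
  unfolding nl_def by measurable

lemma nl_nonneg: "s \<ge> 0 \<Longrightarrow> nl s \<ge> 0" by (simp add: nl_def)

lemma nl_self_nonneg: "nl s * s \<ge> 0" by (simp add: nl_def mult.assoc)

text \<open>For |s| <= 1 the left side is at most 1; beyond, the extra factor |s| only helps. The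
  nonlinear term is therefore integrable against bounded functions once the energy integral is
  finite.\<close>

lemma nl_le: "\<bar>nl s\<bar> \<le> 1 + nl s * s"
proof (cases "\<bar>s\<bar> \<le> 1")
  case True
  then have "\<bar>s\<bar> powr (2 * \<gamma>) \<le> 1" using \<gamma>_pos by (intro powr_le1) auto
  then have "\<bar>s\<bar> powr (2 * \<gamma>) * \<bar>s\<bar> \<le> 1 * 1" using True by (intro mult_mono) auto
  then show ?thesis using nl_self_nonneg[of s] by (simp add: nl_def abs_mult)
next
  case False
  have "\<bar>nl s\<bar> * 1 \<le> \<bar>nl s\<bar> * \<bar>s\<bar>" using False by (intro mult_left_mono) auto
  also have "\<dots> = nl s * s" using nl_self_nonneg[of s] by (simp add: abs_mult[symmetric])
  finally show ?thesis by simp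
qed

text \<open>Equi-integrability: where |s| > m, |nl s| is at most nl s * s / m, so a common bound on
  energy integrals makes the tails uniformly small.\<close>

lemma nl_clamp:
  assumes "m > 0"
  shows "\<bar>nl s - nl (clamp_abs m s)\<bar> \<le> nl s * s / m" "\<bar>nl (clamp_abs m s)\<bar> \<le> m powr (2 * \<gamma>) * m"
proof -
  show "\<bar>nl (clamp_abs m s)\<bar> \<le> m powr (2 * \<gamma>) * m"
    unfolding nl_def abs_mult using clamp_abs_le[of m s] assms \<gamma>_pos by (intro mult_mono) (auto intro: powr_mono2)
  show "\<bar>nl s - nl (clamp_abs m s)\<bar> \<le> nl s * s / m"
  proof (cases "\<bar>s\<bar> \<le> m")
    case True
    then show ?thesis using clamp_abs_id[of s m] nl_self_nonneg[of s] assms by simp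
  next
    case False
    have "\<bar>nl s - nl (clamp_abs m s)\<bar> \<le> \<bar>nl s\<bar>"
    proof (cases "s > 0")
      case True
      then have "clamp_abs m s = m" using False assms by (auto simp: clamp_abs_def)
      moreover have "0 \<le> nl m" "nl m \<le> nl s" unfolding nl_def using True False assms \<gamma>_pos
        by (auto intro!: mult_mono powr_mono2)
      ultimately show ?thesis by simp
    next
      case neg: False
      then have "clamp_abs m s = - m" using False assms by (auto simp: clamp_abs_def)
      moreover have "m powr (2 * \<gamma>) * m \<le> (- s) powr (2 * \<gamma>) * (- s)"
        using neg False assms \<gamma>_pos by (intro mult_mono powr_mono2) auto
      then have "0 \<le> nl m" "nl m \<le> nl (- s)" unfolding nl_def using neg False assms by auto
      moreover have "nl (- t) = - nl t" for t by (simp add: nl_def)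
      ultimately show ?thesis by simp
    qed
    also have "\<dots> \<le> nl s * s / m"
    proof -
      have "\<bar>nl s\<bar> * m \<le> \<bar>nl s\<bar> * \<bar>s\<bar>" using False by (intro mult_left_mono) auto
      also have "\<dots> = nl s * s" using nl_self_nonneg[of s] by (simp add: abs_mult[symmetric])
      finally show ?thesis using assms by (simp add: field_simps)
    qed
    finally show ?thesis .
  qed
qed

lemma sol_D:
  assumes "sol l u" "\<phi> \<in> \<T>"
  shows "integrable M (\<lambda>x. nl (fn u x) * \<phi> x)"
    and "u \<bullet> emb \<phi> = l * (LINT x|M. fn u x * \<phi> x) - (LINT x|M. nl (fn u x) * \<phi> x)"
proof -
  note fe = fn_emb[OF assms(2)]
  note m = measurable_test[OF assms(2)] sqD(1)[OF sq_fn[of u]] nl_measurable[OF sqD(1)[OF sq_fn[of u]]] sqD(1)[OF sq_fn[of "emb \<phi>"]]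
  have s: "integrable M (\<lambda>x. nl (fn u x) * fn (emb \<phi>) x)"
    "u \<bullet> emb \<phi> = l * (LINT x|M. fn u x * fn (emb \<phi>) x) - (LINT x|M. nl (fn u x) * fn (emb \<phi>) x)"
    using assms(1) unfolding sol_iff by blast+
  have e1: "AE x in M. nl (fn u x) * fn (emb \<phi>) x = nl (fn u x) * \<phi> x" using fe by eventually_elim simp
  have e2: "AE x in M. fn u x * fn (emb \<phi>) x = fn u x * \<phi> x" using fe by eventually_elim simp
  have m1: "(\<lambda>x. nl (fn u x) * \<phi> x) \<in> borel_measurable M" "(\<lambda>x. fn u x * \<phi> x) \<in> borel_measurable M"
    "(\<lambda>x. nl (fn u x) * fn (emb \<phi>) x) \<in> borel_measurable M" "(\<lambda>x. fn u x * fn (emb \<phi>) x) \<in> borel_measurable M"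
    using m by measurable
  show "integrable M (\<lambda>x. nl (fn u x) * \<phi> x)" using integrable_cong_AE[OF m1(3,1) e1] s(1) by blast
  show "u \<bullet> emb \<phi> = l * (LINT x|M. fn u x * \<phi> x) - (LINT x|M. nl (fn u x) * \<phi> x)"
    unfolding s(2) integral_cong_AE[OF m1(3,1) e1] integral_cong_AE[OF m1(4,2) e2] ..
qed

context
  fixes l u
  assumes nn: "AE x in M. 0 \<le> fn u x"
    and wi: "\<And>\<phi>. \<phi> \<in> \<D> \<Longrightarrow> integrable M (\<lambda>x. nl (fn u x) * \<phi> x)"
    and eq: "\<And>\<phi>. \<phi> \<in> \<D> \<Longrightarrow> u \<bullet> emb \<phi> = l * (LINT x|M. fn u x * \<phi> x) - (LINT x|M. nl (fn u x) * \<phi> x)"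
begin

text \<open>Nonnegativity of u makes its nonlinear term a nonnegative weight, so that
  \<open>weighted_bound\<close> supplies the functional bound from the equation for test functions
  alone.\<close>

lemma nl_weighted_conv:
  assumes D: "\<And>n::nat. \<phi> n \<in> \<D>" and \<phi>: "(\<lambda>n. emb (\<phi> n)) \<longlonglongrightarrow> \<psi>" "AE x in M. (\<lambda>n. \<phi> n x) \<longlonglongrightarrow> fn \<psi> x"
  shows "integrable M (\<lambda>x. nl (fn u x) * fn \<psi> x)"
    and "(\<lambda>n. LINT x|M. \<bar>nl (fn u x) * \<phi> n x - nl (fn u x) * fn \<psi> x\<bar>) \<longlonglongrightarrow> 0"
proof -
  define w where "w x = nl (fn u x)" for x
  define C where "C = \<bar>l\<bar> * (radius * norm u) * radius + norm u"
  have wm: "w \<in> borel_measurable M" unfolding w_def by (rule nl_measurable[OF sqD(1)[OF sq_fn[of u]]])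
  have w0: "AE x in M. 0 \<le> w x" using nn unfolding w_def by eventually_elim (rule nl_nonneg)
  have wi': "integrable M (\<lambda>x. w x * \<phi> x)" if "\<phi> \<in> \<D>" for \<phi> using wi[OF that] by (simp add: w_def)
  have eq': "u \<bullet> emb \<phi> = l * (LINT x|M. fn u x * \<phi> x) - (LINT x|M. w x * \<phi> x)" if "\<phi> \<in> \<D>" for \<phi>
    using eq[OF that] by (simp add: w_def)
  have wb: "(LINT x|M. \<bar>w x * \<phi> x\<bar>) \<le> C * norm (emb \<phi>)" if "\<phi> \<in> \<D>" for \<phi>
    unfolding C_def by (rule weighted_bound[of w, OF wm w0 wi' eq' that])
  show "integrable M (\<lambda>x. nl (fn u x) * fn \<psi> x)"
    using weighted_conv(1)[of w C, OF wm wi' wb D \<phi>] by (simp add: w_def)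
  show "(\<lambda>n. LINT x|M. \<bar>nl (fn u x) * \<phi> n x - nl (fn u x) * fn \<psi> x\<bar>) \<longlonglongrightarrow> 0"
    using weighted_conv(2)[of w C, OF wm wi' wb D \<phi>] by (simp add: w_def)
qed

text \<open>Everything is continuous along approximants of \<open>\<psi>\<close>: the inner product
  and the L^2 pairing by their convergence, the nonlinear term by
  \<open>nl_weighted_conv\<close>.\<close>

lemma sol_from_D: "sol l u"
  unfolding sol_iff
proof
  fix \<psi>
  obtain \<phi> where \<phi>: "\<forall>n::nat. \<phi> n \<in> \<D>" "(\<lambda>n. emb (\<phi> n)) \<longlonglongrightarrow> \<psi>" "(\<lambda>n. n2 (\<lambda>x. \<phi> n x - fn \<psi> x)) \<longlonglongrightarrow> 0"
    "AE x in M. (\<lambda>n. \<phi> n x) \<longlonglongrightarrow> fn \<psi> x" using D_approx_AE by blast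
  have D: "\<phi> n \<in> \<D>" for n using \<phi>(1) by blast
  note W1 = nl_weighted_conv(1)[OF D \<phi>(2) \<phi>(4)] and W2 = nl_weighted_conv(2)[OF D \<phi>(2) \<phi>(4)]
  have le: "norm ((LINT x|M. nl (fn u x) * \<phi> n x) - (LINT x|M. nl (fn u x) * fn \<psi> x))
     \<le> (LINT x|M. \<bar>nl (fn u x) * \<phi> n x - nl (fn u x) * fn \<psi> x\<bar>)" for n
  proof -
    have e: "(LINT x|M. nl (fn u x) * \<phi> n x) - (LINT x|M. nl (fn u x) * fn \<psi> x) =
      (LINT x|M. nl (fn u x) * \<phi> n x - nl (fn u x) * fn \<psi> x)"
      by (rule Bochner_Integration.integral_diff[OF wi[OF D] W1, symmetric])
    show ?thesis unfolding e real_norm_def by (rule integral_abs_bound)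
  qed
  have "(\<lambda>n. (LINT x|M. nl (fn u x) * \<phi> n x) - (LINT x|M. nl (fn u x) * fn \<psi> x)) \<longlonglongrightarrow> 0"
    by (rule Lim_null_comparison[OF _ W2]) (intro always_eventually allI le)
  then have 1: "(\<lambda>n. LINT x|M. nl (fn u x) * \<phi> n x) \<longlonglongrightarrow> (LINT x|M. nl (fn u x) * fn \<psi> x)" by (rule LIM_zero_cancel)
  have "(\<lambda>n. LINT x|M. \<phi> n x * fn u x) \<longlonglongrightarrow> (LINT x|M. fn \<psi> x * fn u x)"
    by (rule integral_tendsto_sq[OF sq_test[OF D] sq_fn sq_fn \<phi>(3)])
  then have 2: "(\<lambda>n. LINT x|M. fn u x * \<phi> n x) \<longlonglongrightarrow> (LINT x|M. fn u x * fn \<psi> x)" by (simp add: mult.commute)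
  have "(\<lambda>n. l * (LINT x|M. fn u x * \<phi> n x) - (LINT x|M. nl (fn u x) * \<phi> n x)) \<longlonglongrightarrow>
     l * (LINT x|M. fn u x * fn \<psi> x) - (LINT x|M. nl (fn u x) * fn \<psi> x)"
    by (intro tendsto_intros 1 2)
  moreover have "(\<lambda>n. u \<bullet> emb (\<phi> n)) \<longlonglongrightarrow> u \<bullet> \<psi>" by (intro tendsto_intros \<phi>(2))
  ultimately have "u \<bullet> \<psi> = l * (LINT x|M. fn u x * fn \<psi> x) - (LINT x|M. nl (fn u x) * fn \<psi> x)"
    unfolding eq[OF D] using LIMSEQ_unique by blast
  then show "integrable M (\<lambda>x. nl (fn u x) * fn \<psi> x) \<and>
    u \<bullet> \<psi> = l * (LINT x|M. fn u x * fn \<psi> x) - (LINT x|M. nl (fn u x) * fn \<psi> x)" using W1 by blast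
qed

end

lemma sol_energy:
  assumes "sol l u"
  shows "integrable M (\<lambda>x. nl (fn u x) * fn u x)"
    "(norm u)\<^sup>2 = l * (n2 (fn u))\<^sup>2 - (LINT x|M. nl (fn u x) * fn u x)"
    "0 \<le> (LINT x|M. nl (fn u x) * fn u x)"
proof -
  have s: "integrable M (\<lambda>x. nl (fn u x) * fn u x)"
    "u \<bullet> u = l * (LINT x|M. fn u x * fn u x) - (LINT x|M. nl (fn u x) * fn u x)"
    using assms unfolding sol_iff by blast+
  show "integrable M (\<lambda>x. nl (fn u x) * fn u x)" by (rule s(1))
  show "(norm u)\<^sup>2 = l * (n2 (fn u))\<^sup>2 - (LINT x|M. nl (fn u x) * fn u x)"
    using s(2) by (simp add: power2_norm_eq_inner n2_sq power2_eq_square[of "fn u _"])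
  show "0 \<le> (LINT x|M. nl (fn u x) * fn u x)" by (intro Bochner_Integration.integral_nonneg nl_self_nonneg)
qed

text \<open>Testing each solution with itself bounds the energy integrals along the sequence. The
  nonlinear terms are then equi-integrable against bounded test functions, so the equation passes to
  the limit on \<open>\<D>\<close>, and \<open>sol_from_D\<close> extends it to the
  completion.\<close>

lemma sol_closed:
  assumes s: "\<And>n::nat. sol (l n) (u n)" "\<And>n. AE x in M. 0 \<le> fn (u n) x"
    and lim: "l \<longlonglongrightarrow> l0" "u \<longlonglongrightarrow> u0"
  shows "sol l0 u0" "AE x in M. 0 \<le> fn u0 x"
proof -
  have "(\<lambda>n. radius * norm (u n - u0)) \<longlonglongrightarrow> radius * norm (u0 - u0)" by (intro tendsto_intros lim)
  then have r0: "(\<lambda>n. radius * norm (u n - u0)) \<longlonglongrightarrow> 0" by simp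
  have n0: "norm (n2 (\<lambda>x. fn (u n) x - fn u0 x)) \<le> radius * norm (u n - u0)" for n
    using fn_lipschitz[of "u n" u0] n2_nonneg[of "\<lambda>x. fn (u n) x - fn u0 x"] by simp
  have L2: "(\<lambda>n. n2 (\<lambda>x. fn (u n) x - fn u0 x)) \<longlonglongrightarrow> 0"
    by (rule Lim_null_comparison[OF _ r0]) (intro always_eventually allI n0)
  obtain r :: "nat \<Rightarrow> nat" where r: "strict_mono r" "AE x in M. (\<lambda>n. fn (u (r n)) x) \<longlonglongrightarrow> fn u0 x"
    using n2_AE_subseq[OF sq_fn sq_fn L2] by blast
  define v where "v n = u (r n)" for n
  define k where "k n = l (r n)" for n
  have sv: "sol (k n) (v n)" "AE x in M. 0 \<le> fn (v n) x" for n unfolding k_def v_def by (rule s)+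
  have kl: "k \<longlonglongrightarrow> l0" "v \<longlonglongrightarrow> u0"
    using LIMSEQ_subseq_LIMSEQ[OF lim(1) r(1)] LIMSEQ_subseq_LIMSEQ[OF lim(2) r(1)] by (simp_all add: o_def k_def[abs_def] v_def[abs_def])
  have vl: "AE x in M. (\<lambda>n. fn (v n) x) \<longlonglongrightarrow> fn u0 x" using r(2) by (simp add: v_def)
  have vL2: "(\<lambda>n. n2 (\<lambda>x. fn (v n) x - fn u0 x)) \<longlonglongrightarrow> 0"
    using LIMSEQ_subseq_LIMSEQ[OF L2 r(1)] by (simp add: o_def v_def)
  have "AE x in M. \<forall>n. 0 \<le> fn (v n) x" using sv(2) by (simp add: AE_all_countable)
  then show nn: "AE x in M. 0 \<le> fn u0 x"
    using vl by eventually_elim (rule LIMSEQ_le_const, auto)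
  obtain Kk where Kk: "\<And>n. \<bar>k n\<bar> \<le> Kk" using convergent_imp_Bseq[OF convergentI[OF kl(1)]] by (auto simp: Bseq_def)
  obtain Kv where Kv: "\<And>n. norm (v n) \<le> Kv" using convergent_imp_Bseq[OF convergentI[OF kl(2)]] by (auto simp: Bseq_def)
  \<comment> \<open>In the energy identity the squared norm is dropped by its sign, which leaves
    \<open>k n\<close> times the squared L^2 norm as a bound for the energy integral.\<close>
  define K where "K = Kk * (radius * Kv)\<^sup>2"
  let ?P = "\<lambda>n. LINT x|M. nl (fn (v n) x) * fn (v n) x"
  have PK: "?P n \<le> K" for n
  proof -
    have "n2 (fn (v n)) \<le> radius * Kv"
      using fn_bound[of "v n"] mult_left_mono[OF Kv[of n], of radius] radius_pos by linarith
    then have "(n2 (fn (v n)))\<^sup>2 \<le> (radius * Kv)\<^sup>2" by (intro power_mono n2_nonneg)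
    then have "k n * (n2 (fn (v n)))\<^sup>2 \<le> Kk * (radius * Kv)\<^sup>2"
      using Kk[of n] by (intro mult_mono) (auto intro: order_trans[OF abs_ge_zero])
    moreover have "?P n \<le> k n * (n2 (fn (v n)))\<^sup>2" using sol_energy(2)[OF sv(1), of n] zero_le_power2[of "norm (v n)"] by linarith
    ultimately show ?thesis by (simp add: K_def)
  qed
  have fm: "fn w \<in> borel_measurable M" for w by (rule sqD(1)[OF sq_fn])
  note nm = nl_measurable[OF fm]
  have Pm: "(\<lambda>x. nl (fn w x) * fn w x) \<in> borel_measurable M" for w using fm nm by measurable
  \<comment> \<open>Fatou's lemma hands the bound to the limit, so that the tail estimate applies to
    \<open>u0\<close> as well.\<close>
  have Pn: "(\<integral>\<^sup>+x. ennreal (nl (fn u0 x) * fn u0 x) \<partial>M) \<le> ennreal K"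
  proof -
    have "(\<integral>\<^sup>+x. ennreal (nl (fn u0 x) * fn u0 x) \<partial>M) \<le> (\<integral>\<^sup>+x. liminf (\<lambda>n. ennreal (nl (fn (v n) x) * fn (v n) x)) \<partial>M)"
    proof (rule nn_integral_mono_AE)
      show "AE x in M. ennreal (nl (fn u0 x) * fn u0 x) \<le> liminf (\<lambda>n. ennreal (nl (fn (v n) x) * fn (v n) x))"
        using vl
      proof eventually_elim
        case (elim x)
        then have "(\<lambda>n. ennreal (nl (fn (v n) x) * fn (v n) x)) \<longlonglongrightarrow> ennreal (nl (fn u0 x) * fn u0 x)"
          by (intro tendsto_ennrealI tendsto_mult nl_tendsto)
        from lim_imp_Liminf[OF _ this] show ?case by simp
      qed
    qed
    also have "\<dots> \<le> liminf (\<lambda>n. \<integral>\<^sup>+x. ennreal (nl (fn (v n) x) * fn (v n) x) \<partial>M)"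
      using fm nm by (intro nn_integral_liminf) measurable
    also have "\<dots> \<le> ennreal K"
    proof (rule Liminf_le)
      have "(\<integral>\<^sup>+x. ennreal (nl (fn (v n) x) * fn (v n) x) \<partial>M) \<le> ennreal K" for n
      proof -
        have "(\<integral>\<^sup>+x. ennreal (nl (fn (v n) x) * fn (v n) x) \<partial>M) = ennreal (?P n)"
          using sol_energy(1)[OF sv(1)] by (intro nn_integral_eq_integral) (auto simp: nl_self_nonneg)
        then show ?thesis using PK by (simp add: ennreal_leI)
      qed
      then show "\<forall>\<^sub>F n in sequentially. (\<integral>\<^sup>+x. ennreal (nl (fn (v n) x) * fn (v n) x) \<partial>M) \<le> ennreal K" by simp
    qed simp
    finally show ?thesis .
  qed
  have Pi: "integrable M (\<lambda>x. nl (fn u0 x) * fn u0 x)"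
    by (rule integrableI_bounded) (use Pm le_less_trans[OF Pn ennreal_less_top] nl_self_nonneg in auto)
  have K0: "0 \<le> K" using PK[of 0] sol_energy(3)[OF sv(1), of 0] by linarith
  have PK0: "(LINT x|M. nl (fn u0 x) * fn u0 x) \<le> K"
  proof -
    have "ennreal (LINT x|M. nl (fn u0 x) * fn u0 x) \<le> ennreal K"
      using Pn nn_integral_eq_integral[OF Pi] nl_self_nonneg by simp
    then show ?thesis using K0 by (simp add: ennreal_le_iff)
  qed
  have Ni: "integrable M (\<lambda>x. nl (fn w x) * \<phi> x)" if wi: "integrable M (\<lambda>x. nl (fn w x) * fn w x)" and pd: "\<phi> \<in> \<D>" for w \<phi>
  proof -
    obtain B where B: "\<And>x. \<bar>\<phi> x\<bar> \<le> B" using test_functions_bounded[OF pd] by blast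
    show ?thesis
    proof (rule Bochner_Integration.integrable_bound)
      show "integrable M (\<lambda>x. B * (1 + nl (fn w x) * fn w x))" using wi by simp
      show "(\<lambda>x. nl (fn w x) * \<phi> x) \<in> borel_measurable M" using nm measurable_test[OF pd] by measurable
      have "\<bar>nl (fn w x) * \<phi> x\<bar> \<le> (1 + nl (fn w x) * fn w x) * B" for x
        unfolding abs_mult by (intro mult_mono nl_le B) (auto simp: nl_self_nonneg add_nonneg_nonneg)
      then show "AE x in M. norm (nl (fn w x) * \<phi> x) \<le> norm (B * (1 + nl (fn w x) * fn w x))"
        by (auto simp: mult.commute intro: order_trans[OF _ abs_ge_self])
    qed
  qed
  show "sol l0 u0"
  proof (rule sol_from_D[OF nn])
    fix \<phi> assume \<phi>: "\<phi> \<in> \<D>"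
    show "integrable M (\<lambda>x. nl (fn u0 x) * \<phi> x)" by (rule Ni[OF Pi \<phi>])
    obtain B where B: "B > 0" "\<And>x. \<bar>\<phi> x\<bar> \<le> B" using test_functions_bounded[OF \<phi>] by blast
    have \<phi>m: "\<phi> \<in> borel_measurable M" by (rule measurable_test[OF \<phi>])
    have tail: "\<bar>(LINT x|M. nl (fn w x) * \<phi> x) - (LINT x|M. nl (clamp_abs m (fn w x)) * \<phi> x)\<bar> \<le> B * K / m"
      and ci: "integrable M (\<lambda>x. nl (clamp_abs m (fn w x)) * \<phi> x)"
      if "m > 0" and wi: "integrable M (\<lambda>x. nl (fn w x) * fn w x)" and wK: "(LINT x|M. nl (fn w x) * fn w x) \<le> K" for m w
    proof -
      have cm: "(\<lambda>x. nl (clamp_abs m (fn w x)) * \<phi> x) \<in> borel_measurable M"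
        using fm \<phi>m unfolding nl_def clamp_abs_def by measurable
      show ci: "integrable M (\<lambda>x. nl (clamp_abs m (fn w x)) * \<phi> x)"
      proof (rule integrable_bounded[OF cm])
        show "\<bar>nl (clamp_abs m (fn w x)) * \<phi> x\<bar> \<le> m powr (2 * \<gamma>) * m * B" for x
          unfolding abs_mult by (intro mult_mono nl_clamp B) (use \<open>m > 0\<close> in auto)
      qed
      have pw: "\<bar>nl (fn w x) * \<phi> x - nl (clamp_abs m (fn w x)) * \<phi> x\<bar> \<le> B / m * (nl (fn w x) * fn w x)" for x
      proof -
        have "\<bar>nl (fn w x) - nl (clamp_abs m (fn w x))\<bar> * \<bar>\<phi> x\<bar> \<le> (nl (fn w x) * fn w x / m) * B"
          by (intro mult_mono nl_clamp B) (use \<open>m > 0\<close> nl_self_nonneg in auto)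
        also have "(nl (fn w x) * fn w x / m) * B = B / m * (nl (fn w x) * fn w x)" by simp
        finally show ?thesis unfolding left_diff_distrib[symmetric] abs_mult .
      qed
      have "\<bar>(LINT x|M. nl (fn w x) * \<phi> x) - (LINT x|M. nl (clamp_abs m (fn w x)) * \<phi> x)\<bar>
         \<le> (LINT x|M. \<bar>nl (fn w x) * \<phi> x - nl (clamp_abs m (fn w x)) * \<phi> x\<bar>)"
        unfolding Bochner_Integration.integral_diff[OF Ni[OF wi \<phi>] ci, symmetric] by (rule integral_abs_bound)
      also have "\<dots> \<le> (LINT x|M. B / m * (nl (fn w x) * fn w x))"
        by (rule integral_mono[OF _ _ pw])
          (intro Bochner_Integration.integrable_abs Bochner_Integration.integrable_diff Ni[OF wi \<phi>] ci integrable_mult_right wi)+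
      also have "\<dots> = B / m * (LINT x|M. nl (fn w x) * fn w x)" by (rule integral_mult_right_zero)
      also have "\<dots> \<le> B / m * K" using wK B(1) \<open>m > 0\<close> by (intro mult_left_mono) auto
      finally show "\<bar>(LINT x|M. nl (fn w x) * \<phi> x) - (LINT x|M. nl (clamp_abs m (fn w x)) * \<phi> x)\<bar> \<le> B * K / m" by simp
    qed
    have conv: "(\<lambda>n. LINT x|M. nl (fn (v n) x) * \<phi> x) \<longlonglongrightarrow> (LINT x|M. nl (fn u0 x) * \<phi> x)"
    proof (rule LIMSEQ_I)
      fix e :: real assume e: "e > 0"
      \<comment> \<open>Makes the tail error B K / m less than e/3. It is spent once on
        \<open>v n\<close> and once on the limit; the last third goes to the dominated convergence
        of the clamped terms.\<close>
      define m where "m = 3 * (B * K + 1) / e"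
      have BK: "0 \<le> B * K" using B(1) K0 by simp
      have m: "m > 0" using e BK by (simp add: m_def)
      have me: "B * K / m < e / 3"
      proof -
        have "B * K / m = e / 3 * (B * K / (B * K + 1))" unfolding m_def using e BK by (simp add: field_simps)
        also have "\<dots> < e / 3 * 1" using e BK by (intro mult_strict_left_mono) auto
        finally show ?thesis by simp
      qed
      have "(\<lambda>n. LINT x|M. nl (clamp_abs m (fn (v n) x)) * \<phi> x) \<longlonglongrightarrow> (LINT x|M. nl (clamp_abs m (fn u0 x)) * \<phi> x)"
      proof (rule integral_dominated_convergence[where w="\<lambda>x. m powr (2 * \<gamma>) * m * B"])
        show "AE x in M. (\<lambda>n. nl (clamp_abs m (fn (v n) x)) * \<phi> x) \<longlonglongrightarrow> nl (clamp_abs m (fn u0 x)) * \<phi> x"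
          using vl by eventually_elim (intro tendsto_mult_right nl_tendsto tendsto_clamp_abs)
        show "AE x in M. norm (nl (clamp_abs m (fn (v n) x)) * \<phi> x) \<le> m powr (2 * \<gamma>) * m * B" for n
        proof (rule AE_I2)
          show "norm (nl (clamp_abs m (fn (v n) x)) * \<phi> x) \<le> m powr (2 * \<gamma>) * m * B" for x
            unfolding real_norm_def abs_mult by (intro mult_mono nl_clamp B) (use m in auto)
        qed
      qed (auto intro: borel_measurable_integrable ci[OF m Pi PK0] ci[OF m sol_energy(1)[OF sv(1)] PK])
      then obtain N where N: "\<forall>n\<ge>N. norm ((LINT x|M. nl (clamp_abs m (fn (v n) x)) * \<phi> x) - (LINT x|M. nl (clamp_abs m (fn u0 x)) * \<phi> x)) < e / 3"
        using LIMSEQ_D[of _ _ "e/3"] e by fastforce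
      have "norm ((LINT x|M. nl (fn (v n) x) * \<phi> x) - (LINT x|M. nl (fn u0 x) * \<phi> x)) < e" if "n \<ge> N" for n
        using tail[OF m sol_energy(1)[OF sv(1)] PK, of n] tail[OF m Pi PK0] N[rule_format, OF that] me
        unfolding real_norm_def by linarith
      then show "\<exists>no. \<forall>n\<ge>no. norm ((LINT x|M. nl (fn (v n) x) * \<phi> x) - (LINT x|M. nl (fn u0 x) * \<phi> x)) < e" by blast
    qed
    have "(\<lambda>n. LINT x|M. fn (v n) x * \<phi> x) \<longlonglongrightarrow> (LINT x|M. fn u0 x * \<phi> x)"
      by (rule integral_tendsto_sq[OF sq_fn sq_fn sq_test[OF \<phi>] vL2])
    then have "(\<lambda>n. k n * (LINT x|M. fn (v n) x * \<phi> x) - (LINT x|M. nl (fn (v n) x) * \<phi> x)) \<longlonglongrightarrow>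
       l0 * (LINT x|M. fn u0 x * \<phi> x) - (LINT x|M. nl (fn u0 x) * \<phi> x)"
      by (intro tendsto_intros kl conv)
    moreover have "(\<lambda>n. v n \<bullet> emb \<phi>) \<longlonglongrightarrow> u0 \<bullet> emb \<phi>" by (intro tendsto_intros kl)
    ultimately show "u0 \<bullet> emb \<phi> = l0 * (LINT x|M. fn u0 x * \<phi> x) - (LINT x|M. nl (fn u0 x) * \<phi> x)"
      unfolding sol_D(2)[OF sv(1) D_subset_T[OF \<phi>]] using LIMSEQ_unique by blast
  qed
qed

end

section \<open>Picone's inequality and uniqueness of positive solutions\<close>

text \<open>s / sqrt(1 + s^2/k^2): smooth, odd, bounded by k, with derivative (1 + s^2/k^2) to the
  power -3/2, hence of slope at most 1.\<close>

definition trunc :: "real \<Rightarrow> real \<Rightarrow> real" where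
  "trunc k s = s * (1 + s\<^sup>2 / k\<^sup>2) powr (-1/2)"

text \<open>The third bound, the product of the first two, will keep the regularised quotient below
  a multiple of |\<phi>|. The last one provides a positive minimum of a truncated bump on a compact
  ball.\<close>

lemma trunc_bounds:
  assumes "k > 0"
  shows "\<bar>trunc k s\<bar> \<le> \<bar>s\<bar>" "\<bar>trunc k s\<bar> \<le> k" "(trunc k s)\<^sup>2 \<le> k * \<bar>s\<bar>" "(trunc k s)\<^sup>2 \<le> s\<^sup>2"
    "s \<noteq> 0 \<Longrightarrow> trunc k s \<noteq> 0"
proof -
  let ?q = "1 + s\<^sup>2 / k\<^sup>2"
  have q: "?q \<ge> 1" by simp
  have e: "trunc k s = s / sqrt ?q" unfolding trunc_def
    using q by (simp add: powr_minus_divide powr_half_sqrt)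
  have sq: "sqrt ?q \<ge> 1" using q by simp
  show 1: "\<bar>trunc k s\<bar> \<le> \<bar>s\<bar>" unfolding e abs_divide
  proof -
    define Q where "Q = sqrt ?q"
    have "Q \<ge> 1" using sq by (simp add: Q_def)
    then have "\<bar>s\<bar> * 1 \<le> \<bar>s\<bar> * Q" by (intro mult_left_mono) auto
    then have "\<bar>s\<bar> / \<bar>Q\<bar> \<le> \<bar>s\<bar>" using \<open>Q \<ge> 1\<close> by (simp add: divide_le_eq)
    then show "\<bar>s\<bar> / \<bar>sqrt ?q\<bar> \<le> \<bar>s\<bar>" by (simp only: Q_def)
  qed
  have "sqrt (s\<^sup>2 / k\<^sup>2) \<le> sqrt ?q" by (intro real_sqrt_le_mono) simp
  then have "\<bar>s\<bar> / k \<le> sqrt ?q" using assms by (simp add: real_sqrt_divide)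
  then have "\<bar>s\<bar> \<le> k * sqrt ?q" using assms by (simp add: field_simps)
  have "\<bar>s\<bar> / \<bar>Q\<bar> \<le> k" if "\<bar>s\<bar> \<le> k * Q" "Q \<ge> 1" for Q using that by (simp add: divide_le_eq)
  from this[OF \<open>\<bar>s\<bar> \<le> k * sqrt ?q\<close> sq] show 2: "\<bar>trunc k s\<bar> \<le> k" unfolding e abs_divide .
  have "\<bar>trunc k s\<bar> * \<bar>trunc k s\<bar> \<le> k * \<bar>s\<bar>" using 1 2 assms by (intro mult_mono) auto
  then show "(trunc k s)\<^sup>2 \<le> k * \<bar>s\<bar>" by (simp add: power2_eq_square)
  show "(trunc k s)\<^sup>2 \<le> s\<^sup>2" using 1 by (simp add: abs_le_square_iff)
  show "s \<noteq> 0 \<Longrightarrow> trunc k s \<noteq> 0" unfolding e using sq by (metis divide_eq_0_iff not_one_le_zero)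
qed

lemma trunc_deriv:
  assumes "k > 0"
  shows "\<exists>d. (trunc k has_real_derivative d) (at s) \<and> \<bar>d\<bar> \<le> 1"
proof -
  let ?q = "1 + s\<^sup>2 / k\<^sup>2"
  have q: "?q \<ge> 1" by simp
  then have q0: "?q > 0" by linarith
  let ?d = "1 * ?q powr (-1/2) + s * ((-1/2) * ?q powr (-1/2 - 1) * (2 * s / k\<^sup>2))"
  have "((\<lambda>s. 1 + inverse (k\<^sup>2) * s\<^sup>2) has_real_derivative inverse (k\<^sup>2) * (2 * s)) (at s)"
    by (auto intro!: derivative_eq_intros)
  then have "((\<lambda>s. 1 + s\<^sup>2 / k\<^sup>2) has_real_derivative 2 * s / k\<^sup>2) (at s)"
    by (simp add: divide_inverse mult.commute)
  from DERIV_fun_powr[OF this q0, of "-1/2"]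
  have "((\<lambda>s. (1 + s\<^sup>2 / k\<^sup>2) powr (-1/2)) has_real_derivative (-1/2) * ?q powr (-1/2 - 1) * (2 * s / k\<^sup>2)) (at s)"
    by simp
  from DERIV_mult[OF DERIV_ident this]
  have 1: "(trunc k has_real_derivative ?d) (at s)"
    unfolding trunc_def[abs_def] by (simp add: algebra_simps)
  have m: "?q powr (-1/2 - 1) = ?q powr (-1/2) / ?q"
    unfolding powr_diff[of ?q "-1/2" 1] powr_one[OF less_imp_le[OF q0]] ..
  have gen: "1 * P + s * ((-1/2) * (P / q) * (2 * s / k\<^sup>2)) = P * (1 - (s\<^sup>2 / k\<^sup>2) / q)" for P q :: real
    by (simp add: power2_eq_square algebra_simps)
  have "?d = ?q powr (-1/2) * (1 - (s\<^sup>2 / k\<^sup>2) / ?q)" unfolding m by (rule gen)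
  also have "1 - (s\<^sup>2 / k\<^sup>2) / ?q = 1 / ?q"
  proof -
    have "1 - t / (1 + t) = 1 / (1 + t)" if "1 + t > 0" for t :: real using that by (simp add: field_simps)
    from this[OF q0] show ?thesis .
  qed
  finally have d: "?d = ?q powr (-1/2) * (1 / ?q)" .
  have "?q powr (-1/2) \<le> ?q powr 0" using q by (intro powr_mono) auto
  then have "?q powr (-1/2) \<le> 1" using q0 by simp
  moreover have "1 / ?q \<le> 1" using q q0 by (simp only: divide_le_eq_1_pos)
  ultimately have "?q powr (-1/2) * (1 / ?q) \<le> 1 * 1" using q0 by (intro mult_mono) auto
  moreover have "0 \<le> ?q powr (-1/2) * (1 / ?q)" using q0 by simp
  ultimately have "\<bar>?d\<bar> \<le> 1" unfolding d by linarith
  then show ?thesis using 1 by blast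
qed

lemma trunc_tendsto:
  assumes "k > 0" "(f \<longlongrightarrow> l) F"
  shows "((\<lambda>x. trunc k (f x)) \<longlongrightarrow> trunc k l) F"
  unfolding trunc_def using assms by (intro tendsto_intros) (auto simp: add_nonneg_eq_0_iff)

lemma trunc_tendsto_id: "(\<lambda>j. trunc (real j + 1) s) \<longlonglongrightarrow> s"
proof -
  have "(\<lambda>j. s * (1 + s\<^sup>2 * (1 / (real j + 1))\<^sup>2) powr (-1/2)) \<longlonglongrightarrow> s * (1 + s\<^sup>2 * 0\<^sup>2) powr (-1/2)"
    by (intro tendsto_intros tendsto_inverse_Suc) simp
  moreover have "s * (1 + s\<^sup>2 * 0\<^sup>2) powr (-1/2) = s" by simp
  moreover have "s\<^sup>2 / (real j + 1)\<^sup>2 = s\<^sup>2 * (1 / (real j + 1))\<^sup>2" for j by (simp add: power_divide)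
  ultimately show ?thesis unfolding trunc_def by (simp only:)
qed

section \<open>Picone's inequality for a regularised quotient\<close>

context hardy_domain begin

text \<open>A regularisation of \<open>\<phi>\<^sup>2 / c\<close>, performed after the substitution by \<open>lift\<close>.\<close>

definition tst :: "real \<Rightarrow> real \<Rightarrow> (real^'n \<Rightarrow> real) \<Rightarrow> (real^'n \<Rightarrow> real) \<Rightarrow> real^'n \<Rightarrow> real" where
  "tst \<epsilon> k c \<phi> = drp (\<lambda>x. (trunc k (lift \<phi> x))\<^sup>2 * (1 / (lift c x + \<epsilon>)))"

lemma lift_nonneg: "0 \<le> c x \<Longrightarrow> 0 \<le> lift c x" by (simp add: lift_def)

lemma tst_D:
  assumes "c \<in> \<D>" "\<phi> \<in> \<D>" "\<And>x. 0 \<le> c x" "\<epsilon> > 0" "k > 0"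
  shows "tst \<epsilon> k c \<phi> \<in> \<D>"
  unfolding tst_def
proof (rule drp_D[OF assms(2)])
  have o: "open (-{0::real^'n})" by (simp add: open_Compl)
  have "smooth_on (-{0}) (\<lambda>x. lift \<phi> x * (1 + 1 / k\<^sup>2 * (lift \<phi> x * lift \<phi> x)) powr (-1/2))"
    by (intro smooth_on_mult smooth_on_powr smooth_on_add smooth_on_lift smooth_on_const o assms) (simp add: add_pos_nonneg)
  then have t: "smooth_on (-{0}) (\<lambda>x. trunc k (lift \<phi> x))" by (simp add: trunc_def power2_eq_square)
  have "smooth_on (-{0}) (\<lambda>x. 1 / (lift c x + \<epsilon>))"
    using assms(3,4) by (intro smooth_on_inverse smooth_on_add smooth_on_lift assms(1) smooth_on_const o)
      (simp add: add_nonneg_pos lift_nonneg)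
  then show "smooth_on (-{0}) (\<lambda>x. (trunc k (lift \<phi> x))\<^sup>2 * (1 / (lift c x + \<epsilon>)))"
    unfolding power2_eq_square by (intro smooth_on_mult t o)
qed (simp add: trunc_def lift_def)

text \<open>The bound by (k/\<epsilon>) |\<phi>| gives convergence while the parameters are fixed.
  The bound of c times the quotient by \<phi>^2 is free of them and dominates when they are
  removed.\<close>

lemma tst_bounds:
  assumes "0 \<le> c x" "\<epsilon> > 0" "k > 0" "x \<noteq> 0"
  shows "0 \<le> tst \<epsilon> k c \<phi> x" "tst \<epsilon> k c \<phi> x \<le> k / \<epsilon> * \<bar>\<phi> x\<bar>" "0 \<le> c x * tst \<epsilon> k c \<phi> x"
    "c x * tst \<epsilon> k c \<phi> x \<le> (\<phi> x)\<^sup>2"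
proof -
  let ?V = "lift c x + \<epsilon>" let ?P = "(trunc k (lift \<phi> x))\<^sup>2" let ?r = "norm x powr (- a)"
  have V: "?V \<ge> \<epsilon>" "?V > 0" "lift c x \<ge> 0" using assms lift_nonneg[of c x] by auto
  have t: "tst \<epsilon> k c \<phi> x = ?r * (?P * (1 / ?V))" by (simp add: tst_def drp_def)
  have r0: "?r \<ge> 0" by simp
  show 0: "0 \<le> tst \<epsilon> k c \<phi> x" unfolding t using V by simp
  then show "0 \<le> c x * tst \<epsilon> k c \<phi> x" using assms(1) by simp
  have "?P * (1 / ?V) \<le> (k * \<bar>lift \<phi> x\<bar>) * (1 / \<epsilon>)"
    using trunc_bounds(3)[OF assms(3)] V assms by (intro mult_mono divide_left_mono) auto
  then have "tst \<epsilon> k c \<phi> x \<le> ?r * ((k * \<bar>lift \<phi> x\<bar>) * (1 / \<epsilon>))" unfolding t by (intro mult_left_mono r0)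
  also have "\<dots> = k / \<epsilon> * (?r * (norm x powr a * \<bar>\<phi> x\<bar>))" by (simp add: lift_def abs_mult)
  also have "\<dots> = k / \<epsilon> * \<bar>\<phi> x\<bar>" unfolding drp_lift[OF assms(4)] ..
  finally show "tst \<epsilon> k c \<phi> x \<le> k / \<epsilon> * \<bar>\<phi> x\<bar>" .
  have "c x * tst \<epsilon> k c \<phi> x = (?r * (norm x powr a * c x)) * tst \<epsilon> k c \<phi> x" unfolding drp_lift[OF assms(4)] ..
  also have "\<dots> = ?r * ?r * (?P * (lift c x / ?V))" unfolding t lift_def by (simp add: mult_ac)
  also have "\<dots> \<le> ?r * ?r * ((lift \<phi> x)\<^sup>2 * 1)"
    using V trunc_bounds(4)[OF assms(3)] assms(2) by (intro mult_left_mono mult_mono) auto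
  also have "\<dots> = (?r * (norm x powr a * \<phi> x))\<^sup>2" by (simp add: lift_def power2_eq_square mult_ac)
  also have "\<dots> = (\<phi> x)\<^sup>2" unfolding drp_lift[OF assms(4)] ..
  finally show "c x * tst \<epsilon> k c \<phi> x \<le> (\<phi> x)\<^sup>2" .
qed

text \<open>The quotient rule for F^2/V, with F the truncated lift of \<phi> and V the lift of c
  plus \<epsilon>; the powers of r cancel. The number \<open>p\<close> is the slope of
  \<open>trunc\<close>, the only change from the classical Picone computation.\<close>

lemma tst_hgrad:
  assumes "c \<in> \<D>" "\<phi> \<in> \<D>" "\<And>x. 0 \<le> c x" "\<epsilon> > 0" "k > 0" "x \<noteq> 0"
  shows "\<exists>p. \<bar>p\<bar> \<le> 1 \<and> hgrad (tst \<epsilon> k c \<phi>) x =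
    (2 * (trunc k (lift \<phi> x) / (lift c x + \<epsilon>)) * p) *\<^sub>R hgrad \<phi> x - (trunc k (lift \<phi> x) / (lift c x + \<epsilon>))\<^sup>2 *\<^sub>R hgrad c x"
proof -
  obtain p where p: "(trunc k has_real_derivative p) (at (lift \<phi> x))" "\<bar>p\<bar> \<le> 1" using trunc_deriv[OF assms(5)] by blast
  let ?F = "trunc k (lift \<phi> x)" let ?V = "lift c x + \<epsilon>" let ?r = "norm x powr a"
  have V: "?V > 0" using assms(4) lift_nonneg[of c x] assms(3)[of x] by linarith
  note g1 = has_grad_compose[OF p(1) has_grad_lift[OF test_functions_has_grad[OF assms(2)] assms(6)]]
  have "((\<lambda>s. 1 / (s + \<epsilon>)) has_real_derivative - 1 / ?V\<^sup>2) (at (lift c x))"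
    using V by (auto intro!: derivative_eq_intros simp: power2_eq_square)
  note g2 = has_grad_compose[OF this has_grad_lift[OF test_functions_has_grad[OF assms(1)] assms(6)]]
  note g3 = has_grad_mult[OF has_grad_mult[OF g1 g1] g2]
  have "hgrad (drp (\<lambda>x. trunc k (lift \<phi> x) * trunc k (lift \<phi> x) * (1 / (lift c x + \<epsilon>)))) x =
    norm x powr (- a) *\<^sub>R ((?F * ?F) *\<^sub>R ((- 1 / ?V\<^sup>2) *\<^sub>R (?r *\<^sub>R hgrad c x)) +
      (1 / ?V) *\<^sub>R (?F *\<^sub>R (p *\<^sub>R (?r *\<^sub>R hgrad \<phi> x)) + ?F *\<^sub>R (p *\<^sub>R (?r *\<^sub>R hgrad \<phi> x))))"
    by (rule hgrad_drp[OF g3 assms(6)])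
  also have "\<dots> = (norm x powr (- a) * (?r * (- (?F / ?V)\<^sup>2))) *\<^sub>R hgrad c x +
      (norm x powr (- a) * (?r * (2 * (?F / ?V) * p))) *\<^sub>R hgrad \<phi> x"
    by (simp add: scaleR_add_right scaleR_right_diff_distrib power2_eq_square mult_ac flip: scaleR_add_left)
  also have "\<dots> = (2 * (?F / ?V) * p) *\<^sub>R hgrad \<phi> x - (?F / ?V)\<^sup>2 *\<^sub>R hgrad c x"
    unfolding drp_lift[OF assms(6)] by simp
  finally show ?thesis unfolding tst_def power2_eq_square[of "trunc k (lift \<phi> _)"] using p(2) by blast
qed

text \<open>Three squares, with h and g the \<open>hgrad\<close> of \<phi> and c: |p h - q g|^2 >= 0
  is Picone's inequality; |2p h - q g|^2 >= 0 saves half of q^2 |g|^2, a localised squared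
  logarithmic gradient; |2qp h + q^2 g|^2 >= 0 and |q| <= k/\<epsilon> bound the gradient of the
  quotient.\<close>

lemma tst_picone:
  assumes "c \<in> \<D>" "\<phi> \<in> \<D>" "\<And>x. 0 \<le> c x" "\<epsilon> > 0" "k > 0" "x \<noteq> 0"
  shows "hgrad c x \<bullet> hgrad (tst \<epsilon> k c \<phi>) x \<le> hgrad \<phi> x \<bullet> hgrad \<phi> x" (is ?P)
    and "hgrad c x \<bullet> hgrad (tst \<epsilon> k c \<phi>) x \<le> 2 * (hgrad \<phi> x \<bullet> hgrad \<phi> x)
      - (trunc k (lift \<phi> x) / (lift c x + \<epsilon>))\<^sup>2 * (hgrad c x \<bullet> hgrad c x) / 2" (is ?Q)
    and "hgrad (tst \<epsilon> k c \<phi>) x \<bullet> hgrad (tst \<epsilon> k c \<phi>) x \<le>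
      8 * (k / \<epsilon>)\<^sup>2 * (hgrad \<phi> x \<bullet> hgrad \<phi> x) + 2 * (k / \<epsilon>) ^ 4 * (hgrad c x \<bullet> hgrad c x)" (is ?R)
proof -
  define q where "q = trunc k (lift \<phi> x) / (lift c x + \<epsilon>)"
  define h where "h = hgrad \<phi> x"
  define g where "g = hgrad c x"
  obtain p where p: "\<bar>p\<bar> \<le> 1" and t: "hgrad (tst \<epsilon> k c \<phi>) x = (2 * q * p) *\<^sub>R h - q\<^sup>2 *\<^sub>R g"
    using tst_hgrad[OF assms] unfolding q_def h_def g_def by blast
  have p2: "p\<^sup>2 \<le> 1" using p by (simp add: abs_square_le_1)
  have hh: "p\<^sup>2 * (h \<bullet> h) \<le> h \<bullet> h" using p2 mult_right_mono[OF p2, of "h \<bullet> h"] by simp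
  have gt: "g \<bullet> ((2 * q * p) *\<^sub>R h - q\<^sup>2 *\<^sub>R g) = 2 * (q * p * (g \<bullet> h)) - q\<^sup>2 * (g \<bullet> g)"
    by (simp add: inner_diff_right)
  have "0 \<le> (norm (p *\<^sub>R h - q *\<^sub>R g))\<^sup>2" by simp
  also have "\<dots> = p\<^sup>2 * (h \<bullet> h) - 2 * (q * p * (g \<bullet> h)) + q\<^sup>2 * (g \<bullet> g)"
    unfolding power2_norm_eq_inner
    by (simp add: inner_diff_left inner_diff_right inner_commute[of h g] power2_eq_square algebra_simps)
  finally have 1: "2 * (q * p * (g \<bullet> h)) \<le> p\<^sup>2 * (h \<bullet> h) + q\<^sup>2 * (g \<bullet> g)" by simp
  show ?P unfolding t g_def[symmetric] h_def[symmetric] gt using 1 hh by linarith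
  have "0 \<le> (norm ((2 * p) *\<^sub>R h - q *\<^sub>R g))\<^sup>2" by simp
  also have "\<dots> = 4 * (p\<^sup>2 * (h \<bullet> h)) - 4 * (q * p * (g \<bullet> h)) + q\<^sup>2 * (g \<bullet> g)"
    unfolding power2_norm_eq_inner
    by (simp add: inner_diff_left inner_diff_right inner_commute[of h g] power2_eq_square algebra_simps)
  finally have 2: "2 * (q * p * (g \<bullet> h)) \<le> 2 * (p\<^sup>2 * (h \<bullet> h)) + q\<^sup>2 * (g \<bullet> g) / 2" by simp
  show ?Q unfolding t g_def[symmetric] h_def[symmetric] q_def[symmetric] gt using 2 hh by linarith
  have V: "lift c x + \<epsilon> \<ge> \<epsilon>" using lift_nonneg[of c x] assms(3)[of x] by linarith
  have "\<bar>q\<bar> \<le> k / \<epsilon>"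
    unfolding q_def abs_divide using V assms(4,5) trunc_bounds(2)[OF assms(5)] by (intro frac_le) auto
  then have q2: "q\<^sup>2 \<le> (k / \<epsilon>)\<^sup>2" using assms(4,5) by (simp add: abs_le_square_iff[symmetric])
  then have q4: "(q\<^sup>2)\<^sup>2 \<le> (k / \<epsilon>) ^ 4" using power_mono[OF q2, of 2] by (simp flip: power_mult)
  have "0 \<le> (norm ((2 * q * p) *\<^sub>R h + q\<^sup>2 *\<^sub>R g))\<^sup>2" by simp
  also have "\<dots> = 4 * (q\<^sup>2 * (p\<^sup>2 * (h \<bullet> h))) + 4 * (q * p * q\<^sup>2 * (g \<bullet> h)) + (q\<^sup>2)\<^sup>2 * (g \<bullet> g)"
    unfolding power2_norm_eq_inner
    by (simp add: inner_add_left inner_add_right inner_commute[of h g] power2_eq_square algebra_simps)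
  finally have 3: "- (4 * (q * p * q\<^sup>2 * (g \<bullet> h))) \<le> 4 * (q\<^sup>2 * (p\<^sup>2 * (h \<bullet> h))) + (q\<^sup>2)\<^sup>2 * (g \<bullet> g)" by linarith
  have 4: "((2 * q * p) *\<^sub>R h - q\<^sup>2 *\<^sub>R g) \<bullet> ((2 * q * p) *\<^sub>R h - q\<^sup>2 *\<^sub>R g) =
     4 * (q\<^sup>2 * (p\<^sup>2 * (h \<bullet> h))) - 4 * (q * p * q\<^sup>2 * (g \<bullet> h)) + (q\<^sup>2)\<^sup>2 * (g \<bullet> g)"
    by (simp add: inner_diff_left inner_diff_right inner_commute[of h g] power2_eq_square algebra_simps)
  have 5: "q\<^sup>2 * (p\<^sup>2 * (h \<bullet> h)) \<le> (k / \<epsilon>)\<^sup>2 * (h \<bullet> h)" using q2 hh by (intro mult_mono) auto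
  have 6: "(q\<^sup>2)\<^sup>2 * (g \<bullet> g) \<le> (k / \<epsilon>) ^ 4 * (g \<bullet> g)" using q4 by (intro mult_right_mono) auto
  have "8 * (k / \<epsilon>)\<^sup>2 * (h \<bullet> h) + 2 * (k / \<epsilon>) ^ 4 * (g \<bullet> g) = 8 * ((k / \<epsilon>)\<^sup>2 * (h \<bullet> h)) + 2 * ((k / \<epsilon>) ^ 4 * (g \<bullet> g))"
    by simp
  then show ?R unfolding t g_def[symmetric] h_def[symmetric] 4 using 3 5 6 by linarith
qed

text \<open>The first bound feeds the ground state inequality and the second the logarithmic
  estimate; the third keeps the test functions bounded in the completion while the approximants
  converge.\<close>

lemma tst_form:
  assumes c: "c \<in> \<D>" and \<phi>: "\<phi> \<in> \<D>" and c0: "\<And>x. 0 \<le> c x" and e: "\<epsilon> > 0" and k: "k > 0"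
  shows "form c (tst \<epsilon> k c \<phi>) \<le> form \<phi> \<phi>"
    and "form c (tst \<epsilon> k c \<phi>) \<le> 2 * form \<phi> \<phi> - (LINT x|M. (trunc k (lift \<phi> x) / (lift c x + \<epsilon>))\<^sup>2 * (hgrad c x \<bullet> hgrad c x)) / 2"
    and "form (tst \<epsilon> k c \<phi>) (tst \<epsilon> k c \<phi>) \<le> 8 * (k / \<epsilon>)\<^sup>2 * form \<phi> \<phi> + 2 * (k / \<epsilon>) ^ 4 * form c c"
    and "integrable M (\<lambda>x. (trunc k (lift \<phi> x) / (lift c x + \<epsilon>))\<^sup>2 * (hgrad c x \<bullet> hgrad c x))"
proof -
  let ?t = "tst \<epsilon> k c \<phi>"
  note t = tst_D[OF c \<phi> c0 e k]
  note T = D_subset_T[OF c] D_subset_T[OF \<phi>] D_subset_T[OF t]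
  note ict = integrable_hgrad[OF c t] and icc = integrable_hgrad[OF c c] and iff = integrable_hgrad[OF \<phi> \<phi>] and itt = integrable_hgrad[OF t t]
  let ?q = "\<lambda>x. (trunc k (lift \<phi> x) / (lift c x + \<epsilon>))\<^sup>2 * (hgrad c x \<bullet> hgrad c x)"
  show iq: "integrable M ?q"
  proof (rule Bochner_Integration.integrable_bound)
    show "integrable M (\<lambda>x. (k / \<epsilon>)\<^sup>2 * (hgrad c x \<bullet> hgrad c x))" using icc by simp
    have "lift \<phi> \<in> borel_measurable M" "lift c \<in> borel_measurable M"
      using measurable_test[OF \<phi>] measurable_test[OF c] unfolding lift_def by measurable
    then show "?q \<in> borel_measurable M"
      using measurable_hgrad[OF c] unfolding trunc_def by measurable
    have "?q x \<le> (k / \<epsilon>)\<^sup>2 * (hgrad c x \<bullet> hgrad c x)" for x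
    proof -
      have V: "lift c x + \<epsilon> \<ge> \<epsilon>" using lift_nonneg[of c x] c0[of x] by linarith
      have "\<bar>trunc k (lift \<phi> x) / (lift c x + \<epsilon>)\<bar> \<le> k / \<epsilon>"
        unfolding abs_divide using V e k trunc_bounds(2)[OF k] by (intro frac_le) auto
      then have "(trunc k (lift \<phi> x) / (lift c x + \<epsilon>))\<^sup>2 \<le> (k / \<epsilon>)\<^sup>2" using e k by (simp add: abs_le_square_iff[symmetric])
      then show ?thesis by (intro mult_right_mono) auto
    qed
    then show "AE x in M. norm (?q x) \<le> norm ((k / \<epsilon>)\<^sup>2 * (hgrad c x \<bullet> hgrad c x))" by simp
  qed
  have k1: "\<kappa> * (LINT x|M. c x * ?t x / (norm x)\<^sup>2) \<le> \<kappa> * (LINT x|M. \<phi> x * \<phi> x / (norm x)\<^sup>2)"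
  proof (intro mult_left_mono integral_mono_AE integrable_hardy T \<kappa>_nonneg)
    show "AE x in M. c x * ?t x / (norm x)\<^sup>2 \<le> \<phi> x * \<phi> x / (norm x)\<^sup>2"
      using AE_nonzero
    proof eventually_elim
      case (elim x)
      show ?case by (rule divide_right_mono) (use tst_bounds(4)[of c x \<epsilon> k \<phi>, OF c0 e k elim] in \<open>auto simp: power2_eq_square\<close>)
    qed
  qed
  have k2: "\<kappa> * (LINT x|M. ?t x * ?t x / (norm x)\<^sup>2) \<le> \<kappa> * ((k / \<epsilon>)\<^sup>2 * (LINT x|M. \<phi> x * \<phi> x / (norm x)\<^sup>2))"
  proof -
    have "(LINT x|M. ?t x * ?t x / (norm x)\<^sup>2) \<le> (LINT x|M. (k / \<epsilon>)\<^sup>2 * (\<phi> x * \<phi> x / (norm x)\<^sup>2))"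
    proof (intro integral_mono_AE integrable_mult_right integrable_hardy T)
      show "AE x in M. ?t x * ?t x / (norm x)\<^sup>2 \<le> (k / \<epsilon>)\<^sup>2 * (\<phi> x * \<phi> x / (norm x)\<^sup>2)"
        using AE_nonzero
      proof eventually_elim
        case (elim x)
        note b = tst_bounds(1,2)[of c x \<epsilon> k \<phi>, OF c0 e k elim]
        have "?t x * ?t x \<le> (k / \<epsilon> * \<bar>\<phi> x\<bar>) * (k / \<epsilon> * \<bar>\<phi> x\<bar>)" using b e k by (intro mult_mono) auto
        also have "\<dots> = (k / \<epsilon>)\<^sup>2 * (\<phi> x * \<phi> x)" by (simp add: power2_eq_square)
        finally have "?t x * ?t x / (norm x)\<^sup>2 \<le> (k / \<epsilon>)\<^sup>2 * (\<phi> x * \<phi> x) / (norm x)\<^sup>2"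
          by (rule divide_right_mono) simp
        then show ?case by (simp only: times_divide_eq_right)
      qed
    qed
    also have "\<dots> = (k / \<epsilon>)\<^sup>2 * (LINT x|M. \<phi> x * \<phi> x / (norm x)\<^sup>2)" by (rule integral_mult_right_zero)
    finally show ?thesis using \<kappa>_nonneg by (intro mult_left_mono)
  qed
  have kp: "0 \<le> \<kappa> * (LINT x|M. \<psi> x * \<psi> x / (norm x)\<^sup>2)" for \<psi> :: "real^'n \<Rightarrow> real"
    using \<kappa>_nonneg by (intro mult_nonneg_nonneg Bochner_Integration.integral_nonneg) auto
  have "(LINT x|M. hgrad c x \<bullet> hgrad ?t x) \<le> (LINT x|M. hgrad \<phi> x \<bullet> hgrad \<phi> x)"
  proof (rule integral_mono_AE[OF ict iff])
    show "AE x in M. hgrad c x \<bullet> hgrad ?t x \<le> hgrad \<phi> x \<bullet> hgrad \<phi> x"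
      using AE_nonzero by eventually_elim (rule tst_picone(1)[OF c \<phi> c0 e k])
  qed
  then show "form c ?t \<le> form \<phi> \<phi>" unfolding form_hgrad[OF c t] form_hgrad[OF \<phi> \<phi>] using k1 by linarith
  have "(LINT x|M. hgrad c x \<bullet> hgrad ?t x) \<le> (LINT x|M. 2 * (hgrad \<phi> x \<bullet> hgrad \<phi> x) - ?q x / 2)"
  proof (rule integral_mono_AE[OF ict])
    show "integrable M (\<lambda>x. 2 * (hgrad \<phi> x \<bullet> hgrad \<phi> x) - ?q x / 2)" using iff iq by simp
    show "AE x in M. hgrad c x \<bullet> hgrad ?t x \<le> 2 * (hgrad \<phi> x \<bullet> hgrad \<phi> x) - ?q x / 2"
      using AE_nonzero by eventually_elim (rule tst_picone(2)[OF c \<phi> c0 e k])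
  qed
  also have "\<dots> = 2 * (LINT x|M. hgrad \<phi> x \<bullet> hgrad \<phi> x) - (LINT x|M. ?q x) / 2" using iff iq by simp
  finally show "form c ?t \<le> 2 * form \<phi> \<phi> - (LINT x|M. ?q x) / 2"
    unfolding form_hgrad[OF c t] form_hgrad[OF \<phi> \<phi>] distrib_left using k1 kp[of \<phi>] by linarith
  have "(LINT x|M. hgrad ?t x \<bullet> hgrad ?t x) \<le> (LINT x|M. 8 * (k / \<epsilon>)\<^sup>2 * (hgrad \<phi> x \<bullet> hgrad \<phi> x) + 2 * (k / \<epsilon>) ^ 4 * (hgrad c x \<bullet> hgrad c x))"
  proof (rule integral_mono_AE[OF itt])
    show "integrable M (\<lambda>x. 8 * (k / \<epsilon>)\<^sup>2 * (hgrad \<phi> x \<bullet> hgrad \<phi> x) + 2 * (k / \<epsilon>) ^ 4 * (hgrad c x \<bullet> hgrad c x))"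
      by (intro Bochner_Integration.integrable_add integrable_mult_right iff icc)
    show "AE x in M. hgrad ?t x \<bullet> hgrad ?t x \<le> 8 * (k / \<epsilon>)\<^sup>2 * (hgrad \<phi> x \<bullet> hgrad \<phi> x) + 2 * (k / \<epsilon>) ^ 4 * (hgrad c x \<bullet> hgrad c x)"
      using AE_nonzero by eventually_elim (rule tst_picone(3)[OF c \<phi> c0 e k])
  qed
  also have "\<dots> = 8 * (k / \<epsilon>)\<^sup>2 * (LINT x|M. hgrad \<phi> x \<bullet> hgrad \<phi> x) + 2 * (k / \<epsilon>) ^ 4 * (LINT x|M. hgrad c x \<bullet> hgrad c x)"
    by (subst Bochner_Integration.integral_add) (intro integrable_mult_right iff icc | simp only: integral_mult_right_zero)+
  finally have g: "(LINT x|M. hgrad ?t x \<bullet> hgrad ?t x) \<le> \<dots>" .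
  have "\<kappa> * ((k / \<epsilon>)\<^sup>2 * (LINT x|M. \<phi> x * \<phi> x / (norm x)\<^sup>2)) \<le> 8 * (k / \<epsilon>)\<^sup>2 * (\<kappa> * (LINT x|M. \<phi> x * \<phi> x / (norm x)\<^sup>2))"
    using mult_nonneg_nonneg[OF zero_le_power2[of "k / \<epsilon>"] kp[of \<phi>]] by (simp add: mult_ac)
  moreover have "0 \<le> 2 * (k / \<epsilon>) ^ 4 * (\<kappa> * (LINT x|M. c x * c x / (norm x)\<^sup>2))"
    by (rule mult_nonneg_nonneg[OF _ kp]) (use e k in simp)
  ultimately show "form ?t ?t \<le> 8 * (k / \<epsilon>)\<^sup>2 * form \<phi> \<phi> + 2 * (k / \<epsilon>) ^ 4 * form c c"
    unfolding form_hgrad[OF t t] form_hgrad[OF \<phi> \<phi>] form_hgrad[OF c c] distrib_left using g k2 by linarith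
qed

end

context hardy_problem begin

text \<open>The formal test function for the limits \<open>u\<close> and \<open>\<psi>\<close>. It
  is only a function on the domain, to which no element of the completion is attached.\<close>

definition tau :: "real \<Rightarrow> real \<Rightarrow> 'h \<Rightarrow> 'h \<Rightarrow> real^'n \<Rightarrow> real" where
  "tau \<epsilon> k u \<psi> = tst \<epsilon> k (fn u) (fn \<psi>)"

text \<open>Replacing \<open>emb (c n)\<close> by \<open>u\<close> in the inner product costs the
  norm of \<open>emb (c n) - u\<close> times that of the test function, which
  \<open>tst_form\<close> bounds in n. With \<open>u\<close> the equation applies, and its right
  side converges by domination by (k/\<epsilon>) |\<phi> n|.\<close>

lemma test_limit:
  assumes s: "sol l u" and nn: "AE x in M. 0 \<le> fn u x"
    and cD: "\<And>n::nat. c n \<in> \<D>" and c0: "\<And>n x. 0 \<le> c n x" and c: "(\<lambda>n. emb (c n)) \<longlonglongrightarrow> u" "AE x in M. (\<lambda>n. c n x) \<longlonglongrightarrow> fn u x"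
    and D: "\<And>n::nat. \<phi> n \<in> \<D>" and \<phi>: "(\<lambda>n. emb (\<phi> n)) \<longlonglongrightarrow> \<psi>" "AE x in M. (\<lambda>n. \<phi> n x) \<longlonglongrightarrow> fn \<psi> x"
    and e: "\<epsilon> > 0" and k: "k > 0"
  shows "integrable M (\<lambda>x. fn u x * tau \<epsilon> k u \<psi> x)" "integrable M (\<lambda>x. nl (fn u x) * tau \<epsilon> k u \<psi> x)"
    "(\<lambda>n. form (c n) (tst \<epsilon> k (c n) (\<phi> n))) \<longlonglongrightarrow>
       l * (LINT x|M. fn u x * tau \<epsilon> k u \<psi> x) - (LINT x|M. nl (fn u x) * tau \<epsilon> k u \<psi> x)"
proof -
  define t where "t n = tst \<epsilon> k (c n) (\<phi> n)" for n
  have tD: "t n \<in> \<D>" for n unfolding t_def by (rule tst_D[OF cD D c0 e k])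
  have fm: "fn w \<in> borel_measurable M" for w by (rule sqD(1)[OF sq_fn])
  have \<tau>m: "tau \<epsilon> k u \<psi> \<in> borel_measurable M"
    unfolding tau_def tst_def drp_def lift_def trunc_def using fm by measurable
  have tl: "AE x in M. (\<lambda>n. t n x) \<longlonglongrightarrow> tau \<epsilon> k u \<psi> x"
    using c(2) \<phi>(2) nn
  proof eventually_elim
    case (elim x)
    have "lift (fn u) x + \<epsilon> \<noteq> 0" using lift_nonneg[of "fn u" x] elim(3) e by linarith
    then show ?case unfolding t_def tau_def tst_def drp_def lift_def
      by (intro tendsto_intros trunc_tendsto[OF k] elim(1,2)) (simp add: lift_def)
  qed
  have tb: "AE x in M. \<bar>t n x\<bar> \<le> k / \<epsilon> * \<bar>\<phi> n x\<bar>" for n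
    using AE_nonzero
  proof eventually_elim
    case (elim x)
    show ?case unfolding t_def using tst_bounds(1,2)[of "c n" x \<epsilon> k "\<phi> n", OF c0 e k elim] by simp
  qed
  \<comment> \<open>One argument for the weights u and \<open>nl\<close> of u: what it needs of the
    weight is L^1 convergence of w \<phi> n.\<close>
  have gen: "integrable M (\<lambda>x. w x * tau \<epsilon> k u \<psi> x) \<and> (\<lambda>n. LINT x|M. w x * t n x) \<longlonglongrightarrow> (LINT x|M. w x * tau \<epsilon> k u \<psi> x)"
    if wm: "w \<in> borel_measurable M" and wi: "\<And>n. integrable M (\<lambda>x. w x * \<phi> n x)" "integrable M (\<lambda>x. w x * fn \<psi> x)"
      and w1: "(\<lambda>n. LINT x|M. \<bar>w x * \<phi> n x - w x * fn \<psi> x\<bar>) \<longlonglongrightarrow> 0" for w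
  proof -
    let ?K = "k / \<epsilon>"
    have K: "?K > 0" using e k by simp
    have m1: "(\<lambda>x. w x * t n x) \<in> borel_measurable M" for n using wm measurable_test[OF tD, of n] by measurable
    have i1: "integrable M (\<lambda>x. ?K * (w x * \<phi> n x))" for n by (rule integrable_mult_right[OF wi(1)])
    have i2: "integrable M (\<lambda>x. ?K * (w x * fn \<psi> x))" by (rule integrable_mult_right[OF wi(2)])
    have m2: "(\<lambda>x. w x * tau \<epsilon> k u \<psi> x) \<in> borel_measurable M" using wm \<tau>m by measurable
    have b: "AE x in M. \<bar>w x * t n x\<bar> \<le> \<bar>?K * (w x * \<phi> n x)\<bar>" for n
      using tb[of n]
    proof eventually_elim
      case (elim x)
      have "\<bar>w x\<bar> * \<bar>t n x\<bar> \<le> \<bar>w x\<bar> * (?K * \<bar>\<phi> n x\<bar>)" using elim by (intro mult_left_mono) auto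
      then show ?case unfolding abs_mult abs_of_pos[OF K] by (simp only: mult.left_commute)
    qed
    have l1: "AE x in M. (\<lambda>n. w x * t n x) \<longlonglongrightarrow> w x * tau \<epsilon> k u \<psi> x" using tl by eventually_elim (rule tendsto_mult_left)
    have l2: "AE x in M. (\<lambda>n. ?K * (w x * \<phi> n x)) \<longlonglongrightarrow> ?K * (w x * fn \<psi> x)"
      using \<phi>(2) by eventually_elim (intro tendsto_mult_left)
    have "(LINT x|M. \<bar>?K * (w x * \<phi> n x) - ?K * (w x * fn \<psi> x)\<bar>) = ?K * (LINT x|M. \<bar>w x * \<phi> n x - w x * fn \<psi> x\<bar>)" for n
      unfolding right_diff_distrib[symmetric] abs_mult abs_of_pos[OF K] by (rule integral_mult_right_zero)
    then have l3: "(\<lambda>n. LINT x|M. \<bar>?K * (w x * \<phi> n x) - ?K * (w x * fn \<psi> x)\<bar>) \<longlonglongrightarrow> 0"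
      using tendsto_mult_left[OF w1, of ?K] by simp
    show ?thesis
      using L1_dominated(1)[OF m1 i1 i2 m2 b l1 l2 l3] L1_dominated(3)[OF m1 i1 i2 m2 b l1 l2 l3] by blast
  qed
  have s1: "integrable M (\<lambda>x. fn u x * \<phi> n x)" for n by (rule integrable_mult_sq[OF sq_fn sq_test[OF D]])
  have s2: "integrable M (\<lambda>x. fn u x * fn \<psi> x)" by (rule integrable_mult_sq[OF sq_fn sq_fn])
  have L2: "(\<lambda>n. n2 (\<lambda>x. \<phi> n x - fn \<psi> x)) \<longlonglongrightarrow> 0" by (rule fn_conv[OF D_subset_T[OF D] \<phi>(1)])
  have lim: "(\<lambda>n. n2 (fn u) * n2 (\<lambda>x. \<phi> n x - fn \<psi> x)) \<longlonglongrightarrow> 0" using tendsto_mult_left[OF L2, of "n2 (fn u)"] by simp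
  have le: "norm (LINT x|M. \<bar>fn u x * \<phi> n x - fn u x * fn \<psi> x\<bar>) \<le> n2 (fn u) * n2 (\<lambda>x. \<phi> n x - fn \<psi> x)" for n
    unfolding right_diff_distrib[symmetric]
    using cauchy_schwarz[OF sq_fn sq_diff[OF sq_test[OF D] sq_fn], of u n \<psi>] by (simp add: Bochner_Integration.integral_nonneg)
  have s3: "(\<lambda>n. LINT x|M. \<bar>fn u x * \<phi> n x - fn u x * fn \<psi> x\<bar>) \<longlonglongrightarrow> 0"
    by (rule Lim_null_comparison[OF _ lim]) (intro always_eventually allI le)
  note G1 = gen[of "fn u", OF fm s1 s2 s3]
  have t2: "integrable M (\<lambda>x. nl (fn u x) * fn \<psi> x)" using s unfolding sol_iff by blast
  note G2 = gen[of "\<lambda>x. nl (fn u x)", OF nl_measurable[OF fm] sol_D(1)[OF s D_subset_T[OF D]] t2 nl_weighted_conv(2)[OF nn sol_D[OF s D_subset_T] D \<phi>]]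
  show "integrable M (\<lambda>x. fn u x * tau \<epsilon> k u \<psi> x)" using G1 by blast
  show "integrable M (\<lambda>x. nl (fn u x) * tau \<epsilon> k u \<psi> x)" using G2 by blast
  have e1: "u \<bullet> emb (t n) = l * (LINT x|M. fn u x * t n x) - (LINT x|M. nl (fn u x) * t n x)" for n
    by (rule sol_D(2)[OF s D_subset_T[OF tD]])
  have w1: "(\<lambda>n. u \<bullet> emb (t n)) \<longlonglongrightarrow> l * (LINT x|M. fn u x * tau \<epsilon> k u \<psi> x) - (LINT x|M. nl (fn u x) * tau \<epsilon> k u \<psi> x)"
    unfolding e1 by (intro tendsto_diff tendsto_mult_left conjunct2[OF G1] conjunct2[OF G2])
  obtain B1 where B1: "\<And>n. norm (emb (\<phi> n)) \<le> B1" using convergent_imp_Bseq[OF convergentI[OF \<phi>(1)]] by (auto simp: Bseq_def)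
  obtain B2 where B2: "\<And>n. norm (emb (c n)) \<le> B2" using convergent_imp_Bseq[OF convergentI[OF c(1)]] by (auto simp: Bseq_def)
  define Q where "Q = sqrt (8 * (k / \<epsilon>)\<^sup>2 * B1\<^sup>2 + 2 * (k / \<epsilon>) ^ 4 * B2\<^sup>2)"
  have tQ: "norm (emb (t n)) \<le> Q" for n
    unfolding Q_def
  proof (rule real_le_rsqrt)
    have "(norm (emb (t n)))\<^sup>2 \<le> 8 * (k / \<epsilon>)\<^sup>2 * (norm (emb (\<phi> n)))\<^sup>2 + 2 * (k / \<epsilon>) ^ 4 * (norm (emb (c n)))\<^sup>2"
      using tst_form(3)[OF cD[of n] D[of n] c0 e k] unfolding t_def[symmetric] norm_emb[OF D_subset_T[OF tD]] norm_emb[OF D_subset_T[OF D]] norm_emb[OF D_subset_T[OF cD]] .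
    also have "\<dots> \<le> 8 * (k / \<epsilon>)\<^sup>2 * B1\<^sup>2 + 2 * (k / \<epsilon>) ^ 4 * B2\<^sup>2"
      using B1 B2 e k by (intro add_mono mult_left_mono power_mono) auto
    finally show "(norm (emb (t n)))\<^sup>2 \<le> 8 * (k / \<epsilon>)\<^sup>2 * B1\<^sup>2 + 2 * (k / \<epsilon>) ^ 4 * B2\<^sup>2" .
  qed
  have "(\<lambda>n. norm (emb (c n) - u) * Q) \<longlonglongrightarrow> norm (u - u) * Q" by (intro tendsto_intros c(1))
  then have lim2: "(\<lambda>n. norm (emb (c n) - u) * Q) \<longlonglongrightarrow> 0" by simp
  have le2: "norm ((emb (c n) - u) \<bullet> emb (t n)) \<le> norm (emb (c n) - u) * Q" for n
    using Cauchy_Schwarz_ineq2[of "emb (c n) - u" "emb (t n)"] mult_left_mono[OF tQ[of n] norm_ge_zero[of "emb (c n) - u"]]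
    unfolding real_norm_def by linarith
  have "(\<lambda>n. (emb (c n) - u) \<bullet> emb (t n)) \<longlonglongrightarrow> 0"
    by (rule Lim_null_comparison[OF _ lim2]) (intro always_eventually allI le2)
  from tendsto_add[OF this w1]
  have "(\<lambda>n. (emb (c n) - u) \<bullet> emb (t n) + u \<bullet> emb (t n)) \<longlonglongrightarrow>
       l * (LINT x|M. fn u x * tau \<epsilon> k u \<psi> x) - (LINT x|M. nl (fn u x) * tau \<epsilon> k u \<psi> x)" by simp
  moreover have "(emb (c n) - u) \<bullet> emb (t n) + u \<bullet> emb (t n) = form (c n) (tst \<epsilon> k (c n) (\<phi> n))" for n
    unfolding t_def[symmetric] emb_inner[OF D_subset_T[OF cD] D_subset_T[OF tD], symmetric] by (simp add: inner_diff_left)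
  ultimately show "(\<lambda>n. form (c n) (tst \<epsilon> k (c n) (\<phi> n))) \<longlonglongrightarrow>
       l * (LINT x|M. fn u x * tau \<epsilon> k u \<psi> x) - (LINT x|M. nl (fn u x) * tau \<epsilon> k u \<psi> x)" by simp
qed

lemma tau_bounds:
  assumes nn: "AE x in M. 0 \<le> fn u x" and e: "\<epsilon> > 0" and k: "k > 0"
  shows "AE x in M. 0 \<le> fn u x * tau \<epsilon> k u \<psi> x \<and> fn u x * tau \<epsilon> k u \<psi> x \<le> (fn \<psi> x)\<^sup>2"
  using nn AE_nonzero
proof eventually_elim
  case (elim x)
  show ?case unfolding tau_def using tst_bounds(3,4)[of "fn u" x \<epsilon> k "fn \<psi>", OF elim(1) e k elim(2)] by blast
qed

text \<open>Jacobi's argument: test the equation for \<open>u\<close> with \<open>\<psi>\<^sup>2 / u\<close>, regularised as \<open>tau \<epsilon> k u \<psi>\<close>.\<close>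

lemma ground_state:
  assumes s: "sol l u" and pos: "AE x in M. 0 < fn u x"
    and i: "integrable M (\<lambda>x. \<bar>fn u x\<bar> powr (2 * \<gamma>) * (fn \<psi> x)\<^sup>2)"
  shows "l * (LINT x|M. (fn \<psi> x)\<^sup>2) - (LINT x|M. \<bar>fn u x\<bar> powr (2 * \<gamma>) * (fn \<psi> x)\<^sup>2) \<le> (norm \<psi>)\<^sup>2"
proof -
  have nn: "AE x in M. 0 \<le> fn u x" using pos by eventually_elim simp
  obtain c where c': "\<forall>n::nat. c n \<in> \<D> \<and> (\<forall>x. 0 \<le> c n x)" and c: "(\<lambda>n. emb (c n)) \<longlonglongrightarrow> u" "AE x in M. (\<lambda>n. c n x) \<longlonglongrightarrow> fn u x"
    using nonneg_approx[OF nn] by blast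
  have cD: "c n \<in> \<D>" and c0: "0 \<le> c n x" for n x using c' by blast+
  obtain \<phi> where \<phi>': "\<forall>n::nat. \<phi> n \<in> \<D>" and \<phi>: "(\<lambda>n. emb (\<phi> n)) \<longlonglongrightarrow> \<psi>" "AE x in M. (\<lambda>n. \<phi> n x) \<longlonglongrightarrow> fn \<psi> x"
    using D_approx_AE by blast
  have D: "\<phi> n \<in> \<D>" for n using \<phi>' by blast
  have le: "l * (LINT x|M. fn u x * tau \<epsilon> k u \<psi> x) - (LINT x|M. nl (fn u x) * tau \<epsilon> k u \<psi> x) \<le> (norm \<psi>)\<^sup>2"
    if e: "\<epsilon> > 0" and k: "k > 0" for \<epsilon> k
  proof (rule LIMSEQ_le[OF test_limit(3)[OF s nn cD c0 c D \<phi> e k]])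
    show "(\<lambda>n. (norm (emb (\<phi> n)))\<^sup>2) \<longlonglongrightarrow> (norm \<psi>)\<^sup>2" by (intro tendsto_intros \<phi>(1))
    have "form (c n) (tst \<epsilon> k (c n) (\<phi> n)) \<le> (norm (emb (\<phi> n)))\<^sup>2" for n
      unfolding norm_emb[OF D_subset_T[OF D]] by (rule tst_form(1)[OF cD D c0 e k])
    then show "\<exists>N. \<forall>n\<ge>N. form (c n) (tst \<epsilon> k (c n) (\<phi> n)) \<le> (norm (emb (\<phi> n)))\<^sup>2" by blast
  qed
  \<comment> \<open>Regularisation and truncation are removed together, with \<epsilon> = 1/(j+1)
    and k = j+1.\<close>
  define t where "t j = tau (1 / (real j + 1)) (real j + 1) u \<psi>" for j :: nat
  have jp: "1 / (real j + 1) > 0" "real j + 1 > 0" for j by auto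
  have tm: "(\<lambda>x. fn u x * t j x) \<in> borel_measurable M" for j
    unfolding t_def by (rule borel_measurable_integrable[OF test_limit(1)[OF s nn cD c0 c D \<phi> jp]])
  have nm: "(\<lambda>x. nl (fn u x) * t j x) \<in> borel_measurable M" for j
    unfolding t_def by (rule borel_measurable_integrable[OF test_limit(2)[OF s nn cD c0 c D \<phi> jp]])
  have tl: "AE x in M. (\<lambda>j. fn u x * t j x) \<longlonglongrightarrow> (fn \<psi> x)\<^sup>2"
    using pos AE_nonzero
  proof eventually_elim
    case (elim x)
    \<comment> \<open>Here positivity of u enters: at a point where u = 0 the products would all be
      0 instead of tending to the square of \<open>fn \<psi>\<close>.\<close>
    have U: "lift (fn u) x > 0" using elim by (simp add: lift_def)
    let ?r = "norm x powr (- a)"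
    have "(\<lambda>j. fn u x * (?r * ((trunc (real j + 1) (lift (fn \<psi>) x))\<^sup>2 * (1 / (lift (fn u) x + 1 / (real j + 1)))))) \<longlonglongrightarrow>
       fn u x * (?r * ((lift (fn \<psi>) x)\<^sup>2 * (1 / (lift (fn u) x + 0))))"
      using U by (intro tendsto_intros trunc_tendsto_id tendsto_inverse_Suc) auto
    moreover have "fn u x * (?r * ((lift (fn \<psi>) x)\<^sup>2 * (1 / (lift (fn u) x + 0)))) = (fn \<psi> x)\<^sup>2"
    proof -
      have "fn u x * (?r * ((lift (fn \<psi>) x)\<^sup>2 * (1 / (lift (fn u) x + 0)))) = (?r * (norm x powr a * fn \<psi> x)) * fn \<psi> x"
        using elim by (simp add: lift_def power2_eq_square)
      then show ?thesis unfolding drp_lift[OF elim(2)] by (simp add: power2_eq_square)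
    qed
    ultimately show ?case by (simp add: t_def tau_def tst_def drp_def)
  qed
  have tb: "AE x in M. norm (fn u x * t j x) \<le> (fn \<psi> x)\<^sup>2" for j
    using tau_bounds[OF nn jp(1)[of j] jp(2)[of j], where \<psi>=\<psi>] unfolding t_def by eventually_elim simp
  have fm: "fn w \<in> borel_measurable M" for w by (rule sqD(1)[OF sq_fn])
  have 1: "(\<lambda>j. LINT x|M. fn u x * t j x) \<longlonglongrightarrow> (LINT x|M. (fn \<psi> x)\<^sup>2)"
    by (rule integral_dominated_convergence[OF _ tm sqD(2)[OF sq_fn] tl tb]) (use fm in measurable)
  have eq: "nl (fn u x) * t j x = \<bar>fn u x\<bar> powr (2 * \<gamma>) * (fn u x * t j x)" for j x by (simp add: nl_def)
  have nl': "AE x in M. (\<lambda>j. nl (fn u x) * t j x) \<longlonglongrightarrow> \<bar>fn u x\<bar> powr (2 * \<gamma>) * (fn \<psi> x)\<^sup>2"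
    unfolding eq using tl by eventually_elim (rule tendsto_mult_left)
  have nb: "AE x in M. norm (nl (fn u x) * t j x) \<le> \<bar>fn u x\<bar> powr (2 * \<gamma>) * (fn \<psi> x)\<^sup>2" for j
    unfolding eq using tb[of j] by eventually_elim (auto simp: abs_mult intro!: mult_left_mono)
  have 2: "(\<lambda>j. LINT x|M. nl (fn u x) * t j x) \<longlonglongrightarrow> (LINT x|M. \<bar>fn u x\<bar> powr (2 * \<gamma>) * (fn \<psi> x)\<^sup>2)"
    by (rule integral_dominated_convergence[OF borel_measurable_integrable[OF i] nm i nl' nb])
  have "(\<lambda>j. l * (LINT x|M. fn u x * t j x) - (LINT x|M. nl (fn u x) * t j x)) \<longlonglongrightarrow>
     l * (LINT x|M. (fn \<psi> x)\<^sup>2) - (LINT x|M. \<bar>fn u x\<bar> powr (2 * \<gamma>) * (fn \<psi> x)\<^sup>2)"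
    by (intro tendsto_diff tendsto_mult_left 1 2)
  then show ?thesis by (rule LIMSEQ_le_const2) (use le[OF jp] in \<open>auto simp: t_def\<close>)
qed

text \<open>Averaging the ground state inequalities of \<open>u\<close> and \<open>v\<close> at \<open>u - v\<close> and comparing with the difference of the two
  equations leaves the integral of \<open>(u - v) (u + v) (u\<^sup>2\<^sup>\<gamma> - v\<^sup>2\<^sup>\<gamma>)\<close>, which is therefore at most zero.\<close>

lemma positive_unique:
  assumes su: "sol l u" and sv: "sol l v" and pu: "AE x in M. 0 < fn u x" and pv: "AE x in M. 0 < fn v x"
  shows "u = v"
proof -
  define z where "z = u - v"
  define f where "f = fn u"
  define g where "g = fn v"
  define h where "h = fn z"
  have hd: "AE x in M. h x = f x - g x" using fn_diff[of u v] by (simp add: f_def g_def h_def z_def)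
  have fm: "f \<in> borel_measurable M" "g \<in> borel_measurable M" "h \<in> borel_measurable M"
    unfolding f_def g_def h_def by (rule sqD(1)[OF sq_fn])+
  have p: "AE x in M. 0 < f x" "AE x in M. 0 < g x" using pu pv by (simp_all add: f_def g_def)
  have iE: "integrable M (\<lambda>x. nl (f x) * f x + nl (g x) * g x)"
    using sol_energy(1)[OF su] sol_energy(1)[OF sv] unfolding f_def g_def by (rule Bochner_Integration.integrable_add)
  \<comment> \<open>As f and g are positive, |f - g| is at most the larger of the two, so the
    integrand is at most the sum of the two energy densities.\<close>
  have I: "integrable M (\<lambda>x. \<bar>w x\<bar> powr (2 * \<gamma>) * (h x)\<^sup>2)"
    if wm: "w \<in> borel_measurable M" and w: "AE x in M. 0 < w x \<and> w x \<le> max (f x) (g x)" for w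
  proof (rule Bochner_Integration.integrable_bound[OF iE])
    show "(\<lambda>x. \<bar>w x\<bar> powr (2 * \<gamma>) * (h x)\<^sup>2) \<in> borel_measurable M" using wm fm by measurable
    show "AE x in M. norm (\<bar>w x\<bar> powr (2 * \<gamma>) * (h x)\<^sup>2) \<le> norm (nl (f x) * f x + nl (g x) * g x)"
      using w p hd
    proof eventually_elim
      case (elim x)
      define m where "m = max (f x) (g x)"
      have m: "m > 0" using elim by (auto simp: m_def)
      have "\<bar>h x\<bar> \<le> m" using elim by (auto simp: m_def)
      then have "(h x)\<^sup>2 \<le> m\<^sup>2" using m by (simp add: abs_le_square_iff[symmetric])
      moreover have "\<bar>w x\<bar> powr (2 * \<gamma>) \<le> m powr (2 * \<gamma>)" using elim(1) \<gamma>_pos by (intro powr_mono2) (auto simp: m_def)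
      ultimately have "\<bar>w x\<bar> powr (2 * \<gamma>) * (h x)\<^sup>2 \<le> m powr (2 * \<gamma>) * m\<^sup>2" by (intro mult_mono) auto
      also have "\<dots> = nl m * m" using m by (simp add: nl_def power2_eq_square)
      also have "\<dots> \<le> nl (f x) * f x + nl (g x) * g x"
        using nl_self_nonneg[of "f x"] nl_self_nonneg[of "g x"] by (auto simp: m_def max_def)
      finally show ?case by (simp add: abs_mult)
    qed
  qed
  have If: "integrable M (\<lambda>x. \<bar>f x\<bar> powr (2 * \<gamma>) * (h x)\<^sup>2)"
    by (rule I[OF fm(1)]) (use p(1) in \<open>eventually_elim, simp\<close>)
  have Ig: "integrable M (\<lambda>x. \<bar>g x\<bar> powr (2 * \<gamma>) * (h x)\<^sup>2)"
    by (rule I[OF fm(2)]) (use p(2) in \<open>eventually_elim, simp\<close>)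
  have Gu: "l * (LINT x|M. (h x)\<^sup>2) - (LINT x|M. \<bar>f x\<bar> powr (2 * \<gamma>) * (h x)\<^sup>2) \<le> (norm z)\<^sup>2"
    using ground_state[OF su pu, of z] If unfolding f_def h_def by blast
  have Gv: "l * (LINT x|M. (h x)\<^sup>2) - (LINT x|M. \<bar>g x\<bar> powr (2 * \<gamma>) * (h x)\<^sup>2) \<le> (norm z)\<^sup>2"
    using ground_state[OF sv pv, of z] Ig unfolding g_def h_def by blast
  have su': "integrable M (\<lambda>x. nl (f x) * h x)" "u \<bullet> z = l * (LINT x|M. f x * h x) - (LINT x|M. nl (f x) * h x)"
    using su unfolding sol_iff f_def h_def by blast+
  have sv': "integrable M (\<lambda>x. nl (g x) * h x)" "v \<bullet> z = l * (LINT x|M. g x * h x) - (LINT x|M. nl (g x) * h x)"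
    using sv unfolding sol_iff g_def h_def by blast+
  have ifh: "integrable M (\<lambda>x. f x * h x)" "integrable M (\<lambda>x. g x * h x)"
    unfolding f_def g_def h_def by (rule integrable_mult_sq[OF sq_fn sq_fn])+
  have h2: "(LINT x|M. (h x)\<^sup>2) = (LINT x|M. f x * h x) - (LINT x|M. g x * h x)"
  proof -
    have "(LINT x|M. (h x)\<^sup>2) = (LINT x|M. f x * h x - g x * h x)"
    proof (rule integral_cong_AE)
      show "AE x in M. (h x)\<^sup>2 = f x * h x - g x * h x" using hd
      proof eventually_elim
        case (elim x)
        show ?case unfolding power2_eq_square left_diff_distrib[symmetric] elim[symmetric] ..
      qed
    qed (use fm in measurable)
    then show ?thesis using ifh by simp
  qed
  have zz: "(norm z)\<^sup>2 = l * (LINT x|M. (h x)\<^sup>2) - ((LINT x|M. nl (f x) * h x) - (LINT x|M. nl (g x) * h x))"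
  proof -
    have "(norm z)\<^sup>2 = u \<bullet> z - v \<bullet> z" by (simp add: power2_norm_eq_inner z_def inner_diff_left)
    then show ?thesis unfolding su'(2) sv'(2) h2 by (simp add: algebra_simps)
  qed
  define D where "D x = 2 * (nl (f x) * h x - nl (g x) * h x) - (\<bar>f x\<bar> powr (2 * \<gamma>) * (h x)\<^sup>2 + \<bar>g x\<bar> powr (2 * \<gamma>) * (h x)\<^sup>2)" for x
  have Di: "integrable M D" unfolding D_def using su'(1) sv'(1) If Ig
    by (intro Bochner_Integration.integrable_diff Bochner_Integration.integrable_add integrable_mult_right)
  have "(LINT x|M. D x) = 2 * ((LINT x|M. nl (f x) * h x) - (LINT x|M. nl (g x) * h x))
     - ((LINT x|M. \<bar>f x\<bar> powr (2 * \<gamma>) * (h x)\<^sup>2) + (LINT x|M. \<bar>g x\<bar> powr (2 * \<gamma>) * (h x)\<^sup>2))"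
    unfolding D_def using su'(1) sv'(1) If Ig by simp
  \<comment> \<open>With Z = L - (A - B), the two ground state inequalities read A - B <= F and A -
    B <= G; these are added.\<close>
  moreover have "2 * (A - B) - (F + G) \<le> 0" if "L - F \<le> Z" "L - G \<le> Z" "Z = L - (A - B)" for A B F G L Z :: real
  proof -
    have 1: "A - B \<le> F" and 2: "A - B \<le> G" using that by simp_all
    show ?thesis using add_mono[OF 1 2] by simp
  qed
  from this[OF Gu Gv zz] have "2 * ((LINT x|M. nl (f x) * h x) - (LINT x|M. nl (g x) * h x))
     - ((LINT x|M. \<bar>f x\<bar> powr (2 * \<gamma>) * (h x)\<^sup>2) + (LINT x|M. \<bar>g x\<bar> powr (2 * \<gamma>) * (h x)\<^sup>2)) \<le> 0" .
  ultimately have D0: "(LINT x|M. D x) \<le> 0" by (simp only:)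
  have De: "AE x in M. D x = (f x - g x) * (f x + g x) * (f x powr (2 * \<gamma>) - g x powr (2 * \<gamma>))"
    using p hd
  proof eventually_elim
    case (elim x)
    show ?case unfolding D_def nl_def elim(3) using elim(1,2) by (simp add: power2_eq_square algebra_simps)
  qed
  have ps: "(s - t) * (s + t) * (s powr (2 * \<gamma>) - t powr (2 * \<gamma>)) \<ge> 0"
    "s \<noteq> t \<Longrightarrow> (s - t) * (s + t) * (s powr (2 * \<gamma>) - t powr (2 * \<gamma>)) \<noteq> 0" if "0 < s" "0 < t" for s t :: real
  proof -
    have a: "(s - t) * (s + t) * (s powr (2 * \<gamma>) - t powr (2 * \<gamma>)) > 0" if "s \<noteq> t"
    proof (cases "s < t")
      case True
      then have "s powr (2 * \<gamma>) < t powr (2 * \<gamma>)" using \<open>0 < s\<close> \<gamma>_pos by (intro powr_less_mono2) auto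
      then show ?thesis using True \<open>0 < s\<close> \<open>0 < t\<close> by (intro mult_neg_neg mult_neg_pos) auto
    next
      case False
      then have "t powr (2 * \<gamma>) < s powr (2 * \<gamma>)" using \<open>0 < t\<close> \<gamma>_pos that by (intro powr_less_mono2) auto
      then show ?thesis using False that \<open>0 < s\<close> \<open>0 < t\<close> by (intro mult_pos_pos) auto
    qed
    then show "(s - t) * (s + t) * (s powr (2 * \<gamma>) - t powr (2 * \<gamma>)) \<ge> 0" by (cases "s = t") auto
    show "s \<noteq> t \<Longrightarrow> (s - t) * (s + t) * (s powr (2 * \<gamma>) - t powr (2 * \<gamma>)) \<noteq> 0" using a by force
  qed
  have Dn: "AE x in M. 0 \<le> D x" using De p by eventually_elim (simp add: ps)
  have "(LINT x|M. D x) = 0" using D0 integral_nonneg_AE[OF Dn] by linarith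
  then have "AE x in M. D x = 0" using integral_nonneg_eq_0_iff_AE[OF Di Dn] by simp
  then have "AE x in M. h x = 0"
    using De p hd
  proof eventually_elim
    case (elim x)
    then show ?case using ps(2)[of "f x" "g x"] by force
  qed
  \<comment> \<open>That z itself vanishes follows from \<open>zz\<close>, which expresses its norm
    through integrals containing h.\<close>
  then have h0: "AE x in M. (h x)\<^sup>2 = 0" "AE x in M. nl (f x) * h x = 0" "AE x in M. nl (g x) * h x = 0"
    by (auto elim: eventually_mono)
  have "(LINT x|M. (h x)\<^sup>2) = 0" "(LINT x|M. nl (f x) * h x) = 0" "(LINT x|M. nl (g x) * h x) = 0"
    using h0 by (auto intro: integral_eq_zero_AE)
  then have "(norm z)\<^sup>2 = 0" unfolding zz by simp
  then show ?thesis by (simp add: z_def)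
qed

end

section \<open>Positivity\<close>

lemma nn_integral_translation:
  fixes f :: "'a::euclidean_space \<Rightarrow> ennreal"
  assumes "f \<in> borel_measurable borel"
  shows "(\<integral>\<^sup>+x. f (c + x) \<partial>lborel) = (\<integral>\<^sup>+x. f x \<partial>lborel)"
proof -
  have "(\<integral>\<^sup>+x. f x \<partial>lborel) = (\<integral>\<^sup>+x. f x \<partial>distr lborel borel ((+) c))" by (simp add: lborel_distr_plus)
  also have "\<dots> = (\<integral>\<^sup>+x. f (c + x) \<partial>lborel)" using assms by (intro nn_integral_distr) auto
  finally show ?thesis by simp
qed

text \<open>The increment along a segment is at most the integral of the gradient; integrating over all segments
  in a fixed direction and then over the directions gives a Poincare inequality.\<close>

lemma segment_increment:
  fixes L :: "real^'n::finite \<Rightarrow> real"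
  assumes hg: "\<And>x. has_grad L (grad L x) x" and cont: "continuous_on UNIV (grad L)"
  shows "ennreal \<bar>L (x + h) - L x\<bar> \<le>
    (\<integral>\<^sup>+t. ennreal (norm h) * (ennreal (norm (grad L (x + t *\<^sub>R h))) * indicator {0..1} t) \<partial>lborel)"
proof -
  let ?f = "\<lambda>t. grad L (x + t *\<^sub>R h) \<bullet> h"
  have d: "((\<lambda>t. L (x + t *\<^sub>R h)) has_vector_derivative ?f t) (at t within {0..1})" for t
  proof -
    have "((\<lambda>t. x + t *\<^sub>R h) has_derivative (\<lambda>s. s *\<^sub>R h)) (at t within {0..1})"
      by (auto intro!: derivative_eq_intros)
    from has_derivative_compose[OF this hg[unfolded has_grad_def, of "x + t *\<^sub>R h"]]
    show ?thesis by (simp add: has_vector_derivative_def)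
  qed
  have c: "continuous_on {0..1} ?f"
    by (intro continuous_intros continuous_on_compose2[OF cont]) auto
  have h: "has_bochner_integral lborel (\<lambda>t. indicator {0..1} t *\<^sub>R ?f t) (L (x + 1 *\<^sub>R h) - L (x + 0 *\<^sub>R h))"
    by (rule has_bochner_integral_FTC_Icc[OF _ d c]) simp
  have "ennreal \<bar>L (x + h) - L x\<bar> = ennreal (norm (LINT t|lborel. indicator {0..1} t *\<^sub>R ?f t))"
    using has_bochner_integral_integral_eq[OF h] by simp
  also have "\<dots> \<le> (\<integral>\<^sup>+t. ennreal (norm (indicator {0..1} t *\<^sub>R ?f t)) \<partial>lborel)"
    using h by (intro integral_norm_bound_ennreal) (auto simp: has_bochner_integral_iff)
  also have "\<dots> \<le> (\<integral>\<^sup>+t. ennreal (norm h) * (ennreal (norm (grad L (x + t *\<^sub>R h))) * indicator {0..1} t) \<partial>lborel)"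
  proof (rule nn_integral_mono)
    fix t :: real
    have "\<bar>?f t\<bar> \<le> norm h * norm (grad L (x + t *\<^sub>R h))"
      using Cauchy_Schwarz_ineq2[of "grad L (x + t *\<^sub>R h)" h] by (simp add: mult.commute)
    then show "ennreal (norm (indicator {0..1} t *\<^sub>R ?f t)) \<le> ennreal (norm h) * (ennreal (norm (grad L (x + t *\<^sub>R h))) * indicator {0..1} t)"
      by (auto simp: indicator_def ennreal_mult[symmetric] intro!: ennreal_leI)
  qed
  finally show ?thesis .
qed

lemma poincare_ball:
  fixes L :: "real^'n::finite \<Rightarrow> real" and c :: "real^'n" and \<rho> :: real
  assumes hg: "\<And>x. has_grad L (grad L x) x" and cont: "continuous_on UNIV (grad L)"
  defines "B \<equiv> ball c \<rho>"
  shows "(\<integral>\<^sup>+x. \<integral>\<^sup>+y. ennreal \<bar>L y - L x\<bar> * (indicator B x * indicator B y) \<partial>lborel \<partial>lborel) \<le>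
    (ennreal (2 * \<rho>) * (\<integral>\<^sup>+z. ennreal (norm (grad L z)) * indicator B z \<partial>lborel)) * emeasure lborel (ball (0::real^'n) (2 * \<rho>))"
proof -
  have "continuous_on UNIV L"
    using hg has_grad_differentiable differentiable_imp_continuous_within
    by (intro continuous_at_imp_continuous_on) blast
  then have Lm[measurable]: "L \<in> borel_measurable borel" by (rule borel_measurable_continuous_onI)
  have gm[measurable]: "grad L \<in> borel_measurable borel" using cont by (rule borel_measurable_continuous_onI)
  have Bm[measurable]: "B \<in> sets borel" by (simp add: B_def)
  let ?I = "\<integral>\<^sup>+z. ennreal (norm (grad L z)) * indicator B z \<partial>lborel"
  \<comment> \<open>For a fixed displacement h the segment stays in the convex ball; Tonelli moves
    the integral over its parameter t outside, and translation by t h yields the same gradient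
    integral for every t. Displacements of length at least 2\<rho> join no two points of the
    ball.\<close>
  have dir: "(\<integral>\<^sup>+x. ennreal \<bar>L (x + h) - L x\<bar> * (indicator B x * indicator B (x + h)) \<partial>lborel) \<le>
      ennreal (2 * \<rho>) * ?I * indicator (ball 0 (2 * \<rho>)) h" for h
  proof (cases "h \<in> ball 0 (2 * \<rho>)")
    case False
    have z: "indicator B x * indicator B (x + h) = (0::ennreal)" for x
    proof (rule ccontr)
      assume "indicator B x * indicator B (x + h) \<noteq> (0::ennreal)"
      then have "dist c x < \<rho>" "dist c (x + h) < \<rho>" by (auto simp: B_def indicator_def split: if_splits)
      then have "dist x (x + h) < 2 * \<rho>" using dist_triangle3[of x "x + h" c] by simp
      then show False using False by (simp add: dist_norm)
    qed
    have "(\<integral>\<^sup>+x. ennreal \<bar>L (x + h) - L x\<bar> * (indicator B x * indicator B (x + h)) \<partial>lborel) = (\<integral>\<^sup>+x. 0 \<partial>(lborel :: (real^'n) measure))"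
      by (intro nn_integral_cong) (simp only: z mult_zero_right)
    then show ?thesis by simp
  next
    case True
    then have hr: "norm h \<le> 2 * \<rho>" by simp
    have pt: "ennreal \<bar>L (x + h) - L x\<bar> * (indicator B x * indicator B (x + h)) \<le>
       (\<integral>\<^sup>+t. ennreal (norm h) * ((ennreal (norm (grad L (x + t *\<^sub>R h))) * indicator B (x + t *\<^sub>R h)) * indicator {0..1} t) \<partial>lborel)" for x
    proof (cases "x \<in> B \<and> x + h \<in> B")
      case True
      have seg: "x + t *\<^sub>R h \<in> B" if "t \<in> {0..1}" for t
      proof -
        have "(1 - t) *\<^sub>R x + t *\<^sub>R (x + h) \<in> B"
          using True that convex_ball[of c \<rho>] unfolding B_def convex_alt by auto
        moreover have "(1 - t) *\<^sub>R x + t *\<^sub>R (x + h) = x + t *\<^sub>R h" by (simp add: algebra_simps)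
        ultimately show ?thesis by simp
      qed
      have "ennreal \<bar>L (x + h) - L x\<bar> * (indicator B x * indicator B (x + h)) = ennreal \<bar>L (x + h) - L x\<bar>"
        using True by simp
      also have "\<dots> \<le> (\<integral>\<^sup>+t. ennreal (norm h) * (ennreal (norm (grad L (x + t *\<^sub>R h))) * indicator {0..1} t) \<partial>lborel)"
        by (rule segment_increment[OF hg cont])
      also have "\<dots> = (\<integral>\<^sup>+t. ennreal (norm h) * ((ennreal (norm (grad L (x + t *\<^sub>R h))) * indicator B (x + t *\<^sub>R h)) * indicator {0..1} t) \<partial>lborel)"
        using seg by (intro nn_integral_cong) (auto simp: indicator_def)
      finally show ?thesis .
    qed auto
    have "(\<integral>\<^sup>+x. ennreal \<bar>L (x + h) - L x\<bar> * (indicator B x * indicator B (x + h)) \<partial>lborel) \<le>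
      (\<integral>\<^sup>+x. \<integral>\<^sup>+t. ennreal (norm h) * ((ennreal (norm (grad L (x + t *\<^sub>R h))) * indicator B (x + t *\<^sub>R h)) * indicator {0..1} t) \<partial>lborel \<partial>lborel)"
      by (intro nn_integral_mono pt)
    also have "\<dots> = (\<integral>\<^sup>+t. \<integral>\<^sup>+x. ennreal (norm h) * ((ennreal (norm (grad L (x + t *\<^sub>R h))) * indicator B (x + t *\<^sub>R h)) * indicator {0..1} t) \<partial>lborel \<partial>lborel)"
      by (rule lborel_pair.Fubini'[symmetric]) measurable
    also have "\<dots> = (\<integral>\<^sup>+t. ennreal (norm h) * ?I * indicator {0..1::real} t \<partial>lborel)"
    proof (rule nn_integral_cong)
      fix t :: real
      have "(\<integral>\<^sup>+x. ennreal (norm h) * ((ennreal (norm (grad L (x + t *\<^sub>R h))) * indicator B (x + t *\<^sub>R h)) * indicator {0..1} t) \<partial>lborel)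
        = (\<integral>\<^sup>+x. (ennreal (norm h) * indicator {0..1} t) * (ennreal (norm (grad L (t *\<^sub>R h + x))) * indicator B (t *\<^sub>R h + x)) \<partial>lborel)"
        by (intro nn_integral_cong) (simp add: mult_ac add.commute)
      also have "\<dots> = (ennreal (norm h) * indicator {0..1} t) * (\<integral>\<^sup>+x. ennreal (norm (grad L (t *\<^sub>R h + x))) * indicator B (t *\<^sub>R h + x) \<partial>lborel)"
        by (rule nn_integral_cmult) measurable
      also have "(\<integral>\<^sup>+x. ennreal (norm (grad L (t *\<^sub>R h + x))) * indicator B (t *\<^sub>R h + x) \<partial>lborel) = ?I"
        by (rule nn_integral_translation) measurable
      finally show "(\<integral>\<^sup>+x. ennreal (norm h) * ((ennreal (norm (grad L (x + t *\<^sub>R h))) * indicator B (x + t *\<^sub>R h)) * indicator {0..1} t) \<partial>lborel)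
        = ennreal (norm h) * ?I * indicator {0..1} t" by (simp add: mult_ac)
    qed
    also have "\<dots> = ennreal (norm h) * ?I" by (simp add: nn_integral_cmult_indicator)
    also have "\<dots> \<le> ennreal (2 * \<rho>) * ?I" using hr by (intro mult_right_mono ennreal_leI) auto
    finally show ?thesis using True by simp
  qed
  have "(\<integral>\<^sup>+x. \<integral>\<^sup>+y. ennreal \<bar>L y - L x\<bar> * (indicator B x * indicator B y) \<partial>lborel \<partial>lborel) =
     (\<integral>\<^sup>+x. \<integral>\<^sup>+h. ennreal \<bar>L (x + h) - L x\<bar> * (indicator B x * indicator B (x + h)) \<partial>lborel \<partial>lborel)"
  proof (rule nn_integral_cong)
    fix x
    show "(\<integral>\<^sup>+y. ennreal \<bar>L y - L x\<bar> * (indicator B x * indicator B y) \<partial>lborel) =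
      (\<integral>\<^sup>+h. ennreal \<bar>L (x + h) - L x\<bar> * (indicator B x * indicator B (x + h)) \<partial>lborel)"
      by (rule nn_integral_translation[symmetric]) measurable
  qed
  also have "\<dots> = (\<integral>\<^sup>+h. \<integral>\<^sup>+x. ennreal \<bar>L (x + h) - L x\<bar> * (indicator B x * indicator B (x + h)) \<partial>lborel \<partial>lborel)"
    by (rule lborel_pair.Fubini'[symmetric]) measurable
  also have "\<dots> \<le> (\<integral>\<^sup>+h. ennreal (2 * \<rho>) * ?I * indicator (ball (0::real^'n) (2 * \<rho>)) h \<partial>lborel)"
    by (intro nn_integral_mono dir)
  also have "\<dots> = (ennreal (2 * \<rho>) * ?I) * emeasure lborel (ball (0::real^'n) (2 * \<rho>))"
    by (simp add: nn_integral_cmult_indicator)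
  finally show ?thesis .
qed

section \<open>Logarithmic estimate and the strong maximum principle\<close>

context hardy_problem begin

text \<open>Tonelli and translations are applied over \<open>lborel\<close>, while \<open>M\<close>
  is a completed measure; for Borel functions cut off to a Borel set inside the domain the two
  integrals agree.\<close>

lemma nn_integral_M_lborel:
  assumes "g \<in> borel_measurable borel" "B \<in> sets borel" "B \<subseteq> \<Omega>"
  shows "(\<integral>\<^sup>+y. g y * indicator B y \<partial>M) = (\<integral>\<^sup>+y. g y * indicator B y \<partial>lborel)"
proof -
  have "(\<integral>\<^sup>+y. g y * indicator B y \<partial>M) = (\<integral>\<^sup>+y. g y * indicator B y * indicator \<Omega> y \<partial>lebesgue)"
    using Om_sets by (intro nn_integral_restrict_space) auto
  also have "\<dots> = (\<integral>\<^sup>+y. g y * indicator B y \<partial>lebesgue)"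
    using assms(3) by (intro nn_integral_cong) (auto simp: indicator_def)
  also have "\<dots> = (\<integral>\<^sup>+y. g y * indicator B y \<partial>lborel)" by (rule nn_integral_completion)
  finally show ?thesis .
qed

lemma borel_to_M: "f \<in> borel_measurable borel \<Longrightarrow> f \<in> borel_measurable M" for f :: "real^'n \<Rightarrow> ennreal"
  by (intro measurable_restrict_space1 measurable_completion) simp

text \<open>Testing with the regularised quotient of \<beta>, truncated at level 1. Since l >= 0,
  only the nonlinear term can make the right side negative, and it is at most the integral of
  u^(2\<gamma>) \<beta>^2; hence C does not depend on \<epsilon>. The equation is reached only as n
  grows, so the bound holds eventually, with the summand 1 as slack.\<close>

lemma sol_log_bound:
  assumes s: "sol l u" and nn: "AE x in M. 0 \<le> fn u x" and l0: "0 \<le> l" and \<beta>: "\<beta> \<in> \<D>"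
  shows "\<exists>C. \<forall>\<epsilon>>0. \<forall>c. (\<forall>n. c n \<in> \<D> \<and> (\<forall>x. 0 \<le> c n x)) \<and> (\<lambda>n. emb (c n)) \<longlonglongrightarrow> u \<and> (AE x in M. (\<lambda>n. c n x) \<longlonglongrightarrow> fn u x) \<longrightarrow>
    (\<forall>\<^sub>F n in sequentially. (LINT x|M. (trunc 1 (lift \<beta> x) / (lift (c n) x + \<epsilon>))\<^sup>2 * (hgrad (c n) x \<bullet> hgrad (c n) x)) \<le> C)"
proof -
  let ?\<psi> = "emb \<beta>"
  have fm: "fn w \<in> borel_measurable M" for w by (rule sqD(1)[OF sq_fn])
  obtain B where B: "B > 0" "\<forall>x. \<bar>\<beta> x\<bar> \<le> B" using test_functions_bounded[OF \<beta>] by blast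
  have i0: "integrable M (\<lambda>x. (1 + nl (fn u x) * fn u x + 1) * B\<^sup>2)" using sol_energy(1)[OF s] by simp
  define C0 where "C0 = (LINT x|M. (1 + nl (fn u x) * fn u x + 1) * B\<^sup>2)"
  define C where "C = 2 * (2 * form \<beta> \<beta> + C0 + 1)"
  have main: "\<forall>\<^sub>F n in sequentially. (LINT x|M. (trunc 1 (lift \<beta> x) / (lift (c n) x + \<epsilon>))\<^sup>2 * (hgrad (c n) x \<bullet> hgrad (c n) x)) \<le> C"
    if e: "\<epsilon> > 0" and cD: "\<And>n. c n \<in> \<D>" and c0: "\<And>n x. 0 \<le> c n x" and c: "(\<lambda>n. emb (c n)) \<longlonglongrightarrow> u" "AE x in M. (\<lambda>n. c n x) \<longlonglongrightarrow> fn u x" for \<epsilon> c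
  proof -
    have \<phi>: "(\<lambda>n::nat. emb \<beta>) \<longlonglongrightarrow> ?\<psi>" "AE x in M. (\<lambda>n::nat. \<beta> x) \<longlonglongrightarrow> fn ?\<psi> x"
      using fn_emb[OF D_subset_T[OF \<beta>]] by (auto elim!: eventually_mono)
    have k1: "(1::real) > 0" by simp
    note TL = test_limit[of l u c "\<lambda>_. \<beta>" ?\<psi> \<epsilon> 1, OF s nn cD c0 c \<beta> \<phi> e k1]
    have n1: "(LINT x|M. fn u x * tau \<epsilon> 1 u ?\<psi> x) \<ge> 0"
      by (rule integral_nonneg_AE) (use tau_bounds[OF nn e k1, where \<psi>="?\<psi>"] in \<open>auto elim: eventually_mono\<close>)
    have n2: "(LINT x|M. nl (fn u x) * tau \<epsilon> 1 u ?\<psi> x) \<le> C0"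
      unfolding C0_def
    proof (rule integral_mono_AE[OF TL(2) i0])
      show "AE x in M. nl (fn u x) * tau \<epsilon> 1 u ?\<psi> x \<le> (1 + nl (fn u x) * fn u x + 1) * B\<^sup>2"
        using tau_bounds[OF nn e k1, where \<psi>="?\<psi>"] fn_emb[OF D_subset_T[OF \<beta>]] nn
      proof eventually_elim
        case (elim x)
        let ?p = "\<bar>fn u x\<bar> powr (2 * \<gamma>)"
        have "nl (fn u x) * tau \<epsilon> 1 u ?\<psi> x = ?p * (fn u x * tau \<epsilon> 1 u ?\<psi> x)" by (simp add: nl_def)
        also have "\<dots> \<le> ?p * (\<beta> x)\<^sup>2" using elim by (intro mult_left_mono) auto
        also have "\<dots> \<le> (1 + nl (fn u x) * fn u x + 1) * B\<^sup>2"
        proof (intro mult_mono)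
          show "?p \<le> 1 + nl (fn u x) * fn u x + 1"
          proof (cases "\<bar>fn u x\<bar> \<le> 1")
            case True
            then have "?p \<le> 1" using \<gamma>_pos by (intro powr_le1) auto
            then show ?thesis using nl_self_nonneg[of "fn u x"] by linarith
          next
            case False
            have "?p * 1 \<le> ?p * \<bar>fn u x\<bar>" using False by (intro mult_left_mono) auto
            also have "\<dots> = \<bar>nl (fn u x)\<bar>" by (simp add: nl_def abs_mult)
            finally show ?thesis using nl_le[of "fn u x"] by linarith
          qed
          show "(\<beta> x)\<^sup>2 \<le> B\<^sup>2" using B by (simp add: abs_le_square_iff[symmetric])
        qed (use nl_self_nonneg[of "fn u x"] in auto)
        finally show ?case .
      qed
    qed
    have "- (C0 + 1) < l * (LINT x|M. fn u x * tau \<epsilon> 1 u ?\<psi> x) - (LINT x|M. nl (fn u x) * tau \<epsilon> 1 u ?\<psi> x)"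
      using n2 mult_nonneg_nonneg[OF l0 n1] by linarith
    from order_tendstoD(1)[OF TL(3) this]
    show ?thesis
    proof eventually_elim
      case (elim n)
      have "(LINT x|M. (trunc 1 (lift \<beta> x) / (lift (c n) x + \<epsilon>))\<^sup>2 * (hgrad (c n) x \<bullet> hgrad (c n) x)) / 2 \<le> 2 * form \<beta> \<beta> + C0 + 1"
        using tst_form(2)[of "c n" \<beta> \<epsilon> 1, OF cD \<beta> c0 e k1] elim by linarith
      then show ?case by (simp add: C_def)
    qed
  qed
  show ?thesis
  proof (intro exI[of _ C] allI impI)
    fix \<epsilon> :: real and c :: "nat \<Rightarrow> real^'n \<Rightarrow> real"
    assume e: "\<epsilon> > 0" and c: "(\<forall>n. c n \<in> \<D> \<and> (\<forall>x. 0 \<le> c n x)) \<and> (\<lambda>n. emb (c n)) \<longlonglongrightarrow> u \<and> (AE x in M. (\<lambda>n. c n x) \<longlonglongrightarrow> fn u x)"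
    show "\<forall>\<^sub>F n in sequentially. (LINT x|M. (trunc 1 (lift \<beta> x) / (lift (c n) x + \<epsilon>))\<^sup>2 * (hgrad (c n) x \<bullet> hgrad (c n) x)) \<le> C"
      by (rule main[OF e]) (use c in blast)+
  qed
qed

lemma lift_D: assumes "c \<in> \<D>" shows "lift c \<in> \<D>"
  by (rule test_functionsI[OF assms _ _ smooth_on_lift[OF assms]]) (auto simp: open_Compl lift_def)

lemma log_grad:
  assumes "c \<in> \<D>" "\<And>x. 0 \<le> c x" "\<epsilon> > 0"
  defines "L \<equiv> \<lambda>x. ln (lift c x + \<epsilon>)"
  shows "has_grad L (grad L x) x" "continuous_on UNIV (grad L)"
    "x \<noteq> 0 \<Longrightarrow> norm (grad L x) = norm x powr a * norm (hgrad c x) / (lift c x + \<epsilon>)"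
proof -
  note U = lift_D[OF assms(1)]
  have V: "lift c x + \<epsilon> > 0" for x using lift_nonneg[of c x] assms(2)[of x] assms(3) by linarith
  have h: "has_grad L ((1 / (lift c x + \<epsilon>)) *\<^sub>R grad (lift c) x) x" for x
  proof -
    have "((\<lambda>s. ln (s + \<epsilon>)) has_real_derivative 1 / (lift c x + \<epsilon>)) (at (lift c x))"
      using V[of x] by (auto intro!: derivative_eq_intros)
    from has_grad_compose[OF this test_functions_has_grad[OF U]] show ?thesis unfolding L_def .
  qed
  have g: "grad L x = (1 / (lift c x + \<epsilon>)) *\<^sub>R grad (lift c) x" for x by (rule has_grad_unique[OF h])
  show "has_grad L (grad L x) x" unfolding g by (rule h)
  have "continuous_on UNIV (\<lambda>x. (1 / (lift c x + \<epsilon>)) *\<^sub>R grad (lift c) x)"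
    using V by (intro continuous_intros test_functions_continuous[OF U] test_functions_continuous_grad[OF U]) (auto simp: less_imp_neq[symmetric])
  moreover have "grad L = (\<lambda>x. (1 / (lift c x + \<epsilon>)) *\<^sub>R grad (lift c) x)" using g by blast
  ultimately show "continuous_on UNIV (grad L)" by simp
  assume x: "x \<noteq> 0"
  have gl: "grad (lift c) x = norm x powr a *\<^sub>R hgrad c x"
    by (rule has_grad_unique[OF has_grad_lift[OF test_functions_has_grad[OF assms(1)] x]])
  show "norm (grad L x) = norm x powr a * norm (hgrad c x) / (lift c x + \<epsilon>)"
    unfolding g gl using V[of x] by simp
qed

text \<open>Weak strong maximum principle on balls: the logarithmic gradient estimate and the Poincare inequality
  bound \<open>measure {u = 0} * measure {u > 0}\<close> by \<open>1 / K\<close> for every \<open>K\<close>.\<close>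

lemma local_dichotomy:
  assumes s: "sol l u" and nn: "AE x in M. 0 \<le> fn u x" and l0: "0 \<le> l" and x0: "x0 \<in> \<Omega> - {0}"
  shows "\<exists>r>0. ball x0 r \<subseteq> \<Omega> - {0} \<and>
    ((AE x in M. x \<in> ball x0 r \<longrightarrow> fn u x = 0) \<or> (AE x in M. x \<in> ball x0 r \<longrightarrow> 0 < fn u x))"
proof -
  have "open (\<Omega> - {0})" using open_Om by (intro open_Diff) auto
  then obtain R where R: "R > 0" "ball x0 R \<subseteq> \<Omega> - {0}" using x0 open_contains_ball by metis
  obtain \<beta> where \<beta>': "smooth_on UNIV \<beta> \<and> (\<forall>x. \<beta> x \<ge> 0) \<and> (\<forall>x. \<beta> x > 0 \<longleftrightarrow> dist x0 x < R / 2)"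
    using bump_exists[of "R / 2" x0] R(1) by auto
  have supp: "closure {x. \<beta> x \<noteq> 0} \<subseteq> cball x0 (R / 2)"
  proof (rule closure_minimal)
    show "{x. \<beta> x \<noteq> 0} \<subseteq> cball x0 (R / 2)"
    proof
      fix x assume "x \<in> {x. \<beta> x \<noteq> 0}"
      then have "\<beta> x > 0" using \<beta>' by (metis less_eq_real_def mem_Collect_eq)
      then have "dist x0 x < R / 2" using \<beta>' by blast
      then show "x \<in> cball x0 (R / 2)" by simp
    qed
  qed simp
  have "cball x0 (R / 2) \<subseteq> ball x0 R" using R(1) by auto
  then have \<beta>D: "\<beta> \<in> \<D>"
    using \<beta>' supp R(2) by (auto simp: test_functions_iff compact_eq_bounded_closed intro: bounded_subset[OF bounded_cball supp])
  \<comment> \<open>Half the radius on which \<beta> is positive, so that the truncated lift of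
    \<beta> has a positive minimum on the closed ball.\<close>
  define \<rho> where "\<rho> = R / 4"
  define B where "B = ball x0 \<rho>"
  have \<rho>: "\<rho> > 0" using R(1) by (simp add: \<rho>_def)
  have Kc: "cball x0 \<rho> \<subseteq> ball x0 R" "cball x0 \<rho> \<subseteq> ball x0 (R / 2)" using R(1) by (auto simp: \<rho>_def)
  have "B \<subseteq> cball x0 \<rho>" by (auto simp: B_def)
  then have BO: "B \<subseteq> \<Omega> - {0}" using Kc(1) R(2) by blast
  have Bm: "B \<in> sets borel" by (simp add: B_def)
  have "\<exists>m>0. \<forall>x\<in>B. m \<le> \<bar>trunc 1 (lift \<beta> x)\<bar>"
  proof -
    have 1: "continuous_on (cball x0 \<rho>) (lift \<beta>)" by (rule test_functions_continuous[OF lift_D[OF \<beta>D]])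
    have 2: "continuous_on UNIV (trunc 1)"
      by (intro continuous_at_imp_continuous_on ballI) (simp add: isCont_def trunc_tendsto)
    have 3: "continuous_on (cball x0 \<rho>) (\<lambda>x. \<bar>trunc 1 (lift \<beta> x)\<bar>)"
      by (rule continuous_on_rabs[OF continuous_on_compose2[OF 2 1 subset_UNIV]])
    have "cball x0 \<rho> \<noteq> {}" using \<rho> by simp
    from continuous_attains_inf[OF compact_cball this 3]
    obtain z where z: "z \<in> cball x0 \<rho>" and zm: "\<forall>x\<in>cball x0 \<rho>. \<bar>trunc 1 (lift \<beta> z)\<bar> \<le> \<bar>trunc 1 (lift \<beta> x)\<bar>" by blast
    have "z \<in> ball x0 (R / 2)" using z Kc(2) by blast
    then have "\<beta> z > 0" using \<beta>' by simp
    moreover have "z \<noteq> 0" using z Kc(1) R(2) by blast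
    ultimately have "lift \<beta> z \<noteq> 0" by (simp add: lift_def)
    then have "\<bar>trunc 1 (lift \<beta> z)\<bar> > 0" using trunc_bounds(5)[of 1 "lift \<beta> z"] by simp
    moreover have "\<forall>x\<in>B. \<bar>trunc 1 (lift \<beta> z)\<bar> \<le> \<bar>trunc 1 (lift \<beta> x)\<bar>" using zm \<open>B \<subseteq> cball x0 \<rho>\<close> by blast
    ultimately show ?thesis by blast
  qed
  then obtain m where m0: "m > 0" and mB: "\<forall>x\<in>B. m \<le> \<bar>trunc 1 (lift \<beta> x)\<bar>" by blast
  note m = m0 mB[rule_format]
  obtain c where c': "\<forall>n::nat. c n \<in> \<D> \<and> (\<forall>x. 0 \<le> c n x)" and c: "(\<lambda>n. emb (c n)) \<longlonglongrightarrow> u"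
    "(\<lambda>n. n2 (\<lambda>x. c n x - fn u x)) \<longlonglongrightarrow> 0" "AE x in M. (\<lambda>n. c n x) \<longlonglongrightarrow> fn u x"
    using nonneg_approx[OF nn] by blast
  have cD: "c n \<in> \<D>" and c0: "0 \<le> c n x" for n x using c' by blast+
  obtain C where C: "\<And>\<epsilon>. \<epsilon> > 0 \<Longrightarrow> \<forall>\<^sub>F n in sequentially.
      (LINT x|M. (trunc 1 (lift \<beta> x) / (lift (c n) x + \<epsilon>))\<^sup>2 * (hgrad (c n) x \<bullet> hgrad (c n) x)) \<le> C"
    using sol_log_bound[OF s nn l0 \<beta>D] c' c by blast
  \<comment> \<open>On \<open>B\<close>, \<open>A\<close> bounds r^(2a) divided by the square of the
    truncated lift of \<beta>. Then \<open>C2\<close> adds the measure of the domain, from y <= 1 +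
    y^2, to pass from the squared gradient of the logarithm to the gradient.\<close>
  define A where "A = (radius powr a / m)\<^sup>2"
  define C2 where "C2 = measure M \<Omega> + A * C"
  define W where "W = (ennreal (2 * \<rho>) * ennreal C2) * emeasure lborel (ball (0::real^'n) (2 * \<rho>))"
  have Wfin: "W < top" unfolding W_def using emeasure_lborel_ball_finite[of "0::real^'n" "2 * \<rho>"]
    by (simp add: ennreal_mult_less_top)
  have fm: "fn u \<in> borel_measurable M" by (rule sqD(1)[OF sq_fn])
  define Z where "Z = {x \<in> \<Omega>. x \<in> B \<and> fn u x = 0}"
  \<comment> \<open>The levels 1/(i+1) exhaust the part of the ball where the lift of u is positive,
    and give a fixed lower bound on each piece.\<close>
  define P where "P i = {x \<in> \<Omega>. x \<in> B \<and> 1 / (real i + 1) \<le> lift (fn u) x}" for i :: nat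
  have lm: "lift (fn u) \<in> borel_measurable M" unfolding lift_def using fm by measurable
  have spM: "space M = \<Omega>" by simp
  have BM: "B \<in> sets lebesgue" using Bm by simp
  have BinM: "{x \<in> space M. x \<in> B} \<in> sets M"
    using BM BO Om_sets by (auto simp: sets_restrict_space_iff Collect_conj_eq[symmetric] intro!: sets.Int)
  have Zm: "Z \<in> sets M"
  proof -
    have "{x \<in> space M. fn u x = 0} \<in> sets M" using fm by measurable
    then have "{x \<in> space M. x \<in> B} \<inter> {x \<in> space M. fn u x = 0} \<in> sets M" using BinM by blast
    moreover have "{x \<in> space M. x \<in> B} \<inter> {x \<in> space M. fn u x = 0} = Z" by (auto simp: Z_def)
    ultimately show ?thesis by simp
  qed
  have Pm: "P i \<in> sets M" for i
  proof -
    have "{x \<in> space M. 1 / (real i + 1) \<le> lift (fn u) x} \<in> sets M" using lm by measurable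
    then have "{x \<in> space M. x \<in> B} \<inter> {x \<in> space M. 1 / (real i + 1) \<le> lift (fn u) x} \<in> sets M" using BinM by blast
    moreover have "{x \<in> space M. x \<in> B} \<inter> {x \<in> space M. 1 / (real i + 1) \<le> lift (fn u) x} = P i" by (auto simp: P_def)
    ultimately show ?thesis by simp
  qed
  let ?mO = "emeasure M \<Omega>"
  have mO: "?mO < top" by (simp add: M.emeasure_finite less_top[symmetric])
  \<comment> \<open>For y in \<open>Z\<close> and x in \<open>P i\<close>, L x - ln \<epsilon> is at
    most |L y - L x| plus L y - ln \<epsilon>. Integrated over both points, the first part is
    bounded by \<open>poincare_ball\<close> independently of \<epsilon>, and the second becomes
    small because the approximants tend to 0 on \<open>Z\<close>.\<close>
  have key: "emeasure M Z * (\<integral>\<^sup>+x. ennreal (ln (lift (fn u) x + \<epsilon>) - ln \<epsilon>) * indicator (P i) x \<partial>M) \<le> W + ?mO"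
    if e: "\<epsilon> > 0" for \<epsilon> i
  proof -
    define L where "L n x = ln (lift (c n) x + \<epsilon>)" for n x
    define p where "p n x = L n x - ln \<epsilon>" for n x
    have V: "lift (c n) x + \<epsilon> \<ge> \<epsilon>" for n x using lift_nonneg[of "c n" x] c0[of n x] by linarith
    have p0: "p n x \<ge> 0" for n x unfolding p_def L_def using V[of n x] e by (simp add: ln_le_cancel_iff)
    have pU: "p n x \<le> lift (c n) x / \<epsilon>" for n x
    proof -
      have "p n x = ln ((lift (c n) x + \<epsilon>) / \<epsilon>)" unfolding p_def L_def using V[of n x] e by (subst ln_div) auto
      also have "\<dots> \<le> (lift (c n) x + \<epsilon>) / \<epsilon> - 1" using V[of n x] e by (intro ln_le_minus_one) (auto intro: divide_pos_pos)
      also have "\<dots> = lift (c n) x / \<epsilon>" using e by (simp add: field_simps)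
      finally show ?thesis .
    qed
    have hg: "has_grad (L n) (grad (L n) x) x" and gc: "continuous_on UNIV (grad (L n))"
      and gn: "x \<noteq> 0 \<Longrightarrow> norm (grad (L n) x) = norm x powr a * norm (hgrad (c n) x) / (lift (c n) x + \<epsilon>)" for n x
      unfolding L_def using log_grad[OF cD c0 e] by blast+
    have Lc: "continuous_on UNIV (L n)" for n
      by (intro continuous_at_imp_continuous_on ballI differentiable_imp_continuous_within has_grad_differentiable[OF hg])
    have Lb: "L n \<in> borel_measurable borel" for n using Lc by (rule borel_measurable_continuous_onI)
    note [measurable] = Lb Bm
    have LM: "L n \<in> borel_measurable M" for n by (rule measurable_continuous[OF continuous_on_subset[OF Lc subset_UNIV]])
    have pM: "p n \<in> borel_measurable M" for n unfolding p_def using LM by measurable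
    have ev1: "\<forall>\<^sub>F n in sequentially. (\<integral>\<^sup>+z. ennreal (norm (grad (L n) z)) * indicator B z \<partial>lborel) \<le> ennreal C2"
      using C[OF e]
    proof eventually_elim
      case (elim n)
      let ?q = "\<lambda>x. (trunc 1 (lift \<beta> x) / (lift (c n) x + \<epsilon>))\<^sup>2 * (hgrad (c n) x \<bullet> hgrad (c n) x)"
      have qi: "integrable M ?q" by (rule tst_form(4)[of "c n" \<beta> \<epsilon> 1, OF cD \<beta>D c0 e]) simp
      have q0: "?q x \<ge> 0" for x by simp
      have gb: "grad (L n) \<in> borel_measurable borel" using gc by (rule borel_measurable_continuous_onI)
      have "(\<integral>\<^sup>+z. ennreal (norm (grad (L n) z)) * indicator B z \<partial>lborel) = (\<integral>\<^sup>+z. ennreal (norm (grad (L n) z)) * indicator B z \<partial>M)"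
        by (rule nn_integral_M_lborel[symmetric]) (use gb Bm BO in auto)
      also have "\<dots> \<le> (\<integral>\<^sup>+z. ennreal (1 + A * ?q z) \<partial>M)"
      proof (rule nn_integral_mono)
        fix z
        show "ennreal (norm (grad (L n) z)) * indicator B z \<le> ennreal (1 + A * ?q z)"
        proof (cases "z \<in> B")
          case True
          define V where "V = lift (c n) z + \<epsilon>"
          define g where "g = norm (hgrad (c n) z) / V"
          have V0: "V > 0" unfolding V_def using V[of n z] e by linarith
          have z: "z \<noteq> 0" "z \<in> \<Omega>" using True BO by auto
          have g0: "g \<ge> 0" using V0 by (simp add: g_def)
          have "norm z powr a \<le> radius powr a" using norm_le_radius[OF z(2)] a_pos by (intro powr_mono2) auto
          then have "norm z powr a * g \<le> radius powr a * g" using g0 by (intro mult_right_mono) auto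
          also have "\<dots> = (radius powr a / m) * (m * g)" using m(1) by simp
          also have "\<dots> \<le> (radius powr a / m) * (\<bar>trunc 1 (lift \<beta> z)\<bar> * g)"
            using m(2)[OF True] g0 m(1) by (intro mult_left_mono mult_right_mono) auto
          finally have "norm (grad (L n) z) \<le> (radius powr a / m) * (\<bar>trunc 1 (lift \<beta> z)\<bar> * g)"
            unfolding gn[OF z(1)] g_def V_def by simp
          also have "\<dots> \<le> 1 + ((radius powr a / m) * (\<bar>trunc 1 (lift \<beta> z)\<bar> * g))\<^sup>2"
          proof -
            have "y \<le> 1 + y\<^sup>2" for y :: real using zero_le_power2[of "y - 1/2"] by (simp add: power2_eq_square algebra_simps)
            then show ?thesis .
          qed
          also have "((radius powr a / m) * (\<bar>trunc 1 (lift \<beta> z)\<bar> * g))\<^sup>2 = A * ((trunc 1 (lift \<beta> z) / V)\<^sup>2 * (norm (hgrad (c n) z))\<^sup>2)"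
            by (simp add: A_def g_def power_mult_distrib power_divide)
          finally show ?thesis using True unfolding V_def power2_norm_eq_inner by (simp add: ennreal_leI)
        qed simp
      qed
      also have "\<dots> = ennreal (LINT z|M. 1 + A * ?q z)"
        using qi by (intro nn_integral_eq_integral) (auto simp: A_def)
      also have "(LINT z|M. 1 + A * ?q z) = measure M \<Omega> + A * (LINT z|M. ?q z)" using qi by simp
      also have "ennreal \<dots> \<le> ennreal C2" unfolding C2_def using elim
        by (intro ennreal_leI add_left_mono mult_left_mono) (auto simp: A_def)
      finally show ?case .
    qed
    define H where "H n x = (\<integral>\<^sup>+y. ennreal \<bar>L n y - L n x\<bar> * indicator B y \<partial>M)" for n x
    have Heq: "H n x = (\<integral>\<^sup>+y. ennreal \<bar>L n y - L n x\<bar> * indicator B y \<partial>lborel)" for n x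
      unfolding H_def by (rule nn_integral_M_lborel) (use Lb Bm BO in auto)
    have Hb: "H n \<in> borel_measurable borel" for n
    proof -
      have "(\<lambda>x. \<integral>\<^sup>+y. ennreal \<bar>L n y - L n x\<bar> * indicator B y \<partial>lborel) \<in> borel_measurable borel"
        using Lb Bm by measurable
      then show ?thesis unfolding Heq[abs_def] .
    qed
    have HW: "\<forall>\<^sub>F n in sequentially. (\<integral>\<^sup>+x. H n x * indicator B x \<partial>M) \<le> W"
      using ev1
    proof eventually_elim
      case (elim n)
      have "(\<integral>\<^sup>+x. H n x * indicator B x \<partial>M) = (\<integral>\<^sup>+x. H n x * indicator B x \<partial>lborel)"
        by (rule nn_integral_M_lborel) (use Hb Bm BO in auto)
      also have "\<dots> = (\<integral>\<^sup>+x. \<integral>\<^sup>+y. ennreal \<bar>L n y - L n x\<bar> * (indicator B x * indicator B y) \<partial>lborel \<partial>lborel)"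
      proof (rule nn_integral_cong)
        fix x
        have m1: "(\<lambda>y. ennreal \<bar>L n y - L n x\<bar> * indicator B y) \<in> borel_measurable lborel"
          by (intro borel_measurable_times_ennreal measurable_compose[OF _ measurable_ennreal] borel_measurable_abs
              borel_measurable_diff borel_measurable_const borel_measurable_indicator) (use Lb Bm in auto)
        have "H n x * indicator B x = (\<integral>\<^sup>+y. ennreal \<bar>L n y - L n x\<bar> * indicator B y * indicator B x \<partial>lborel)"
          unfolding Heq by (rule nn_integral_multc[OF m1, symmetric])
        then show "H n x * indicator B x = (\<integral>\<^sup>+y. ennreal \<bar>L n y - L n x\<bar> * (indicator B x * indicator B y) \<partial>lborel)"
          by (simp add: mult_ac)
      qed
      also have "\<dots> \<le> (ennreal (2 * \<rho>) * (\<integral>\<^sup>+z. ennreal (norm (grad (L n) z)) * indicator B z \<partial>lborel)) * emeasure lborel (ball (0::real^'n) (2 * \<rho>))"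
        unfolding B_def by (rule poincare_ball[OF hg gc])
      also have "\<dots> \<le> W" unfolding W_def by (intro mult_right_mono mult_left_mono elim) auto
      finally show ?case .
    qed
    define S where "S n = (\<integral>\<^sup>+y. ennreal (p n y) * indicator Z y \<partial>M)" for n
    have S1: "\<forall>\<^sub>F n in sequentially. S n \<le> 1"
    proof -
      let ?k = "radius powr a / \<epsilon>"
      have k0: "?k \<ge> 0" using e by simp
      have Sle: "S n \<le> ennreal (?k * (n2 (\<lambda>x. c n x - fn u x) * n2 (\<lambda>_. 1)))" for n
      proof -
        have di: "integrable M (\<lambda>x. \<bar>c n x - fn u x\<bar>)" using sq_integrable[OF sq_diff[OF sq_test[OF cD] sq_fn]] by simp
        have "S n \<le> (\<integral>\<^sup>+y. ennreal (?k * \<bar>c n y - fn u y\<bar>) \<partial>M)"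
          unfolding S_def
        proof (rule nn_integral_mono)
          fix y
          show "ennreal (p n y) * indicator Z y \<le> ennreal (?k * \<bar>c n y - fn u y\<bar>)"
          proof (cases "y \<in> Z")
            case True
            then have y: "y \<in> \<Omega>" "fn u y = 0" by (auto simp: Z_def)
            have "norm y powr a \<le> radius powr a" using norm_le_radius[OF y(1)] a_pos by (intro powr_mono2) auto
            then have "lift (c n) y / \<epsilon> \<le> (radius powr a * c n y) / \<epsilon>"
              unfolding lift_def using c0[of n y] e by (intro divide_right_mono mult_right_mono) auto
            then have "p n y \<le> ?k * \<bar>c n y - fn u y\<bar>" using pU[of n y] y(2) c0[of n y] by simp
            then show ?thesis using True by (simp add: ennreal_leI)
          qed simp
        qed
        also have "\<dots> = ennreal (LINT y|M. ?k * \<bar>c n y - fn u y\<bar>)"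
          using di k0 e by (intro nn_integral_eq_integral integrable_mult_right) auto
        also have "(LINT y|M. ?k * \<bar>c n y - fn u y\<bar>) = ?k * (LINT y|M. \<bar>c n y - fn u y\<bar>)" by (rule integral_mult_right_zero)
        also have "ennreal \<dots> \<le> ennreal (?k * (n2 (\<lambda>x. c n x - fn u x) * n2 (\<lambda>_. 1)))"
          using L1_le_n2[OF sq_diff[OF sq_test[OF cD] sq_fn]] k0 by (intro ennreal_leI mult_left_mono) auto
        finally show ?thesis .
      qed
      have "(\<lambda>n. ?k * (n2 (\<lambda>x. c n x - fn u x) * n2 (\<lambda>_. 1))) \<longlonglongrightarrow> ?k * (0 * n2 (\<lambda>_. 1))"
        by (intro tendsto_mult_left tendsto_mult_right c(2))
      then have "\<forall>\<^sub>F n in sequentially. ?k * (n2 (\<lambda>x. c n x - fn u x) * n2 (\<lambda>_. 1)) < 1"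
        by (rule order_tendstoD) simp
      then show ?thesis
      proof eventually_elim
        case (elim n)
        have "ennreal (?k * (n2 (\<lambda>x. c n x - fn u x) * n2 (\<lambda>_. 1))) \<le> ennreal 1" using elim by (intro ennreal_leI) simp
        from order_trans[OF Sle[of n] this] show ?case by (simp only: ennreal_1)
      qed
    qed
    have ev: "\<forall>\<^sub>F n in sequentially. (\<integral>\<^sup>+x. emeasure M Z * (ennreal (p n x) * indicator (P i) x) \<partial>M) \<le> W + ?mO"
      using HW S1
    proof eventually_elim
      case (elim n)
      have pw: "emeasure M Z * (ennreal (p n x) * indicator (P i) x) \<le> H n x * indicator B x + S n" if "x \<in> space M" for x
      proof (cases "x \<in> P i")
        case True
        then have xB: "x \<in> B" by (simp add: P_def)
        have "emeasure M Z * ennreal (p n x) = (\<integral>\<^sup>+y. ennreal (p n x) * indicator Z y \<partial>M)"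
          unfolding nn_integral_cmult_indicator[OF Zm] by (rule mult.commute)
        also have "\<dots> \<le> (\<integral>\<^sup>+y. ennreal \<bar>L n y - L n x\<bar> * indicator B y + ennreal (p n y) * indicator Z y \<partial>M)"
        proof (rule nn_integral_mono)
          fix y
          show "ennreal (p n x) * indicator Z y \<le> ennreal \<bar>L n y - L n x\<bar> * indicator B y + ennreal (p n y) * indicator Z y"
          proof (cases "y \<in> Z")
            case True
            have "ennreal (p n x) \<le> ennreal (\<bar>L n y - L n x\<bar> + p n y)" by (intro ennreal_leI) (simp add: p_def)
            then show ?thesis using True p0[of n y] by (simp add: Z_def ennreal_plus)
          qed simp
        qed
        also have "\<dots> = H n x + S n" unfolding H_def S_def
        proof (rule nn_integral_add)
          have "(\<lambda>y. ennreal \<bar>L n y - L n x\<bar> * indicator B y) \<in> borel_measurable borel"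
            by (intro borel_measurable_times_ennreal measurable_compose[OF _ measurable_ennreal] borel_measurable_abs
                borel_measurable_diff borel_measurable_const borel_measurable_indicator Lb Bm)
          then show "(\<lambda>y. ennreal \<bar>L n y - L n x\<bar> * indicator B y) \<in> borel_measurable M" by (rule borel_to_M)
          show "(\<lambda>y. ennreal (p n y) * indicator Z y) \<in> borel_measurable M"
            by (intro borel_measurable_times_ennreal measurable_compose[OF _ measurable_ennreal] pM borel_measurable_indicator Zm)
        qed
        finally show ?thesis using True xB by simp
      qed simp
      have "(\<integral>\<^sup>+x. emeasure M Z * (ennreal (p n x) * indicator (P i) x) \<partial>M) \<le> (\<integral>\<^sup>+x. H n x * indicator B x + S n \<partial>M)"
        by (rule nn_integral_mono) (rule pw)
      also have "\<dots> = (\<integral>\<^sup>+x. H n x * indicator B x \<partial>M) + (\<integral>\<^sup>+x. S n \<partial>M)"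
      proof (rule nn_integral_add)
        have "(\<lambda>x. H n x * indicator B x) \<in> borel_measurable borel" using Hb Bm by measurable
        then show "(\<lambda>x. H n x * indicator B x) \<in> borel_measurable M" by (rule borel_to_M)
      qed simp
      also have "(\<integral>\<^sup>+x. S n \<partial>M) = S n * ?mO" by simp
      also have "(\<integral>\<^sup>+x. H n x * indicator B x \<partial>M) + S n * ?mO \<le> W + 1 * ?mO"
        using elim by (intro add_mono mult_right_mono) auto
      finally show ?case by simp
    qed
    let ?z = "emeasure M Z"
    have zfin: "?z < top" by (simp add: M.emeasure_finite less_top[symmetric])
    have PM: "(\<lambda>x. indicator (P i) x :: ennreal) \<in> borel_measurable M" using Pm by (rule borel_measurable_indicator)
    have um: "(\<lambda>x. ennreal (ln (lift (fn u) x + \<epsilon>) - ln \<epsilon>) * indicator (P i) x) \<in> borel_measurable M"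
      by (intro borel_measurable_times_ennreal PM measurable_compose[OF _ measurable_ennreal]) (use lm in measurable)
    have "?z * (\<integral>\<^sup>+x. ennreal (ln (lift (fn u) x + \<epsilon>) - ln \<epsilon>) * indicator (P i) x \<partial>M) =
      (\<integral>\<^sup>+x. ?z * (ennreal (ln (lift (fn u) x + \<epsilon>) - ln \<epsilon>) * indicator (P i) x) \<partial>M)"
      by (rule nn_integral_cmult[symmetric, OF um])
    also have "\<dots> \<le> (\<integral>\<^sup>+x. liminf (\<lambda>n. ?z * (ennreal (p n x) * indicator (P i) x)) \<partial>M)"
    proof (rule nn_integral_mono_AE)
      show "AE x in M. ?z * (ennreal (ln (lift (fn u) x + \<epsilon>) - ln \<epsilon>) * indicator (P i) x) \<le> liminf (\<lambda>n. ?z * (ennreal (p n x) * indicator (P i) x))"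
        using c(3) nn
      proof eventually_elim
        case (elim x)
        show ?case
        proof (cases "x \<in> P i")
          case True
          have "lift (fn u) x + \<epsilon> \<noteq> 0" using lift_nonneg[of "fn u" x] elim(2) e by linarith
          then have "(\<lambda>n. p n x) \<longlonglongrightarrow> ln (lift (fn u) x + \<epsilon>) - ln \<epsilon>"
            unfolding p_def L_def lift_def by (intro tendsto_intros elim(1))
          then have "(\<lambda>n. ?z * ennreal (p n x)) \<longlonglongrightarrow> ?z * ennreal (ln (lift (fn u) x + \<epsilon>) - ln \<epsilon>)"
            by (intro ennreal_tendsto_cmult zfin tendsto_ennrealI)
          from lim_imp_Liminf[OF _ this] show ?thesis using True by simp
        qed simp
      qed
    qed
    also have "\<dots> \<le> liminf (\<lambda>n. \<integral>\<^sup>+x. ?z * (ennreal (p n x) * indicator (P i) x) \<partial>M)"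
      by (intro nn_integral_liminf borel_measurable_times_ennreal borel_measurable_const measurable_compose[OF _ measurable_ennreal] pM PM)
    also have "\<dots> \<le> W + ?mO" by (rule Liminf_le[OF _ ev]) simp
    finally show ?thesis .
  qed
  have null: "measure M Z * measure M (P i) = 0" for i
  proof (rule ccontr)
    assume ne: "measure M Z * measure M (P i) \<noteq> 0"
    then have pos: "measure M Z * measure M (P i) > 0" by (simp add: zero_less_mult_iff measure_nonneg order_less_le)
    define w where "w = enn2real (W + ?mO)"
    have w: "W + ?mO = ennreal w" unfolding w_def using Wfin mO by (simp add: less_top)
    have w0: "w \<ge> 0" by (simp add: w_def)
    \<comment> \<open>\<open>K\<close> exceeds by 1 the largest value that \<open>key\<close>
      permits, and \<epsilon> = exp(-K)/(i+1) makes the logarithmic increment at least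
      \<open>K\<close> on \<open>P i\<close>.\<close>
    define K where "K = w / (measure M Z * measure M (P i)) + 1"
    have K0: "K > 0" using w0 pos by (simp add: K_def add_nonneg_pos)
    define \<epsilon> where "\<epsilon> = exp (- K) / (real i + 1)"
    have e: "\<epsilon> > 0" by (simp add: \<epsilon>_def)
    have ge: "ennreal K * indicator (P i) x \<le> ennreal (ln (lift (fn u) x + \<epsilon>) - ln \<epsilon>) * indicator (P i) x" for x
    proof (cases "x \<in> P i")
      case True
      then have "1 / (real i + 1) \<le> lift (fn u) x + \<epsilon>" using e by (simp add: P_def)
      then have "ln (1 / (real i + 1)) \<le> ln (lift (fn u) x + \<epsilon>)"
        by (subst ln_le_cancel_iff) (auto intro: less_le_trans[of 0 "1 / (real i + 1)"])
      moreover have "ln \<epsilon> = ln (1 / (real i + 1)) - K" unfolding \<epsilon>_def by (simp add: ln_div)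
      ultimately have "K \<le> ln (lift (fn u) x + \<epsilon>) - ln \<epsilon>" by linarith
      then show ?thesis using True by (simp add: ennreal_leI)
    qed simp
    have "ennreal (measure M Z * (K * measure M (P i))) = emeasure M Z * (ennreal K * emeasure M (P i))"
      using K0 by (simp add: M.emeasure_eq_measure ennreal_mult)
    also have "\<dots> = emeasure M Z * (\<integral>\<^sup>+x. ennreal K * indicator (P i) x \<partial>M)"
      using Pm by (simp add: nn_integral_cmult_indicator)
    also have "\<dots> \<le> emeasure M Z * (\<integral>\<^sup>+x. ennreal (ln (lift (fn u) x + \<epsilon>) - ln \<epsilon>) * indicator (P i) x \<partial>M)"
      by (intro mult_left_mono nn_integral_mono ge) auto
    also have "\<dots> \<le> ennreal w" using key[OF e] unfolding w .
    finally have "measure M Z * (K * measure M (P i)) \<le> w" using w0 by (simp add: ennreal_le_iff)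
    moreover have "measure M Z * (K * measure M (P i)) = w + measure M Z * measure M (P i)"
      unfolding K_def using ne by (simp add: field_simps)
    ultimately show False using pos by linarith
  qed
  show ?thesis
  proof (intro exI[of _ \<rho>] conjI)
    show "\<rho> > 0" by (rule \<rho>)
    show "ball x0 \<rho> \<subseteq> \<Omega> - {0}" using BO by (simp add: B_def)
    show "(AE x in M. x \<in> ball x0 \<rho> \<longrightarrow> fn u x = 0) \<or> (AE x in M. x \<in> ball x0 \<rho> \<longrightarrow> 0 < fn u x)"
    proof (cases "measure M Z = 0")
      case True
      then have "AE x in M. x \<notin> Z" using Zm by (intro AE_not_in) (simp add: null_sets_def M.emeasure_eq_measure)
      moreover have "AE x in M. x \<in> space M" by (rule AE_space)
      ultimately have "AE x in M. x \<in> ball x0 \<rho> \<longrightarrow> 0 < fn u x"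
        using nn by eventually_elim (auto simp: Z_def B_def)
      then show ?thesis ..
    next
      case False
      then have "measure M (P i) = 0" for i using null[of i] by simp
      then have "AE x in M. x \<notin> P i" for i using Pm by (intro AE_not_in) (simp add: null_sets_def M.emeasure_eq_measure)
      then have "AE x in M. \<forall>i. x \<notin> P i" by (simp add: AE_all_countable)
      moreover have "AE x in M. x \<in> space M" by (rule AE_space)
      ultimately have "AE x in M. x \<in> ball x0 \<rho> \<longrightarrow> fn u x = 0"
        using nn AE_nonzero
      proof eventually_elim
        case (elim x)
        show ?case
        proof
          assume xB: "x \<in> ball x0 \<rho>"
          show "fn u x = 0"
          proof (rule ccontr)
            assume "fn u x \<noteq> 0"
            then have "lift (fn u) x > 0" using elim(3,4) by (simp add: lift_def)
            then obtain i :: nat where "1 / (real i + 1) < lift (fn u) x"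
              using reals_Archimedean[of "lift (fn u) x"] by (auto simp: inverse_eq_divide add.commute)
            then have "x \<in> P i" using xB elim(2) by (simp add: P_def B_def)
            then show False using elim(1) by blast
          qed
        qed
      qed
      then show ?thesis ..
    qed
  qed
qed

text \<open>By Lindelof's theorem countably many of the balls cover the punctured domain, and the
  origin is a null set.\<close>

lemma AE_local:
  assumes "\<And>x. x \<in> \<Omega> - {0} \<Longrightarrow> \<exists>r>0. AE y in M. y \<in> ball x r \<longrightarrow> Q y"
  shows "AE y in M. Q y"
proof -
  obtain r where r: "\<And>x. x \<in> \<Omega> - {0} \<Longrightarrow> r x > 0 \<and> (AE y in M. y \<in> ball x (r x) \<longrightarrow> Q y)" using assms by metis
  let ?F = "(\<lambda>x. ball x (r x)) ` (\<Omega> - {0})"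
  have "\<exists>F'. F' \<subseteq> ?F \<and> countable F' \<and> \<Union>F' = \<Union>?F" using Lindelof[of ?F] by (metis (no_types, lifting) imageE open_ball)
  then obtain F' where F': "F' \<subseteq> ?F" "countable F'" "\<Union>F' = \<Union>?F" by blast
  have "AE y in M. \<forall>S\<in>F'. y \<in> S \<longrightarrow> Q y"
    unfolding AE_ball_countable[OF F'(2)] using F'(1) r by blast
  moreover have "AE x in M. x \<in> space M" by (rule AE_space)
  ultimately show ?thesis using AE_nonzero
  proof eventually_elim
    case (elim y)
    then have "y \<in> \<Omega> - {0}" by simp
    from r[OF this] have "y \<in> ball y (r y)" by simp
    then have "y \<in> \<Union>?F" using \<open>y \<in> \<Omega> - {0}\<close> by blast
    then show ?case using elim(1) F'(3) by blast
  qed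
qed

text \<open>All from the energy identity: a positive norm forces l > 0 and a nonzero function, and a
  vanishing energy integral would make that function vanish a.e.\<close>

lemma nnsol_facts:
  assumes "nnsol l u"
  shows "sol l u" "AE x in M. 0 \<le> fn u x" "0 < l" "0 < n2 (fn u)" "0 < (LINT x|M. nl (fn u x) * fn u x)"
proof -
  show s: "sol l u" and "AE x in M. 0 \<le> fn u x"
    using assms unfolding nontrivial_nonneg_solution_def by blast+
  have u: "(norm u)\<^sup>2 > 0" using assms unfolding nontrivial_nonneg_solution_def by simp
  note E = sol_energy[OF s]
  have p: "0 < l * (n2 (fn u))\<^sup>2" using u E(2,3) by linarith
  then show l: "0 < l" by (metis mult_nonpos_nonneg not_less zero_le_power2)
  show n: "0 < n2 (fn u)" using p n2_nonneg[of "fn u"] by (cases "n2 (fn u) = 0") auto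
  show "0 < (LINT x|M. nl (fn u x) * fn u x)"
  proof (rule ccontr)
    assume "\<not> 0 < (LINT x|M. nl (fn u x) * fn u x)"
    then have "(LINT x|M. nl (fn u x) * fn u x) = 0" using E(3) by simp
    then have "AE x in M. nl (fn u x) * fn u x = 0"
      using integral_nonneg_eq_0_iff_AE[OF E(1)] nl_self_nonneg by simp
    then have "AE x in M. (fn u x)\<^sup>2 = 0" by eventually_elim (auto simp: nl_def)
    then have "(LINT x|M. (fn u x)\<^sup>2) = 0" by (rule integral_eq_zero_AE)
    then show False using n by (simp add: n2_def)
  qed
qed

text \<open>The punctured domain is the union of two open sets, the points near which u is positive
  a.e. and those near which it vanishes a.e. They are disjoint because balls have positive measure,
  and removing a point keeps the domain connected in this dimension. Vanishing everywhere would
  contradict the positive L^2 norm.\<close>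

lemma nnsol_positive:
  assumes "nnsol l u" "connected \<Omega>"
  shows "AE x in M. 0 < fn u x"
proof -
  note F = nnsol_facts[OF assms(1)]
  let ?S = "\<Omega> - {0}"
  let ?p = "\<lambda>x r. AE y in M. y \<in> ball x r \<longrightarrow> 0 < fn u y"
  let ?z = "\<lambda>x r. AE y in M. y \<in> ball x r \<longrightarrow> fn u y = 0"
  define A where "A = {x \<in> ?S. \<exists>r>0. ball x r \<subseteq> ?S \<and> ?p x r}"
  define B where "B = {x \<in> ?S. \<exists>r>0. ball x r \<subseteq> ?S \<and> ?z x r}"
  have S: "?S = A \<union> B"
    using local_dichotomy[OF F(1,2) less_imp_le[OF F(3)]] unfolding A_def B_def by blast
  have sub: "ball y (r - dist x y) \<subseteq> ball x r" for x y :: "real^'n" and r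
  proof
    fix z assume "z \<in> ball y (r - dist x y)"
    then show "z \<in> ball x r" using dist_triangle[of x z y] by simp
  qed
  have opn: "open {x \<in> ?S. \<exists>r>0. ball x r \<subseteq> ?S \<and> (AE y in M. y \<in> ball x r \<longrightarrow> Q y)}" for Q
    unfolding open_contains_ball
  proof
    fix x assume "x \<in> {x \<in> ?S. \<exists>r>0. ball x r \<subseteq> ?S \<and> (AE y in M. y \<in> ball x r \<longrightarrow> Q y)}"
    then obtain r where r: "r > 0" "ball x r \<subseteq> ?S" "AE y in M. y \<in> ball x r \<longrightarrow> Q y" by blast
    have "ball x r \<subseteq> {x \<in> ?S. \<exists>r>0. ball x r \<subseteq> ?S \<and> (AE y in M. y \<in> ball x r \<longrightarrow> Q y)}"
    proof
      fix y assume y: "y \<in> ball x r"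
      have "AE z in M. z \<in> ball y (r - dist x y) \<longrightarrow> Q z" using r(3) sub[of y r x] by (auto elim!: eventually_mono)
      moreover have "r - dist x y > 0" using y by simp
      moreover have "ball y (r - dist x y) \<subseteq> ?S" using sub[of y r x] r(2) by blast
      ultimately show "y \<in> {x \<in> ?S. \<exists>r>0. ball x r \<subseteq> ?S \<and> (AE y in M. y \<in> ball x r \<longrightarrow> Q y)}" using y r(2) by blast
    qed
    then show "\<exists>e>0. ball x e \<subseteq> {x \<in> ?S. \<exists>r>0. ball x r \<subseteq> ?S \<and> (AE y in M. y \<in> ball x r \<longrightarrow> Q y)}" using r(1) by blast
  qed
  have oA: "open A" and oB: "open B" unfolding A_def B_def by (rule opn)+
  have disj: "A \<inter> B = {}"
  proof (rule ccontr)
    assume "A \<inter> B \<noteq> {}"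
    then obtain x r1 r2 where x: "r1 > 0" "ball x r1 \<subseteq> ?S" "?p x r1" "r2 > 0" "?z x r2" unfolding A_def B_def by blast
    define r where "r = min r1 r2"
    have r: "r > 0" "ball x r \<subseteq> \<Omega>" using x by (auto simp: r_def)
    have "AE y in M. y \<notin> ball x r" using x(3,5) by eventually_elim (auto simp: r_def)
    then have n: "ball x r \<inter> \<Omega> \<in> null_sets M"
      using r(2) by (subst (asm) AE_iff_null_sets[symmetric])
        (auto simp: sets_restrict_space_iff Om_sets Int_absorb2)
    then have "emeasure lebesgue (ball x r) = 0"
      using r(2) Om_sets by (simp add: null_sets_def emeasure_restrict_space Int_absorb2)
    then have "measure lebesgue (ball x r) = 0" by (simp add: measure_def)
    then show False using content_ball_pos[OF r(1), of x] by simp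
  qed
  have "connected ?S"
    by (rule connected_open_delete[OF open_Om assms(2)]) (use dim in simp)
  then have "A = {} \<or> B = {}"
    using connectedD[of ?S A B] oA oB disj S by blast
  then show ?thesis
  proof
    assume "A = {}"
    then have "AE y in M. fn u y = 0"
      by (intro AE_local) (use S B_def in blast)
    then have "AE x in M. (fn u x)\<^sup>2 = 0" by eventually_elim simp
    then have "(LINT x|M. (fn u x)\<^sup>2) = 0" by (rule integral_eq_zero_AE)
    then show ?thesis using F(4) by (simp add: n2_def)
  next
    assume "B = {}"
    then show ?thesis by (intro AE_local) (use S A_def in blast)
  qed
qed

section \<open>Properties of the global branch\<close>

lemma nnsol_unique: "nnsol l u \<Longrightarrow> nnsol l v \<Longrightarrow> connected \<Omega> \<Longrightarrow> u = v"
  by (rule positive_unique[OF nnsol_facts(1) nnsol_facts(1) nnsol_positive nnsol_positive])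

text \<open>The branch lies in the closure of the solution set, so its points are limits of
  solutions. Nontriviality is the only property that may be lost in such a limit.\<close>

lemma branch_nnsol:
  assumes "(l, u) \<in> global_branch \<Omega> emb \<gamma>" "u \<noteq> 0"
  shows "nnsol l u"
proof -
  have "(l, u) \<in> closure {(l, u). nnsol l u}"
    using assms(1) connected_component_subset unfolding global_branch_def by blast
  then obtain s where s: "\<forall>n. s n \<in> {(l, u). nnsol l u}" "s \<longlonglongrightarrow> (l, u)"
    unfolding closure_sequential by blast
  have n: "nnsol (fst (s n)) (snd (s n))" for n using s(1) by (auto simp: case_prod_beta)
  have "(\<lambda>n. fst (s n)) \<longlonglongrightarrow> l" "(\<lambda>n. snd (s n)) \<longlonglongrightarrow> u" using tendsto_fst[OF s(2)] tendsto_snd[OF s(2)] by simp_all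
  note C = sol_closed[OF nnsol_facts(1)[OF n] nnsol_facts(2)[OF n] this]
  show ?thesis unfolding nontrivial_nonneg_solution_def using C assms(2) by blast
qed

text \<open>By the energy identity the Rayleigh quotient of u is l minus the energy integral over
  the squared L^2 norm, and both of these are positive.\<close>

lemma nnsol_gt_lambda1:
  assumes "nnsol l u" shows "lambda1 \<Omega> emb < l"
proof -
  note F = nnsol_facts[OF assms]
  let ?Q = "{(norm \<phi>)\<^sup>2 / (LINT x:\<Omega>|lebesgue. (fn \<phi> x)\<^sup>2) | \<phi>. \<phi> \<noteq> 0}"
  have q: "(LINT x:\<Omega>|lebesgue. (fn \<phi> x)\<^sup>2) = (n2 (fn \<phi>))\<^sup>2" for \<phi> unfolding set_lint_M n2_sq ..
  have "lambda1 \<Omega> emb \<le> (norm u)\<^sup>2 / (n2 (fn u))\<^sup>2"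
    unfolding lambda1_def
  proof (rule cInf_lower)
    show "(norm u)\<^sup>2 / (n2 (fn u))\<^sup>2 \<in> ?Q"
      using assms unfolding nontrivial_nonneg_solution_def q by blast
    show "bdd_below ?Q" unfolding q by (rule bdd_belowI[of _ 0]) auto
  qed
  also have "\<dots> < l" using sol_energy(2)[OF F(1)] F(4,5) by (simp add: pos_divide_less_eq)
  finally show ?thesis .
qed

text \<open>By the energy identity the squared norm is the integral of (l - s^(2\<gamma>)) s^2 with
  s = |u|. This is positive only where s^(2\<gamma>) < l <= K, so that s^2 is at most
  K^(1/\<gamma>), and the domain has finite measure.\<close>

lemma nnsol_norm_bound:
  assumes "nnsol l u" "l \<le> K" "0 < K"
  shows "(norm u)\<^sup>2 \<le> K * (K powr (1 / \<gamma>)) * measure M \<Omega>"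
proof -
  note F = nnsol_facts[OF assms(1)]
  note E = sol_energy[OF F(1)]
  have i: "integrable M (\<lambda>x. l * (fn u x)\<^sup>2 - nl (fn u x) * fn u x)"
    by (intro Bochner_Integration.integrable_diff integrable_mult_right sqD(2)[OF sq_fn] E(1))
  have "(norm u)\<^sup>2 = (LINT x|M. l * (fn u x)\<^sup>2 - nl (fn u x) * fn u x)"
    unfolding E(2) n2_sq using sqD(2)[OF sq_fn[of u]] E(1) by simp
  also have "\<dots> \<le> (LINT x|M. K * (K powr (1 / \<gamma>)))"
  proof (rule integral_mono[OF i])
    fix x
    define s where "s = \<bar>fn u x\<bar>"
    have e: "l * (fn u x)\<^sup>2 - nl (fn u x) * fn u x = (l - s powr (2 * \<gamma>)) * s\<^sup>2"
      by (simp add: s_def nl_def power2_eq_square algebra_simps)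
    show "l * (fn u x)\<^sup>2 - nl (fn u x) * fn u x \<le> K * (K powr (1 / \<gamma>))"
    proof (cases "s powr (2 * \<gamma>) \<le> K")
      case True
      have s0: "s \<ge> 0" by (simp add: s_def)
      have "(s powr (2 * \<gamma>)) powr (1 / \<gamma>) \<le> K powr (1 / \<gamma>)" using True \<gamma>_pos by (intro powr_mono2) auto
      then have "s powr 2 \<le> K powr (1 / \<gamma>)" using \<gamma>_pos by (simp add: powr_powr)
      then have s2: "s\<^sup>2 \<le> K powr (1 / \<gamma>)" using s0 by (cases "s = 0") auto
      have "l - s powr (2 * \<gamma>) \<le> K" using assms(2) powr_ge_zero[of s "2 * \<gamma>"] by linarith
      then have "(l - s powr (2 * \<gamma>)) * s\<^sup>2 \<le> K * s\<^sup>2" by (intro mult_right_mono) auto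
      also have "\<dots> \<le> K * (K powr (1 / \<gamma>))" using s2 assms(3) by (intro mult_left_mono) auto
      finally show ?thesis unfolding e .
    next
      case False
      then have "(l - s powr (2 * \<gamma>)) * s\<^sup>2 \<le> 0" using assms(2) by (intro mult_nonpos_nonneg) auto
      also have "0 \<le> K * (K powr (1 / \<gamma>))" using assms(3) by simp
      finally show ?thesis unfolding e .
    qed
  qed simp
  also have "\<dots> = K * (K powr (1 / \<gamma>)) * measure M \<Omega>" by simp
  finally show ?thesis .
qed

lemma branch_bounded:
  assumes "L > 0"
  shows "bounded {u. \<exists>l. (l, u) \<in> global_branch \<Omega> emb \<gamma> \<and> \<bar>l\<bar> \<le> L}"
proof -
  define b where "b = sqrt (L * (L powr (1 / \<gamma>)) * measure M \<Omega>)"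
  have "norm u \<le> b" if "(l, u) \<in> global_branch \<Omega> emb \<gamma>" "\<bar>l\<bar> \<le> L" for l u
  proof (cases "u = 0")
    case True
    then show ?thesis using assms by (simp add: b_def)
  next
    case False
    show ?thesis unfolding b_def
      by (rule real_le_rsqrt, rule nnsol_norm_bound[OF branch_nnsol[OF that(1) False] _ assms]) (use that(2) in simp)
  qed
  then show ?thesis unfolding bounded_iff by blast
qed

end

theorem proposition1p2:
  fixes \<Omega> :: "(real^'n::finite) set"
    and \<mu> q \<gamma> :: real
    and emb :: "(real^'n \<Rightarrow> real) \<Rightarrow> 'h::{real_inner,complete_space}"
  assumes "CARD('n) \<ge> 3"
    and "open \<Omega>" and "connected \<Omega>" and "bounded \<Omega>" and "0 \<in> \<Omega>"
    and "0 < \<mu>" and "\<mu> \<le> hardy_const CARD('n)"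
    and "2 * real CARD('n) / (real CARD('n) + 2) < q" and "q < 2"
    and "0 < \<gamma>"
    and "\<gamma> \<le> (real CARD('n) * q - 2 * real CARD('n) + 2 * q) / (2 * (real CARD('n) - q))"
    and "is_H_mu \<Omega> \<mu> emb"
  shows "((\<forall>l u. (l, u) \<in> global_branch \<Omega> emb \<gamma> \<and> u \<noteq> 0 \<longrightarrow> lambda1 \<Omega> emb < l) \<and>
          (\<forall>L>0. bounded {u. \<exists>l. (l, u) \<in> global_branch \<Omega> emb \<gamma> \<and> \<bar>l\<bar> \<le> L})) \<and>
         (\<forall>l u. (l, u) \<in> global_branch \<Omega> emb \<gamma> \<and> u \<noteq> 0 \<longrightarrow>
            nontrivial_nonneg_solution \<Omega> emb \<gamma> l u \<and>
            (\<forall>v. nontrivial_nonneg_solution \<Omega> emb \<gamma> l v \<longrightarrow> v = u))"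
proof -
  interpret hardy_problem \<Omega> \<mu> emb \<gamma>
    by unfold_locales (use assms in auto)
  show ?thesis
    using branch_nnsol nnsol_gt_lambda1 branch_bounded nnsol_unique[OF _ _ assms(3)] by blast
qed

end
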